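(* Let $\alpha\ge-1$, $0<p<\infty$, $m\in\mathbb{N}$, $n\in\mathbb{N}$ with $n\ge2$, and $s=\frac mn+1$. Then there is a constant $C>0$ independent of $g$ such that $$\|S_g^mT_g^n\|_{\alpha,p}\le C\|g\|^{sn}_{\mathscr{B}^s_\alpha}\qquad(g\in\mathcal{H}(\mathbb{D})).$$
   Context: $\mathbb{D}$ unit disc, $\mathcal{H}(\mathbb{D})$ analytic functions, $dA$ normalized area measure. For $\alpha>-1$, $A^p_\alpha$ is the set of $f\in\mathcal{H}(\mathbb{D})$ with $\|f\|_{\alpha,p}^p=(\alpha+1)\int_{\mathbb{D}}|f|^p(1-|z|^2)^\alpha dA<\infty$; $A^p_{-1}=H^p$ with the Hardy norm. $T_gf(z)=\int_0^zfg'$, $S_gf(z)=\int_0^zf'g$. $\|L\|_{\alpha,p}=\sup\{\|Lf\|_{\alpha,p}:f\in A^p_\alpha,\|f\|_{\alpha,p}\le1\}$. $|\nabla\psi|(z)=\limsup_{w\to z}|\psi(w)-\psi(z)|/|w-z|$, $\phi_a(z)=\frac{a-z}{1-\bar az}$. For $q\ge1$, $\|g\|_{\mathscr{B}^q}^q=\sup_z(1-|z|^2)|\nabla|g|^q|(z)$, $\|g\|_{BMOA^q}^{2q}=\sup_a\int_{\mathbb{D}}(1-|\phi_a|^2)|\nabla|g|^q|^2dA$; $\|\cdot\|_{\mathscr{B}^q_\alpha}=\|\cdot\|_{\mathscr{B}^q}$ for $\alpha>-1$ and $=\|\cdot\|_{BMOA^q}$ for $\alpha=-1$. *)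

theory Defs
  imports "HOL-Complex_Analysis.Complex_Analysis"
begin

definition enn_root :: "real \<Rightarrow> ennreal \<Rightarrow> ennreal" where
  "enn_root q x = (if x = \<infinity> then \<infinity> else ennreal (enn2real x powr (1 / q)))"

definition hardy_pow :: "real \<Rightarrow> (complex \<Rightarrow> complex) \<Rightarrow> ennreal" where
  "hardy_pow p f = (SUP r\<in>{0<..<1::real}.
     ennreal (1 / (2 * pi)) *
     (\<integral>\<^sup>+ t. indicator {0..2*pi} t * ennreal (cmod (f (complex_of_real r * exp (\<i> * complex_of_real t))) powr p) \<partial>lborel))"

text \<open>p-th power of the weighted Bergman norm; \<open>dA = dLebesgue/\<pi>\<close>.\<close>
definition bergman_pow :: "real \<Rightarrow> real \<Rightarrow> (complex \<Rightarrow> complex) \<Rightarrow> ennreal" where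
  "bergman_pow \<alpha> p f = ennreal ((\<alpha> + 1) / pi) *
     (\<integral>\<^sup>+ z. indicator (ball 0 1) z * ennreal (cmod (f z) powr p * (1 - (cmod z)\<^sup>2) powr \<alpha>) \<partial>lborel)"

text \<open>\<open>\<parallel>f\<parallel>_{\<alpha>,p}\<close>, with \<open>A^p_{-1} = H^p\<close>.\<close>
definition Apnorm :: "real \<Rightarrow> real \<Rightarrow> (complex \<Rightarrow> complex) \<Rightarrow> ennreal" where
  "Apnorm \<alpha> p f = enn_root p (if \<alpha> = -1 then hardy_pow p f else bergman_pow \<alpha> p f)"

definition in_Ap :: "real \<Rightarrow> real \<Rightarrow> (complex \<Rightarrow> complex) \<Rightarrow> bool" where
  "in_Ap \<alpha> p f \<longleftrightarrow> f holomorphic_on ball 0 1 \<and> Apnorm \<alpha> p f < \<infinity>"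

definition opnorm :: "real \<Rightarrow> real \<Rightarrow> ((complex \<Rightarrow> complex) \<Rightarrow> (complex \<Rightarrow> complex)) \<Rightarrow> ennreal" where
  "opnorm \<alpha> p L = (SUP f\<in>{f. in_Ap \<alpha> p f \<and> Apnorm \<alpha> p f \<le> 1}. Apnorm \<alpha> p (L f))"

definition T_op :: "(complex \<Rightarrow> complex) \<Rightarrow> (complex \<Rightarrow> complex) \<Rightarrow> (complex \<Rightarrow> complex)" where
  "T_op g f = (\<lambda>z. contour_integral (linepath 0 z) (\<lambda>w. f w * deriv g w))"

definition S_op :: "(complex \<Rightarrow> complex) \<Rightarrow> (complex \<Rightarrow> complex) \<Rightarrow> (complex \<Rightarrow> complex)" where
  "S_op g f = (\<lambda>z. contour_integral (linepath 0 z) (\<lambda>w. deriv f w * g w))"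

definition grad_abs :: "(complex \<Rightarrow> real) \<Rightarrow> complex \<Rightarrow> ennreal" where
  "grad_abs \<psi> z = Limsup (at z) (\<lambda>w. ennreal (\<bar>\<psi> w - \<psi> z\<bar> / cmod (w - z)))"

definition disc_auto :: "complex \<Rightarrow> complex \<Rightarrow> complex" where
  "disc_auto a z = (a - z) / (1 - cnj a * z)"

definition bloch_q_norm :: "real \<Rightarrow> (complex \<Rightarrow> complex) \<Rightarrow> ennreal" where
  "bloch_q_norm q g = enn_root q
     (SUP z\<in>ball 0 1. ennreal (1 - (cmod z)\<^sup>2) * grad_abs (\<lambda>w. cmod (g w) powr q) z)"

definition bmoa_q_norm :: "real \<Rightarrow> (complex \<Rightarrow> complex) \<Rightarrow> ennreal" where
  "bmoa_q_norm q g = enn_root (2 * q)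
     (SUP a\<in>ball 0 1. ennreal (1 / pi) *
        (\<integral>\<^sup>+ z. indicator (ball 0 1) z * ennreal (1 - (cmod (disc_auto a z))\<^sup>2)
                 * (grad_abs (\<lambda>w. cmod (g w) powr q) z)\<^sup>2 \<partial>lborel))"

definition Bq_alpha_norm :: "real \<Rightarrow> real \<Rightarrow> (complex \<Rightarrow> complex) \<Rightarrow> ennreal" where
  "Bq_alpha_norm \<alpha> q g = (if \<alpha> = -1 then bmoa_q_norm q g else bloch_q_norm q g)"

end

theory Submission
  imports Defs
begin

text \<open>
  Write \<open>\<sigma> = m / n\<close>, \<open>h\<^sub>k = T\<^sub>g\<^sup>k f\<close> and \<open>W = 1 + \<bar>g\<bar>\<^sup>2\<close>. Since \<open>u = S\<^sub>g\<^sup>m T\<^sub>g\<^sup>n f\<close> satisfies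
  \<open>u' = g\<^sup>m g' h\<^sub>n\<^sub>-\<^sub>1\<close>, it suffices to bound the weighted norms of \<open>W\<^bsup>k\<sigma>/2\<^esup> h\<^sub>k\<close> successively by
  each other. After rescaling \<open>g\<close>, the norm hypothesis says that \<open>\<bar>g\<bar>\<^bsup>2\<sigma>\<^esup> \<bar>g'\<bar>\<^sup>2\<close> is the density of a Carleson
  measure, and the same then holds for \<open>W\<^bsup>\<sigma>\<^esup> \<bar>g'\<bar>\<^sup>2\<close> with a constant as small as we please. A Bellman
  function argument turns this into the one-step bound for every \<open>p > 0\<close>, without maximal functions or
  duality: the Laplacian of a power of \<open>W\<^sup>c \<bar>h\<^sub>k\<bar>\<^sup>2\<close> (plus, for \<open>p < 2\<close>, the corresponding term for
  \<open>h\<^sub>k\<^sub>-\<^sub>1\<close>) is dominated by that function times the Carleson density, and the resulting term is absorbed.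
  Only circle means of smooth functions occur, so Green's formula reduces to one-variable calculus in
  polar coordinates.
\<close>

section \<open>The Laplacian and log-subharmonic functions\<close>

text \<open>Each of the \<open>n\<close> factors g' produced by \<open>T_op\<close> is paid for with
  an equal share \<open>\<sigma>\<close> of the \<open>m\<close> factors g produced by
  \<open>S_op\<close>; this is why the weight on squared moduli grows by W^\<sigma> per step and is
  spent only at the end. W replaces |g|^2 for two reasons: its powers are smooth at zeros of g, and
  differentiating the weight itself costs |g'|^2, which the density dominates because W >= 1. It
  also makes smallness available: under g -> \<delta> g with \<delta> <= 1 the factor W^\<sigma>
  does not grow while |g'|^2 gains \<delta>^2, and homogeneity of degree m + n in g turns the loss
  into a constant. Absorption needs finite quantities, so all estimates are made at radii below 1,
  with constants independent of the radius. The Carleson property itself comes from two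
  superharmonic functions: ln (1 - |z|^2) in the Bloch case, whose unboundedness is repaired by
  integrating against the Bergman weight (cost 2 / (\<alpha> + 1), hence the separate case \<alpha>
  = -1), and in the BMOA case a potential with values in [0, 1].\<close>

abbreviation cmod2 :: "complex \<Rightarrow> real" where
  "cmod2 z \<equiv> (cmod z)\<^sup>2"

text \<open>Here \<open>d = \<partial>F/\<partial>z\<close>, and \<open>L = \<partial>\<^sup>2F/\<partial>z\<partial>z'\<close> with \<open>z' = cnj z\<close> is a quarter of the Laplacian of \<open>F\<close>.\<close>

definition c2 :: "complex set \<Rightarrow> (complex \<Rightarrow> real) \<Rightarrow> (complex \<Rightarrow> complex) \<Rightarrow> (complex \<Rightarrow> real) \<Rightarrow> bool" where
  "c2 S F d L \<longleftrightarrow> (\<exists>P. continuous_on S P \<and> continuous_on S L \<and>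
     (\<forall>z\<in>S. (F has_derivative (\<lambda>h. 2 * Re (d z * h))) (at z) \<and>
            (d has_derivative (\<lambda>h. P z * h + of_real (L z) * cnj h)) (at z)))"

lemma c2I:
  assumes "continuous_on S P" "continuous_on S L"
    and "\<And>z. z \<in> S \<Longrightarrow> (F has_derivative (\<lambda>h. 2 * Re (d z * h))) (at z)"
    and "\<And>z. z \<in> S \<Longrightarrow> (d has_derivative (\<lambda>h. P z * h + of_real (L z) * cnj h)) (at z)"
  shows "c2 S F d L"
  using assms unfolding c2_def by blast

lemma c2E:
  assumes "c2 S F d L"
  obtains P where "continuous_on S P" "continuous_on S L"
    and "\<forall>z\<in>S. (F has_derivative (\<lambda>h. 2 * Re (d z * h))) (at z)"
    and "\<forall>z\<in>S. (d has_derivative (\<lambda>h. P z * h + of_real (L z) * cnj h)) (at z)"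
  using assms unfolding c2_def by blast

lemma c2_continuous:
  assumes "c2 S F d L"
  shows "continuous_on S F" "continuous_on S d" "continuous_on S L"
proof -
  obtain P where P: "continuous_on S P" "continuous_on S L"
    "\<forall>z\<in>S. (F has_derivative (\<lambda>h. 2 * Re (d z * h))) (at z)"
    "\<forall>z\<in>S. (d has_derivative (\<lambda>h. P z * h + of_real (L z) * cnj h)) (at z)"
    using c2E[OF assms] by blast
  show "continuous_on S F"
    using P(3) by (meson continuous_at_imp_continuous_on has_derivative_continuous)
  show "continuous_on S d"
    using P(4) by (meson continuous_at_imp_continuous_on has_derivative_continuous)
  show "continuous_on S L" by fact
qed

lemma c2_const: "c2 S (\<lambda>_. k) (\<lambda>_. 0) (\<lambda>_. 0)"
  by (rule c2I[where P="\<lambda>_. 0"]) auto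

lemma c2_add:
  assumes "c2 S F d L" "c2 S F' d' L'"
  shows "c2 S (\<lambda>z. F z + F' z) (\<lambda>z. d z + d' z) (\<lambda>z. L z + L' z)"
proof -
  obtain P where P: "continuous_on S P" "continuous_on S L"
    "\<forall>z\<in>S. (F has_derivative (\<lambda>h. 2 * Re (d z * h))) (at z)"
    "\<forall>z\<in>S. (d has_derivative (\<lambda>h. P z * h + of_real (L z) * cnj h)) (at z)"
    using c2E[OF assms(1)] by blast
  obtain P' where P': "continuous_on S P'" "continuous_on S L'"
    "\<forall>z\<in>S. (F' has_derivative (\<lambda>h. 2 * Re (d' z * h))) (at z)"
    "\<forall>z\<in>S. (d' has_derivative (\<lambda>h. P' z * h + of_real (L' z) * cnj h)) (at z)"
    using c2E[OF assms(2)] by blast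
  show ?thesis
  proof (rule c2I[where P="\<lambda>z. P z + P' z"])
    fix z assume z: "z \<in> S"
    show "((\<lambda>z. F z + F' z) has_derivative (\<lambda>h. 2 * Re ((d z + d' z) * h))) (at z)"
      by (rule has_derivative_eq_rhs[OF has_derivative_add[OF P(3)[rule_format, OF z] P'(3)[rule_format, OF z]]])
        (auto simp: algebra_simps)
    show "((\<lambda>z. d z + d' z) has_derivative (\<lambda>h. (P z + P' z) * h + of_real (L z + L' z) * cnj h)) (at z)"
      by (rule has_derivative_eq_rhs[OF has_derivative_add[OF P(4)[rule_format, OF z] P'(4)[rule_format, OF z]]])
        (auto simp: algebra_simps)
  qed (use P P' in \<open>auto intro!: continuous_intros\<close>)
qed

lemma c2_mult:
  assumes "c2 S F d L" "c2 S F' d' L'"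
  shows "c2 S (\<lambda>z. F z * F' z) (\<lambda>z. F z * d' z + F' z * d z)
    (\<lambda>z. F z * L' z + F' z * L z + 2 * Re (d z * cnj (d' z)))"
proof -
  obtain P where P: "continuous_on S P" "continuous_on S L"
    "\<forall>z\<in>S. (F has_derivative (\<lambda>h. 2 * Re (d z * h))) (at z)"
    "\<forall>z\<in>S. (d has_derivative (\<lambda>h. P z * h + of_real (L z) * cnj h)) (at z)"
    using c2E[OF assms(1)] by blast
  obtain P' where P': "continuous_on S P'" "continuous_on S L'"
    "\<forall>z\<in>S. (F' has_derivative (\<lambda>h. 2 * Re (d' z * h))) (at z)"
    "\<forall>z\<in>S. (d' has_derivative (\<lambda>h. P' z * h + of_real (L' z) * cnj h)) (at z)"
    using c2E[OF assms(2)] by blast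
  note cont = c2_continuous[OF assms(1)] c2_continuous[OF assms(2)]
  show ?thesis
  proof (rule c2I[where P="\<lambda>z. F z * P' z + F' z * P z + 2 * d z * d' z"])
    fix z assume z: "z \<in> S"
    show "((\<lambda>z. F z * F' z) has_derivative (\<lambda>h. 2 * Re ((F z * d' z + F' z * d z) * h))) (at z)"
      by (rule has_derivative_eq_rhs[OF has_derivative_mult[OF P(3)[rule_format, OF z] P'(3)[rule_format, OF z]]])
        (auto simp: algebra_simps)
    have 1: "((\<lambda>z. complex_of_real (F z)) has_derivative (\<lambda>h. of_real (2 * Re (d z * h)))) (at z)"
      by (rule has_derivative_of_real[OF P(3)[rule_format, OF z]])
    have 2: "((\<lambda>z. complex_of_real (F' z)) has_derivative (\<lambda>h. of_real (2 * Re (d' z * h)))) (at z)"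
      by (rule has_derivative_of_real[OF P'(3)[rule_format, OF z]])
    show "((\<lambda>z. F z * d' z + F' z * d z) has_derivative
      (\<lambda>h. (F z * P' z + F' z * P z + 2 * d z * d' z) * h +
        of_real (F z * L' z + F' z * L z + 2 * Re (d z * cnj (d' z))) * cnj h)) (at z)"
      by (rule has_derivative_eq_rhs[OF has_derivative_add[OF has_derivative_mult[OF 1 P'(4)[rule_format, OF z]]
              has_derivative_mult[OF 2 P(4)[rule_format, OF z]]]])
        (auto simp: complex_eq_iff algebra_simps)
  qed (use P P' cont in \<open>auto intro!: continuous_intros\<close>)
qed

lemma c2_cmult:
  assumes "c2 S F d L"
  shows "c2 S (\<lambda>z. k * F z) (\<lambda>z. of_real k * d z) (\<lambda>z. k * L z)"
  using c2_mult[OF c2_const[of S k] assms] by simp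

lemma c2_diff:
  assumes "c2 S F d L" "c2 S F' d' L'"
  shows "c2 S (\<lambda>z. F z - F' z) (\<lambda>z. d z - d' z) (\<lambda>z. L z - L' z)"
  using c2_add[OF assms(1) c2_cmult[OF assms(2), of "-1"]] by simp

lemma of_real_Re_twice: "complex_of_real (x * (2 * Re w)) = of_real x * (w + cnj w)"
  by (simp add: complex_eq_iff)

lemma c2_compose:
  fixes \<phi> \<phi>1 \<phi>2 :: "real \<Rightarrow> real" and d :: "complex \<Rightarrow> complex"
  assumes F: "c2 S F d L"
    and d1: "\<And>z. z \<in> S \<Longrightarrow> (\<phi> has_real_derivative \<phi>1 (F z)) (at (F z))"
    and d2: "\<And>z. z \<in> S \<Longrightarrow> (\<phi>1 has_real_derivative \<phi>2 (F z)) (at (F z))"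
    and c: "continuous_on S (\<lambda>z. \<phi>2 (F z))"
  shows "c2 S (\<lambda>z. \<phi> (F z)) (\<lambda>z. of_real (\<phi>1 (F z)) * d z)
    (\<lambda>z. \<phi>2 (F z) * cmod2 (d z) + \<phi>1 (F z) * L z)"
proof -
  obtain P where P: "continuous_on S P" "continuous_on S L"
    "\<forall>z\<in>S. (F has_derivative (\<lambda>h. 2 * Re (d z * h))) (at z)"
    "\<forall>z\<in>S. (d has_derivative (\<lambda>h. P z * h + of_real (L z) * cnj h)) (at z)"
    using c2E[OF F] by blast
  have D1: "((\<lambda>z. \<phi>1 (F z)) has_derivative (\<lambda>h. \<phi>2 (F z) * (2 * Re (d z * h)))) (at z)" if z: "z \<in> S" for z
    using diff_chain_at[OF P(3)[rule_format, OF z] d2[OF z, unfolded has_field_derivative_def]]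
    by (simp add: o_def)
  have c1: "continuous_on S (\<lambda>z. \<phi>1 (F z))"
    using D1 by (meson continuous_at_imp_continuous_on has_derivative_continuous)
  show ?thesis
  proof (rule c2I[where P="\<lambda>z. of_real (\<phi>2 (F z)) * (d z)\<^sup>2 + of_real (\<phi>1 (F z)) * P z"])
    fix z assume z: "z \<in> S"
    show "((\<lambda>z. \<phi> (F z)) has_derivative (\<lambda>h. 2 * Re (of_real (\<phi>1 (F z)) * d z * h))) (at z)"
      using diff_chain_at[OF P(3)[rule_format, OF z] d1[OF z, unfolded has_field_derivative_def]]
      by (simp add: o_def algebra_simps)
    show "((\<lambda>z. of_real (\<phi>1 (F z)) * d z) has_derivative
      (\<lambda>h. (of_real (\<phi>2 (F z)) * (d z)\<^sup>2 + of_real (\<phi>1 (F z)) * P z) * h +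
        of_real (\<phi>2 (F z) * cmod2 (d z) + \<phi>1 (F z) * L z) * cnj h)) (at z)"
      by (rule has_derivative_eq_rhs[OF has_derivative_mult[OF has_derivative_of_real[OF D1[OF z]] P(4)[rule_format, OF z]]])
        (rule ext, simp only: of_real_Re_twice,
          simp only: of_real_add of_real_mult complex_norm_square complex_cnj_mult,
          simp add: algebra_simps power2_eq_square)
  qed (use P c c1 c2_continuous[OF F] in \<open>auto intro!: continuous_intros\<close>)
qed

lemma cmod2_derivatives:
  assumes u: "(u has_field_derivative v z) (at z)" and v: "(v has_field_derivative w) (at z)"
  shows "((\<lambda>z. cmod2 (u z)) has_derivative (\<lambda>h. 2 * Re (cnj (u z) * v z * h))) (at z)"
    and "((\<lambda>z. cnj (u z) * v z) has_derivative
      (\<lambda>h. cnj (u z) * w * h + of_real (cmod2 (v z)) * cnj h)) (at z)"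
proof -
  have u': "(u has_derivative (\<lambda>h. v z * h)) (at z)" and v': "(v has_derivative (\<lambda>h. w * h)) (at z)"
    using u v by (auto simp: has_field_derivative_def)
  have uc: "((\<lambda>z. cnj (u z)) has_derivative (\<lambda>h. cnj (v z * h))) (at z)"
    by (rule has_derivative_cnj[OF u'])
  have e: "cmod2 (u z) = Re (cnj (u z) * u z)" for z
    by (metis Re_complex_of_real complex_norm_square mult.commute)
  show "((\<lambda>z. cmod2 (u z)) has_derivative (\<lambda>h. 2 * Re (cnj (u z) * v z * h))) (at z)"
    unfolding e
    by (rule has_derivative_eq_rhs[OF bounded_linear.has_derivative[OF bounded_linear_Re has_derivative_mult[OF uc u']]])
      (auto simp: algebra_simps)
  show "((\<lambda>z. cnj (u z) * v z) has_derivative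
    (\<lambda>h. cnj (u z) * w * h + of_real (cmod2 (v z)) * cnj h)) (at z)"
    by (rule has_derivative_eq_rhs[OF has_derivative_mult[OF uc v']])
      (auto simp: fun_eq_iff complex_norm_square algebra_simps simp del: of_real_power)
qed

lemma c2_cmod2:
  assumes "open S" "u holomorphic_on S"
  shows "c2 S (\<lambda>z. cmod2 (u z)) (\<lambda>z. cnj (u z) * deriv u z) (\<lambda>z. cmod2 (deriv u z))"
proof (rule c2I[where P="\<lambda>z. cnj (u z) * deriv (deriv u) z"])
  have h: "deriv u holomorphic_on S" "deriv (deriv u) holomorphic_on S"
    using assms by (auto intro!: holomorphic_deriv)
  then show "continuous_on S (\<lambda>z. cnj (u z) * deriv (deriv u) z)" "continuous_on S (\<lambda>z. cmod2 (deriv u z))"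
    using assms(2) by (auto intro!: continuous_intros dest!: holomorphic_on_imp_continuous_on)
  fix z assume z: "z \<in> S"
  note * = cmod2_derivatives[OF holomorphic_derivI[OF assms(2,1) z] holomorphic_derivI[OF h(1) assms(1) z]]
  show "((\<lambda>z. cmod2 (u z)) has_derivative (\<lambda>h. 2 * Re (cnj (u z) * deriv u z * h))) (at z)"
    by (rule *(1))
  show "((\<lambda>z. cnj (u z) * deriv u z) has_derivative
    (\<lambda>h. cnj (u z) * deriv (deriv u) z * h + of_real (cmod2 (deriv u z)) * cnj h)) (at z)"
    by (rule *(2))
qed

text \<open>For \<open>F > 0\<close> the inequality says that \<open>ln F\<close> is subharmonic.\<close>

definition log_sub :: "complex set \<Rightarrow> (complex \<Rightarrow> real) \<Rightarrow> (complex \<Rightarrow> complex) \<Rightarrow> (complex \<Rightarrow> real) \<Rightarrow> bool" where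
  "log_sub S F d L \<longleftrightarrow> c2 S F d L \<and> (\<forall>z\<in>S. 0 \<le> F z \<and> 0 \<le> L z \<and> cmod2 (d z) \<le> F z * L z)"

lemma log_sub_c2: "log_sub S F d L \<Longrightarrow> c2 S F d L"
  by (simp add: log_sub_def)

lemma log_subD:
  assumes "log_sub S F d L" "z \<in> S"
  shows "0 \<le> F z" "0 \<le> L z" "cmod2 (d z) \<le> F z * L z"
  using assms by (auto simp: log_sub_def)

lemma log_sub_const: "0 \<le> k \<Longrightarrow> log_sub S (\<lambda>_. k) (\<lambda>_. 0) (\<lambda>_. 0)"
  by (auto simp: log_sub_def intro: c2_const)

lemma log_sub_cmod2:
  assumes "open S" "u holomorphic_on S"
  shows "log_sub S (\<lambda>z. cmod2 (u z)) (\<lambda>z. cnj (u z) * deriv u z) (\<lambda>z. cmod2 (deriv u z))"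
  using c2_cmod2[OF assms] by (auto simp: log_sub_def norm_mult power_mult_distrib)

text \<open>Cauchy-Schwarz for (sqrt A, sqrt A') and (sqrt B, sqrt B') with the roots avoided; it is
  what closes \<open>log_sub\<close> under sums.\<close>

lemma Cauchy_Schwarz_two:
  fixes a b :: "'a::real_normed_vector"
  assumes "0 \<le> A" "0 \<le> B" "0 \<le> A'" "0 \<le> B'" "(norm a)\<^sup>2 \<le> A * B" "(norm b)\<^sup>2 \<le> A' * B'"
  shows "(norm (a + b))\<^sup>2 \<le> (A + A') * (B + B')"
proof -
  have "(norm a * norm b)\<^sup>2 \<le> (A * B) * (A' * B')"
    unfolding power_mult_distrib using assms by (intro mult_mono) auto
  also have "\<dots> = (A * B') * (A' * B)" by (simp add: algebra_simps)
  also have "4 * \<dots> \<le> (A * B' + A' * B)\<^sup>2"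
    using sum_squares_ge_zero[of "A * B' - A' * B" 0] by (simp add: power2_eq_square algebra_simps)
  finally have "(2 * (norm a * norm b))\<^sup>2 \<le> (A * B' + A' * B)\<^sup>2"
    by (simp add: power_mult_distrib)
  then have "2 * (norm a * norm b) \<le> A * B' + A' * B"
    by (rule power2_le_imp_le) (use assms in auto)
  then have "(norm a + norm b)\<^sup>2 \<le> (A + A') * (B + B')"
    using assms by (simp add: power2_eq_square algebra_simps)
  moreover have "(norm (a + b))\<^sup>2 \<le> (norm a + norm b)\<^sup>2"
    by (intro power_mono norm_triangle_ineq) auto
  ultimately show ?thesis by linarith
qed

lemma log_sub_add:
  assumes "log_sub S F d L" "log_sub S F' d' L'"
  shows "log_sub S (\<lambda>z. F z + F' z) (\<lambda>z. d z + d' z) (\<lambda>z. L z + L' z)"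
  using c2_add[of S F d L F' d' L'] assms
  by (auto simp: log_sub_def intro!: Cauchy_Schwarz_two)

text \<open>Logarithms add, but the factors may vanish, so the inequality is checked directly; the
  mixed term is controlled by the arithmetic-geometric mean inequality.\<close>

lemma log_sub_mult:
  assumes "log_sub S F d L" "log_sub S F' d' L'"
  shows "log_sub S (\<lambda>z. F z * F' z) (\<lambda>z. F z * d' z + F' z * d z)
    (\<lambda>z. F z * L' z + F' z * L z + 2 * Re (d z * cnj (d' z)))"
  unfolding log_sub_def
proof (intro conjI ballI)
  show "c2 S (\<lambda>z. F z * F' z) (\<lambda>z. F z * d' z + F' z * d z)
    (\<lambda>z. F z * L' z + F' z * L z + 2 * Re (d z * cnj (d' z)))"
    by (intro c2_mult log_sub_c2 assms)
  fix z assume z: "z \<in> S"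
  note * = log_subD[OF assms(1) z] log_subD[OF assms(2) z]
  show "0 \<le> F z * F' z" using * by simp
  have "(cmod (d z) * cmod (d' z))\<^sup>2 \<le> (F z * L z) * (F' z * L' z)"
    unfolding power_mult_distrib using * by (intro mult_mono) auto
  also have "\<dots> = (F z * L' z) * (F' z * L z)" by (simp add: algebra_simps)
  also have "4 * \<dots> \<le> (F z * L' z + F' z * L z)\<^sup>2"
    using sum_squares_ge_zero[of "F z * L' z - F' z * L z" 0] by (simp add: power2_eq_square algebra_simps)
  finally have "(2 * (cmod (d z) * cmod (d' z)))\<^sup>2 \<le> (F z * L' z + F' z * L z)\<^sup>2"
    by (simp add: power_mult_distrib)
  then have "2 * (cmod (d z) * cmod (d' z)) \<le> F z * L' z + F' z * L z"
    by (rule power2_le_imp_le) (use * in auto)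
  moreover have "\<bar>Re (d z * cnj (d' z))\<bar> \<le> cmod (d z) * cmod (d' z)"
    using abs_Re_le_cmod[of "d z * cnj (d' z)"] by (simp add: norm_mult)
  ultimately show "0 \<le> F z * L' z + F' z * L z + 2 * Re (d z * cnj (d' z))" by linarith
  have e: "cmod2 (F z * d' z + F' z * d z) =
    (F z)\<^sup>2 * cmod2 (d' z) + (F' z)\<^sup>2 * cmod2 (d z) + 2 * F z * F' z * Re (d z * cnj (d' z))"
    unfolding cmod_power2 by (simp add: power2_eq_square algebra_simps)
  have "(F z)\<^sup>2 * cmod2 (d' z) \<le> (F z)\<^sup>2 * (F' z * L' z)"
    "(F' z)\<^sup>2 * cmod2 (d z) \<le> (F' z)\<^sup>2 * (F z * L z)"
    using * by (auto intro!: mult_left_mono)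
  then show "cmod2 (F z * d' z + F' z * d z)
    \<le> F z * F' z * (F z * L' z + F' z * L z + 2 * Re (d z * cnj (d' z)))"
    unfolding e by (simp add: power2_eq_square algebra_simps)
qed

lemma c2_powr:
  assumes F: "c2 S F d L" and pos: "\<And>z. z \<in> S \<Longrightarrow> 0 < F z"
  shows "c2 S (\<lambda>z. F z powr q) (\<lambda>z. of_real (q * F z powr (q - 1)) * d z)
    (\<lambda>z. q * (q - 1) * F z powr (q - 2) * cmod2 (d z) + q * F z powr (q - 1) * L z)"
proof -
  have "((\<lambda>x. x powr q) has_real_derivative q * (F z powr (q - 1))) (at (F z))"
       "((\<lambda>x. q * x powr (q - 1)) has_real_derivative q * (q - 1) * (F z powr (q - 2))) (at (F z))" if "z \<in> S" for z
    using pos[OF that] by (auto intro!: derivative_eq_intros simp: algebra_simps)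
  moreover have "continuous_on S (\<lambda>z. q * (q - 1) * (F z powr (q - 2)))"
    using c2_continuous[OF F] pos by (intro continuous_intros) (auto simp: order.strict_iff_order)
  ultimately show ?thesis
    using c2_compose[OF F, of "\<lambda>x. x powr q" "\<lambda>x. q * (x powr (q - 1))" "\<lambda>x. q * (q - 1) * (x powr (q - 2))"]
    by (simp add: mult.assoc)
qed

text \<open>The logarithm is multiplied by \<open>q\<close>, so even q < 1 is allowed: the negative
  term q (q - 1) |d|^2 of the concave power is compensated through |d|^2 <= F L, which leaves at
  least q^2 |d|^2.\<close>

lemma log_sub_powr:
  assumes F: "log_sub S F d L" and pos: "\<And>z. z \<in> S \<Longrightarrow> 0 < F z" and q: "0 \<le> q"
  shows "log_sub S (\<lambda>z. F z powr q) (\<lambda>z. of_real (q * F z powr (q - 1)) * d z)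
    (\<lambda>z. q * (q - 1) * F z powr (q - 2) * cmod2 (d z) + q * F z powr (q - 1) * L z)"
  unfolding log_sub_def
proof (intro conjI ballI c2_powr log_sub_c2[OF F] pos)
  fix z assume z: "z \<in> S"
  note * = log_subD[OF F z] pos[OF z]
  define X where "X = F z powr (q - 2)"
  have X: "0 < X" "F z powr (q - 1) = X * F z" "F z powr q = X * (F z)\<^sup>2"
    using *(4) by (auto simp: X_def powr_diff powr_numeral power2_eq_square)
  have "q * X * ((q - 1) * cmod2 (d z) + F z * L z) \<ge> q * X * (q * cmod2 (d z))"
    using * X q by (intro mult_left_mono) (auto simp: algebra_simps)
  then have 1: "q * (q - 1) * X * cmod2 (d z) + q * (X * F z) * L z \<ge> q\<^sup>2 * X * cmod2 (d z)"
    by (simp add: algebra_simps power2_eq_square)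
  then show "0 \<le> q * (q - 1) * F z powr (q - 2) * cmod2 (d z) + q * F z powr (q - 1) * L z"
    unfolding X_def[symmetric] X using X q by (smt (verit) mult_nonneg_nonneg zero_le_power2)
  have "X * (F z)\<^sup>2 * (q\<^sup>2 * X * cmod2 (d z)) \<le> X * (F z)\<^sup>2 * (q * (q - 1) * X * cmod2 (d z) + q * (X * F z) * L z)"
    using 1 X by (intro mult_left_mono) auto
  then show "cmod2 (of_real (q * F z powr (q - 1)) * d z)
    \<le> F z powr q * (q * (q - 1) * F z powr (q - 2) * cmod2 (d z) + q * F z powr (q - 1) * L z)"
    unfolding X_def[symmetric] X by (simp add: norm_mult power_mult_distrib power2_eq_square algebra_simps)
qed simp_all

text \<open>Multiplying a log-subharmonic function by \<open>exp (- \<psi>)\<close> with \<open>\<psi>\<close> bounded and superharmonic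
  (Uchiyama's device) makes the Laplacian dominate \<open>F\<close> times the Laplacian of \<open>- \<psi>\<close>.\<close>

lemma c2_exp_mult:
  assumes F: "log_sub S F d L" and psi: "c2 S \<psi> e K"
  obtains d' L' where "c2 S (\<lambda>z. exp (- \<psi> z) * F z) d' L'"
    "\<And>z. z \<in> S \<Longrightarrow> - (exp (- \<psi> z) * F z * K z) \<le> L' z"
proof -
  have "c2 S (\<lambda>z. exp (- \<psi> z)) (\<lambda>z. of_real (- exp (- \<psi> z)) * e z) (\<lambda>z. exp (- \<psi> z) * cmod2 (e z) + - exp (- \<psi> z) * K z)"
    by (rule c2_compose[OF psi, of "\<lambda>x. exp (- x)" "\<lambda>x. - exp (- x)" "\<lambda>x. exp (- x)"])
      (auto intro!: derivative_eq_intros continuous_intros c2_continuous(1)[OF psi])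
  note * = c2_mult[OF this log_sub_c2[OF F]]
  show ?thesis
  proof (rule that[OF *])
    fix z assume z: "z \<in> S"
    define a b where "a = cmod (d z)" and "b = cmod (e z)"
    note f = log_subD[OF F z]
    \<comment> \<open>From (a - F b)^2 >= 0 and a^2 <= F L after dividing by F; at a zero of F the
      gradient vanishes as well.\<close>
    have "2 * (a * b) \<le> F z * b\<^sup>2 + L z"
    proof (cases "F z = 0")
      case True
      then have "a = 0" using f by (simp add: a_def)
      then show ?thesis using f True by simp
    next
      case False
      have "0 \<le> (a - F z * b)\<^sup>2" by simp
      then have "2 * a * b * F z \<le> F z * (F z * b\<^sup>2 + L z)"
        using f(3) by (simp add: a_def[symmetric] power2_eq_square algebra_simps)
      then have "F z * (2 * (a * b)) \<le> F z * (F z * b\<^sup>2 + L z)" by (simp add: algebra_simps)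
      then show ?thesis using False f(1) by (simp add: mult_le_cancel_left)
    qed
    moreover have "\<bar>Re (e z * cnj (d z))\<bar> \<le> a * b"
      using abs_Re_le_cmod[of "e z * cnj (d z)"] by (simp add: norm_mult a_def b_def mult.commute)
    ultimately have "0 \<le> F z * b\<^sup>2 + L z - 2 * Re (e z * cnj (d z))"
      by linarith
    then have "0 \<le> exp (- \<psi> z) * (F z * b\<^sup>2 + L z - 2 * Re (e z * cnj (d z)))" by simp
    then show "- (exp (- \<psi> z) * F z * K z) \<le> exp (- \<psi> z) * L z +
      F z * (exp (- \<psi> z) * cmod2 (e z) + - exp (- \<psi> z) * K z) +
      2 * Re ((of_real (- exp (- \<psi> z)) * e z) * cnj (d z))"
      by (simp add: algebra_simps b_def)
  qed
qed

section \<open>Circle means\<close>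

definition circle_mean :: "real \<Rightarrow> (complex \<Rightarrow> real) \<Rightarrow> real" where
  "circle_mean r F = (1 / (2 * pi)) * integral {0..2*pi} (\<lambda>t. F (rcis r t))"

abbreviation unit_disc :: "complex set" where
  "unit_disc \<equiv> ball 0 1"

lemma rcis_in_disc [simp]: "rcis r t \<in> unit_disc \<longleftrightarrow> \<bar>r\<bar> < 1"
  by (simp add: complex_mod_rcis)

lemma continuous_on_circle:
  assumes "continuous_on unit_disc F" "\<bar>r\<bar> < 1"
  shows "continuous_on T (\<lambda>t. F (rcis r t))"
  by (rule continuous_on_compose2[OF assms(1)]) (use assms(2) in \<open>auto intro!: continuous_intros simp: complex_mod_rcis\<close>)

lemma integrable_on_circle:
  fixes F :: "complex \<Rightarrow> 'a::banach"
  assumes "continuous_on unit_disc F" "\<bar>r\<bar> < 1"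
  shows "(\<lambda>t. F (rcis r t)) integrable_on {a..b}"
  by (intro integrable_continuous_interval continuous_on_circle assms)

lemma continuous_on_polar:
  assumes "continuous_on unit_disc F"
  shows "continuous_on ({-1<..<1} \<times> cbox a b) (\<lambda>(r, t). F (rcis r t))"
  unfolding split_beta
  by (rule continuous_on_compose2[OF assms]) (auto intro!: continuous_intros simp: complex_mod_rcis)

lemma circle_mean_mono:
  assumes "continuous_on unit_disc F" "continuous_on unit_disc G" "\<bar>r\<bar> < 1"
    and "\<And>z. z \<in> unit_disc \<Longrightarrow> F z \<le> G z"
  shows "circle_mean r F \<le> circle_mean r G"
  unfolding circle_mean_def
  by (intro mult_left_mono integral_le integrable_on_circle assms(1-3)) (use assms(3,4) in auto)

lemma circle_mean_add:
  assumes "continuous_on unit_disc F" "continuous_on unit_disc G" "\<bar>r\<bar> < 1"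
  shows "circle_mean r (\<lambda>z. F z + G z) = circle_mean r F + circle_mean r G"
  unfolding circle_mean_def
  by (subst integral_add) (auto intro!: integrable_on_circle assms simp: algebra_simps)

lemma circle_mean_cmult: "circle_mean r (\<lambda>z. k * F z) = k * circle_mean r F"
  unfolding circle_mean_def by simp

lemma circle_mean_radial: "circle_mean r (\<lambda>z. h (cmod z) * F z) = h \<bar>r\<bar> * circle_mean r F"
  unfolding circle_mean_def by (simp add: complex_mod_rcis)

lemma circle_mean_const [simp]: "circle_mean r (\<lambda>_. k) = k"
  by (simp add: circle_mean_def)

lemma circle_mean_0 [simp]: "circle_mean 0 F = F 0"
  by (simp add: circle_mean_def rcis_zero_mod)

lemma circle_mean_continuous:
  assumes "continuous_on unit_disc F"
  shows "continuous_on {-1<..<1} (\<lambda>r. circle_mean r F)"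
  unfolding circle_mean_def
  using integral_continuous_on_param[OF continuous_on_polar[OF assms], of 0 "2 * pi"]
  by (auto intro!: continuous_intros)

lemma rcis_radial_derivative:
  "((\<lambda>r. rcis r t) has_derivative (\<lambda>h. of_real h * cis t)) (at r within A)"
  unfolding rcis_def by (auto intro!: derivative_eq_intros)

lemma rcis_angular_derivative:
  "((\<lambda>t. rcis r t) has_derivative (\<lambda>h. of_real h * (\<i> * rcis r t))) (at t within A)"
  unfolding rcis_def by (auto intro!: derivative_eq_intros simp: scaleR_conv_of_real)

lemma circle_mean_derivative:
  assumes F: "c2 unit_disc F d L" and r: "\<bar>r\<bar> < 1"
  shows "((\<lambda>r. circle_mean r F) has_real_derivative
    (1 / (2 * pi)) * integral {0..2*pi} (\<lambda>t. 2 * Re (d (rcis r t) * cis t))) (at r)"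
proof -
  obtain P where P: "continuous_on unit_disc P" "continuous_on unit_disc L"
    "\<forall>z\<in>unit_disc. (F has_derivative (\<lambda>h. 2 * Re (d z * h))) (at z)"
    "\<forall>z\<in>unit_disc. (d has_derivative (\<lambda>h. P z * h + of_real (L z) * cnj h)) (at z)"
    using c2E[OF F] by blast
  have "((\<lambda>r. integral (cbox 0 (2*pi)) (\<lambda>t. F (rcis r t))) has_vector_derivative
     integral (cbox 0 (2*pi)) (\<lambda>t. 2 * Re (d (rcis r t) * cis t))) (at r within {-1<..<1})"
  proof (rule leibniz_rule_vector_derivative)
    fix x t :: real assume x: "x \<in> {-1<..<1}"
    have z: "rcis x t \<in> unit_disc" using x by auto
    show "((\<lambda>x. F (rcis x t)) has_vector_derivative 2 * Re (d (rcis x t) * cis t)) (at x within {-1<..<1})"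
      unfolding has_vector_derivative_def
      by (rule has_derivative_eq_rhs[OF has_derivative_compose[OF rcis_radial_derivative P(3)[rule_format, OF z]]])
        (auto simp: algebra_simps)
  next
    show "continuous_on ({- 1<..<1} \<times> cbox 0 (2 * pi)) (\<lambda>(x, t). 2 * Re (d (rcis x t) * cis t))"
      using continuous_on_polar[OF c2_continuous(2)[OF F], of 0 "2 * pi"]
      unfolding split_beta by (auto intro!: continuous_intros)
  next
    fix x :: real assume "x \<in> {-1<..<1}"
    then show "(\<lambda>t. F (rcis x t)) integrable_on cbox 0 (2*pi)"
      using integrable_on_circle[OF c2_continuous(1)[OF F], of x 0 "2*pi"] by auto
  qed (use r in auto)
  then have "((\<lambda>r. integral {0..2*pi} (\<lambda>t. F (rcis r t))) has_real_derivative
     integral {0..2*pi} (\<lambda>t. 2 * Re (d (rcis r t) * cis t))) (at r)"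
    using r by (subst (asm) at_within_open) (auto simp: has_real_derivative_iff_has_vector_derivative)
  from DERIV_cmult[OF this, of "1 / (2 * pi)"] show ?thesis
    unfolding circle_mean_def .
qed

text \<open>In polar coordinates \<open>(r \<partial>\<^sub>r)\<^sup>2 F + \<partial>\<^sub>t\<^sup>2 F\<close> is \<open>r\<^sup>2\<close> times the Laplacian, and the angular term
  integrates to zero over a circle.\<close>

definition radial_flux :: "real \<Rightarrow> (complex \<Rightarrow> complex) \<Rightarrow> real" where
  "radial_flux r d = (1 / (2 * pi)) * integral {0..2*pi} (\<lambda>t. 2 * Re (d (rcis r t) * rcis r t))"

lemma radial_flux_0 [simp]: "radial_flux 0 d = 0"
  by (simp add: radial_flux_def rcis_zero_mod)

text \<open>The flux is r times the derivative of the mean; stating it as a product avoids a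
  division at r = 0.\<close>

lemma circle_mean_derivative_flux:
  assumes F: "c2 unit_disc F d L" and r: "\<bar>r\<bar> < 1"
  obtains D where "((\<lambda>r. circle_mean r F) has_real_derivative D) (at r)" "r * D = radial_flux r d"
proof (rule that[OF circle_mean_derivative[OF assms]])
  show "r * (1 / (2 * pi) * integral {0..2 * pi} (\<lambda>t. 2 * Re (d (rcis r t) * cis t))) = radial_flux r d"
    unfolding radial_flux_def integral_mult_right[symmetric] mult.left_commute[of r]
    by (simp add: rcis_def algebra_simps)
qed

lemma radial_flux_derivative:
  assumes F: "c2 unit_disc F d L" and r: "\<bar>r\<bar> < 1"
  shows "((\<lambda>r. radial_flux r d) has_real_derivative 4 * r * circle_mean r L) (at r)"
proof -
  obtain P where P: "continuous_on unit_disc P" "continuous_on unit_disc L"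
    "\<forall>z\<in>unit_disc. (F has_derivative (\<lambda>h. 2 * Re (d z * h))) (at z)"
    "\<forall>z\<in>unit_disc. (d has_derivative (\<lambda>h. P z * h + of_real (L z) * cnj h)) (at z)"
    using c2E[OF F] by blast
  note cd = c2_continuous(2)[OF F]
  define Q where "Q = (\<lambda>x t. 2 * Re ((P (rcis x t) * cis t + of_real (L (rcis x t)) * cnj (cis t)) * rcis x t
      + d (rcis x t) * cis t))"
  have "((\<lambda>r. integral (cbox 0 (2*pi)) (\<lambda>t. 2 * Re (d (rcis r t) * rcis r t))) has_vector_derivative
     integral (cbox 0 (2*pi)) (Q r)) (at r within {-1<..<1})"
  proof (rule leibniz_rule_vector_derivative)
    fix x t :: real assume x: "x \<in> {-1<..<1}"
    have z: "rcis x t \<in> unit_disc" using x by auto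
    note dd = has_derivative_mult[OF has_derivative_compose[OF rcis_radial_derivative P(4)[rule_format, OF z]]
        rcis_radial_derivative]
    show "((\<lambda>x. 2 * Re (d (rcis x t) * rcis x t)) has_vector_derivative Q x t) (at x within {-1<..<1})"
      unfolding has_vector_derivative_def
      by (rule has_derivative_eq_rhs[OF has_derivative_mult_right[OF bounded_linear.has_derivative[OF bounded_linear_Re dd]]])
        (auto simp: Q_def algebra_simps)
  next
    show "continuous_on ({- 1<..<1} \<times> cbox 0 (2 * pi)) (\<lambda>(x, t). Q x t)"
      using continuous_on_polar[OF cd, of 0 "2 * pi"] continuous_on_polar[OF P(1), of 0 "2 * pi"]
        continuous_on_polar[OF P(2), of 0 "2 * pi"]
      unfolding split_beta Q_def by (auto intro!: continuous_intros)
  next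
    fix x :: real assume "x \<in> {-1<..<1}"
    then show "(\<lambda>t. 2 * Re (d (rcis x t) * rcis x t)) integrable_on cbox 0 (2*pi)"
      using continuous_on_circle[OF cd, of x "cbox 0 (2 * pi)"]
      by (intro integrable_continuous continuous_intros) auto
  qed (use r in auto)
  then have D: "((\<lambda>r. integral {0..2*pi} (\<lambda>t. 2 * Re (d (rcis r t) * rcis r t))) has_real_derivative
     integral {0..2*pi} (Q r)) (at r)"
    using r by (subst (asm) at_within_open) (auto simp: has_real_derivative_iff_has_vector_derivative)
  \<comment> \<open>\<open>q\<close> is the angular derivative of F divided by r, written without
    the division. Its derivative in t is 4 r L minus the integrand \<open>Q\<close>, and periodicity
    makes the integral of that derivative vanish.\<close>
  define q where "q = (\<lambda>t. 2 * Re (d (rcis r t) * (\<i> * cis t)))"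
  define q' where "q' = (\<lambda>t. 4 * r * L (rcis r t) - Q r t)"
  have "(q' has_integral (q (2 * pi) - q 0)) {0..2*pi}"
  proof (rule fundamental_theorem_of_calculus)
    fix t :: real
    have z: "rcis r t \<in> unit_disc" using r by auto
    have ci: "(cis has_derivative (\<lambda>h. h *\<^sub>R (\<i> * cis t))) (at t within {0..2*pi})"
      using has_derivative_cis[OF has_derivative_ident] .
    have cc: "cis t * cnj (cis t) = 1"
      by (simp add: cis_cnj cis_mult)
    note dd = has_derivative_mult[OF has_derivative_compose[OF rcis_angular_derivative P(4)[rule_format, OF z]]
        has_derivative_mult_right[OF ci, of \<i>]]
    have e: "2 * Re (d (rcis r t) * (\<i> * h *\<^sub>R (\<i> * cis t)) +
        (P (rcis r t) * (of_real h * (\<i> * rcis r t)) +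
         of_real (L (rcis r t)) * cnj (of_real h * (\<i> * rcis r t))) * (\<i> * cis t)) = h * q' t" for h
    proof -
      define a b l where "a = d (rcis r t) * cis t" and "b = P (rcis r t) * of_real r * (cis t)\<^sup>2"
        and "l = L (rcis r t) * r"
      have "d (rcis r t) * (\<i> * h *\<^sub>R (\<i> * cis t)) +
        (P (rcis r t) * (of_real h * (\<i> * rcis r t)) +
         of_real (L (rcis r t)) * cnj (of_real h * (\<i> * rcis r t))) * (\<i> * cis t)
        = of_real h * (of_real l * (cis t * cnj (cis t)) - a - b)"
        by (simp add: scaleR_conv_of_real rcis_def power2_eq_square algebra_simps a_def b_def l_def)
      moreover have "Re (of_real h * (of_real l * (cis t * cnj (cis t)) - a - b)) = h * (l - Re a - Re b)"
        by (simp only: cc) simp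
      moreover have "Q r t = 2 * Re (b + of_real l * (cis t * cnj (cis t)) + a)"
        by (simp add: Q_def rcis_def power2_eq_square algebra_simps a_def b_def l_def)
      then have "Q r t = 2 * (Re b + l + Re a)" by (simp only: cc) simp
      then have "q' t = 2 * (l - Re a - Re b)"
        by (simp add: q'_def l_def algebra_simps)
      ultimately show ?thesis by simp
    qed
    show "(q has_vector_derivative q' t) (at t within {0..2*pi})"
      unfolding has_vector_derivative_def q_def
      by (rule has_derivative_eq_rhs[OF has_derivative_mult_right[OF bounded_linear.has_derivative[OF bounded_linear_Re dd]]])
        (use e in \<open>auto simp: fun_eq_iff\<close>)
  qed auto
  moreover have "q (2 * pi) = q 0"
    by (simp add: q_def rcis_def)
  ultimately have "integral {0..2*pi} q' = 0"
    by (simp add: integral_unique)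
  moreover have "integral {0..2*pi} q' = integral {0..2*pi} (\<lambda>t. 4 * r * L (rcis r t)) - integral {0..2*pi} (Q r)"
    unfolding q'_def
  proof (rule integral_diff)
    show "(\<lambda>t. 4 * r * L (rcis r t)) integrable_on {0..2 * pi}"
      using continuous_on_circle[OF P(2) r] by (intro integrable_continuous_interval continuous_intros)
    show "Q r integrable_on {0..2 * pi}" unfolding Q_def
      using continuous_on_circle[OF P(2) r] continuous_on_circle[OF P(1) r] continuous_on_circle[OF cd r]
      by (intro integrable_continuous_interval continuous_intros) auto
  qed
  ultimately have "integral {0..2*pi} (Q r) = 4 * r * integral {0..2*pi} (\<lambda>t. L (rcis r t))"
    by simp
  with DERIV_cmult[OF D, of "1 / (2 * pi)"] show ?thesis
    unfolding radial_flux_def circle_mean_def by (simp add: algebra_simps)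
qed

text \<open>The flux starts at 0 and decreases, so the mean decreases too. The sign of
  \<open>L\<close> is required only up to radius \<open>r\<close>, because the potential used for
  Hardy means is controlled only there.\<close>

lemma circle_mean_superharmonic:
  assumes F: "c2 unit_disc F d L" and r: "0 \<le> r" "r < 1"
    and L: "\<And>z. cmod z \<le> r \<Longrightarrow> L z \<le> 0"
  shows "circle_mean r F \<le> F 0"
proof (cases "r = 0")
  case False
  have flux: "radial_flux s d \<le> 0" if s: "0 \<le> s" "s \<le> r" for s
  proof -
    have "radial_flux s d \<le> radial_flux 0 d"
    proof (rule DERIV_nonpos_imp_nonincreasing[OF s(1)])
      fix x assume x: "0 \<le> x" "x \<le> s"
      have "circle_mean x L \<le> 0"
      proof -
        have "integral {0..2*pi} (\<lambda>t. L (rcis x t)) \<le> integral {0..2*pi} (\<lambda>t. 0)"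
          by (intro integral_le integrable_on_circle[OF c2_continuous(3)[OF F], of x] integrable_0)
            (use x s r in \<open>auto intro!: L simp: complex_mod_rcis\<close>)
        then show ?thesis by (simp add: circle_mean_def mult_nonneg_nonpos divide_nonpos_pos)
      qed
      with x have "4 * x * circle_mean x L \<le> 0" by (simp add: mult_nonneg_nonpos)
      with radial_flux_derivative[OF F, of x] x s r
      show "\<exists>y. ((\<lambda>r. radial_flux r d) has_real_derivative y) (at x) \<and> y \<le> 0" by auto
    qed
    then show ?thesis by simp
  qed
  have "\<exists>D. ((\<lambda>r. circle_mean r F) has_real_derivative D) (at x) \<and> x * D = radial_flux x d" if "\<bar>x\<bar> < 1" for x
    using circle_mean_derivative_flux[OF F that] by blast
  then obtain D where D: "\<And>x. \<bar>x\<bar> < 1 \<Longrightarrow> ((\<lambda>r. circle_mean r F) has_real_derivative D x) (at x)"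
     "\<And>x. \<bar>x\<bar> < 1 \<Longrightarrow> x * D x = radial_flux x d"
    by metis
  obtain x where x: "0 < x" "x < r" "circle_mean r F - circle_mean 0 F = (r - 0) * D x"
    using MVT2[of 0 r "\<lambda>r. circle_mean r F" D] D(1) False r by auto
  have "x * D x \<le> 0" using D(2)[of x] flux[of x] x r by simp
  then have "D x \<le> 0" using x by (simp add: mult_le_0_iff)
  then have "r * D x \<le> 0" using r by (simp add: mult_nonneg_nonpos)
  then show ?thesis using x(3) by simp
qed simp

lemma circle_mean_subharmonic:
  assumes F: "c2 unit_disc F d L" and r: "0 \<le> r" "r < 1"
    and L: "\<And>z. z \<in> unit_disc \<Longrightarrow> 0 \<le> L z"
  shows "F 0 \<le> circle_mean r F"
  using circle_mean_superharmonic[OF c2_cmult[OF F, of "-1"] r] L r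
  by (simp add: circle_mean_def)

text \<open>A form of Green's formula in which the comparison function \<open>G\<close> may blow up
  at the unit circle. Moving the weight 1 - s^2 through two radial integrations leaves the integral
  of \<open>4 * s * circle_mean s G\<close> as an error term.\<close>

lemma circle_mean_compare:
  assumes F: "c2 unit_disc F d L" and V: "c2 unit_disc V e K" and G: "c2 unit_disc G e' K'"
    and G_def: "\<And>z. z \<in> unit_disc \<Longrightarrow> V z = (1 - cmod2 z) * G z"
    and G0: "\<And>z. z \<in> unit_disc \<Longrightarrow> 0 \<le> G z"
    and L: "\<And>z. z \<in> unit_disc \<Longrightarrow> L z \<le> (1 - cmod2 z) * K' z"
    and r: "0 \<le> r" "r < 1"
  shows "circle_mean r F - F 0 \<le> circle_mean r V +
    integral {0..r} (\<lambda>s. 4 * s * circle_mean s G)"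
proof -
  have VG: "circle_mean s V = (1 - s\<^sup>2) * circle_mean s G" if "\<bar>s\<bar> < 1" for s
  proof -
    have "circle_mean s V = circle_mean s (\<lambda>z. (1 - cmod2 z) * G z)"
      unfolding circle_mean_def using G_def that by simp
    also have "\<dots> = (1 - \<bar>s\<bar>\<^sup>2) * circle_mean s G" by (rule circle_mean_radial)
    finally show ?thesis by simp
  qed
  have ex: "\<exists>D. ((\<lambda>r. circle_mean r F) has_real_derivative D) (at x) \<and> x * D = radial_flux x d"
    if "\<bar>x\<bar> < 1" "c2 unit_disc F d L" for x F d L
    using circle_mean_derivative_flux[OF that(2,1)] by blast
  obtain D where D: "\<And>x. \<bar>x\<bar> < 1 \<Longrightarrow> ((\<lambda>r. circle_mean r F) has_real_derivative D x) (at x)"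
     "\<And>x. \<bar>x\<bar> < 1 \<Longrightarrow> x * D x = radial_flux x d"
    using ex[OF _ F] by metis
  obtain D' where D': "\<And>x. \<bar>x\<bar> < 1 \<Longrightarrow> ((\<lambda>r. circle_mean r G) has_real_derivative D' x) (at x)"
     "\<And>x. \<bar>x\<bar> < 1 \<Longrightarrow> x * D' x = radial_flux x e'"
    using ex[OF _ G] by metis
  \<comment> \<open>\<open>E\<close> is s times the derivative of \<open>Z\<close> below. In its own
    derivative the two contributions of the flux of \<open>G\<close> cancel; what remains is 4 s
    times (1 - s^2) mean K' - mean L, plus 4 s times the mean of \<open>G\<close>, and both are
    nonnegative.\<close>
  define E where "E = (\<lambda>s. (1 - s\<^sup>2) * radial_flux s e' + 2 * s\<^sup>2 * circle_mean s G - radial_flux s d)"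
  have E: "0 \<le> E s" if s: "0 \<le> s" "s < 1" for s
  proof -
    have "E 0 \<le> E s"
    proof (rule DERIV_nonneg_imp_nondecreasing[OF s(1)])
      fix x assume "0 \<le> x" "x \<le> s"
      then have x: "\<bar>x\<bar> < 1" "0 \<le> x" using s by auto
      have "circle_mean x L \<le> circle_mean x (\<lambda>z. (1 - cmod2 z) * K' z)"
        by (intro circle_mean_mono continuous_intros c2_continuous(3)[OF F] c2_continuous(3)[OF G] L x(1))
      also have "\<dots> = (1 - x\<^sup>2) * circle_mean x K'"
        by (subst circle_mean_radial) simp
      finally have 1: "x * circle_mean x L \<le> x * ((1 - x\<^sup>2) * circle_mean x K')"
        using x by (intro mult_left_mono)
      have "circle_mean x (\<lambda>_. 0) \<le> circle_mean x G"
        by (intro circle_mean_mono continuous_intros c2_continuous(1)[OF G] G0 x(1))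
      then have 2: "0 \<le> x * circle_mean x G" using x by simp
      have "(E has_real_derivative (1 - x\<^sup>2) * (4 * x * circle_mean x K') - 2 * x * radial_flux x e'
          + (4 * x * circle_mean x G + 2 * x\<^sup>2 * D' x) - 4 * x * circle_mean x L) (at x)"
        unfolding E_def
        by (auto intro!: derivative_eq_intros radial_flux_derivative[OF G] radial_flux_derivative[OF F] D'(1) x(1)
            simp: algebra_simps)
      moreover have "0 \<le> (1 - x\<^sup>2) * (4 * x * circle_mean x K') - 2 * x * radial_flux x e'
          + (4 * x * circle_mean x G + 2 * x\<^sup>2 * D' x) - 4 * x * circle_mean x L"
        using 1 2 unfolding D'(2)[OF x(1), symmetric] by (simp add: algebra_simps power2_eq_square)
      ultimately show "\<exists>y. (E has_real_derivative y) (at x) \<and> 0 \<le> y" by blast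
    qed
    then show ?thesis by (simp add: E_def)
  qed
  define J where "J = (\<lambda>r. integral {0..r} (\<lambda>s. 4 * s * circle_mean s G))"
  define Z where "Z = (\<lambda>s. (1 - s\<^sup>2) * circle_mean s G + J s - circle_mean s F)"
  have cG: "continuous_on {0..r} (\<lambda>s. circle_mean s G)"
    by (rule continuous_on_subset[OF circle_mean_continuous[OF c2_continuous(1)[OF G]]]) (use r in auto)
  have cF: "continuous_on {0..r} (\<lambda>s. circle_mean s F)"
    by (rule continuous_on_subset[OF circle_mean_continuous[OF c2_continuous(1)[OF F]]]) (use r in auto)
  have cg: "continuous_on {0..r} (\<lambda>s. 4 * s * circle_mean s G)"
    by (intro continuous_intros cG)
  have cJ: "continuous_on {0..r} J"
    unfolding J_def using indefinite_integral_continuous_1 integrable_continuous_interval[OF cg] by blast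
  have "Z 0 \<le> Z r"
  proof (rule DERIV_nonneg_imp_increasing_open[OF r(1)])
    show "continuous_on {0..r} Z" unfolding Z_def by (intro continuous_intros cG cF cJ)
    fix x assume x: "0 < x" "x < r"
    then have x1: "\<bar>x\<bar> < 1" using r by auto
    have "(J has_real_derivative 4 * x * circle_mean x G) (at x within {0..r})"
      unfolding J_def by (rule integral_has_real_derivative[OF cg]) (use x in auto)
    then have J': "(J has_real_derivative 4 * x * circle_mean x G) (at x)"
      using x by (simp add: at_within_Icc_at)
    define y where "y = (1 - x\<^sup>2) * D' x - 2 * x * circle_mean x G + 4 * x * circle_mean x G - D x"
    have "(Z has_real_derivative y) (at x)"
      unfolding Z_def y_def
      by (auto intro!: derivative_eq_intros J' D(1) D'(1) x1 simp: algebra_simps)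
    moreover have "x * y = E x"
      unfolding y_def E_def D'(2)[OF x1, symmetric] D(2)[OF x1, symmetric]
      by (simp add: algebra_simps power2_eq_square)
    then have "0 \<le> y" using E[of x] x r by (metis less_trans less_imp_le zero_le_mult_iff not_less)
    ultimately show "\<exists>y. (Z has_real_derivative y) (at x) \<and> 0 \<le> y" by blast
  qed
  moreover have "Z 0 = G 0 - F 0" by (simp add: Z_def J_def)
  moreover have "Z r = circle_mean r V + J r - circle_mean r F"
    using r by (simp add: Z_def VG)
  ultimately show ?thesis using G0[of 0] by (simp add: J_def)
qed

section \<open>Carleson conditions for means\<close>

text \<open>Positivity and linearity on continuous functions are all that the estimates use, so
  circle means (Hardy) and their radial averages (Bergman) share one argument. Values are real,
  hence finite, which makes absorption legitimate.\<close>

locale disc_mean =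
  fixes N :: "(complex \<Rightarrow> real) \<Rightarrow> real"
  assumes mono: "\<lbrakk>continuous_on unit_disc F; continuous_on unit_disc G;
        \<And>z. z \<in> unit_disc \<Longrightarrow> F z \<le> G z\<rbrakk> \<Longrightarrow> N F \<le> N G"
    and add: "\<lbrakk>continuous_on unit_disc F; continuous_on unit_disc G\<rbrakk>
        \<Longrightarrow> N (\<lambda>z. F z + G z) = N F + N G"
    and cmult: "continuous_on unit_disc F \<Longrightarrow> N (\<lambda>z. k * F z) = k * N F"
begin

lemma N_nonneg:
  assumes "continuous_on unit_disc F" "\<And>z. z \<in> unit_disc \<Longrightarrow> 0 \<le> F z"
  shows "0 \<le> N F"
proof -
  have "N (\<lambda>z. 0 * F z) \<le> N F"
    by (intro mono continuous_intros assms) (use assms in simp)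
  then show ?thesis using cmult[OF assms(1), of 0] by simp
qed

lemma N_one: "0 \<le> N (\<lambda>_. 1)"
  by (rule N_nonneg) auto

text \<open>For a superposition \<open>N\<close> of circle means, Green's formula turns \<open>N F - N 1 * F 0\<close> into an integral of the
  Laplacian of \<open>F\<close>, so this says that \<open>\<tau>\<close> times the weight in that formula is a Carleson measure.\<close>

definition carleson :: "(complex \<Rightarrow> real) \<Rightarrow> real \<Rightarrow> bool" where
  "carleson \<tau> \<kappa> \<longleftrightarrow> (\<forall>F d L V e K. c2 unit_disc F d L \<longrightarrow> log_sub unit_disc V e K \<longrightarrow>
     (\<forall>z\<in>unit_disc. 0 < V z) \<longrightarrow> (\<forall>z\<in>unit_disc. L z \<le> V z * \<tau> z) \<longrightarrow>
     N F \<le> N (\<lambda>_. 1) * F 0 + \<kappa> * N V)"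

lemma carlesonD:
  assumes "carleson \<tau> \<kappa>" "c2 unit_disc F d L" "log_sub unit_disc V e K"
    "\<And>z. z \<in> unit_disc \<Longrightarrow> 0 < V z" "\<And>z. z \<in> unit_disc \<Longrightarrow> L z \<le> V z * \<tau> z"
  shows "N F \<le> N (\<lambda>_. 1) * F 0 + \<kappa> * N V"
  using assms unfolding carleson_def by blast

text \<open>The given condition is tested with F / k.\<close>

lemma carleson_scale:
  assumes c: "carleson \<tau> \<kappa>" and k: "0 < k" and le: "\<And>z. z \<in> unit_disc \<Longrightarrow> \<tau>' z \<le> k * \<tau> z"
  shows "carleson \<tau>' (k * \<kappa>)"
  unfolding carleson_def
proof (intro allI impI)
  fix F d L V e K
  assume F: "c2 unit_disc F d L" and V: "log_sub unit_disc V e K" "\<forall>z\<in>unit_disc. 0 < V z"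
    and L: "\<forall>z\<in>unit_disc. L z \<le> V z * \<tau>' z"
  have "N (\<lambda>z. (1 / k) * F z) \<le> N (\<lambda>_. 1) * ((1 / k) * F 0) + \<kappa> * N V"
  proof (rule carlesonD[OF c c2_cmult[OF F] V(1)])
    fix z assume z: "z \<in> unit_disc"
    show "0 < V z" using V z by auto
    have "L z \<le> V z * \<tau>' z" using L z by auto
    also have "\<dots> \<le> V z * (k * \<tau> z)" using le[OF z] V(2) z by (intro mult_left_mono) (auto intro: less_imp_le)
    finally show "1 / k * L z \<le> V z * \<tau> z" using k by (simp add: field_simps)
  qed
  then show "N F \<le> N (\<lambda>_. 1) * F 0 + k * \<kappa> * N V"
    unfolding cmult[OF c2_continuous(1)[OF F]] using k by (simp add: field_simps)
qed

text \<open>Where \<open>\<bar>g\<bar>\<close> is small the missing part of the measure is supplied by the Laplacian of the bounded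
  function \<open>1 / (1 + \<bar>g\<bar>\<^sup>2)\<close>.\<close>

lemma carleson_regularized:
  assumes g: "g holomorphic_on unit_disc" and s: "0 \<le> \<sigma>" and k: "0 \<le> \<kappa>"
    and c: "carleson (\<lambda>z. cmod2 (g z) powr \<sigma> * cmod2 (deriv g z)) \<kappa>"
  shows "carleson (\<lambda>z. (1 + cmod2 (g z)) powr \<sigma> * cmod2 (deriv g z))
    (21 * 2 powr \<sigma> + (3 powr \<sigma> + 21 * 2 powr \<sigma> * 2 powr \<sigma>) * \<kappa>)"
  unfolding carleson_def
proof (intro allI impI)
  fix F d L V e K
  assume F: "c2 unit_disc F d L" and V: "log_sub unit_disc V e K" "\<forall>z\<in>unit_disc. 0 < V z"
    and L: "\<forall>z\<in>unit_disc. L z \<le> V z * ((1 + cmod2 (g z)) powr \<sigma> * cmod2 (deriv g z))"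
  \<comment> \<open>21 is the least integer with 21 * (1/3) * (4/27) >= 1. Here 1/3 bounds exp (-
    \<psi>) from below, and 4/27 is the value of (1 - t) / (1 + t)^3 at t = 1/2, its minimum on
    [0, 1/2].\<close>
  define A where "A = 21 * 2 powr \<sigma>"
  \<comment> \<open>Serves t > 1/2: there 1 + t <= 3 t gives 3^\<sigma>, and the correction, which
    is at least -A, is paid for by A (2 t)^\<sigma> >= A.\<close>
  define B where "B = 3 powr \<sigma> + A * 2 powr \<sigma>"
  have A: "0 < A" by (simp add: A_def)
  have B: "0 < B" unfolding B_def using A by (intro add_pos_pos mult_pos_pos) auto
  \<comment> \<open>With t = |g|^2, minus the Laplacian of \<open>\<psi>\<close> is (1 - t) / (1 +
    t)^3 times |g'|^2: positive for |g| < 1 and never below -|g'|^2.\<close>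
  define \<psi> where "\<psi> = (\<lambda>z. inverse (1 + cmod2 (g z)))"
  have pos: "1 + cmod2 (g z) \<noteq> 0" for z
    by (metis add.commute add_nonneg_eq_0_iff zero_le_one zero_le_power2 zero_neq_one)
  have "c2 unit_disc \<psi> (\<lambda>z. of_real (- (inverse (1 + cmod2 (g z))^2)) * (cnj (g z) * deriv g z))
    (\<lambda>z. 2 * inverse (1 + cmod2 (g z))^3 * cmod2 (cnj (g z) * deriv g z) +
      - (inverse (1 + cmod2 (g z))^2) * cmod2 (deriv g z))"
    unfolding \<psi>_def
  proof (rule c2_compose[OF c2_cmod2[OF open_ball g], of "\<lambda>x. inverse (1 + x)" "\<lambda>x. - (inverse (1 + x)^2)" "\<lambda>x. 2 * inverse (1 + x)^3"])
    show "continuous_on unit_disc (\<lambda>z. 2 * inverse (1 + cmod2 (g z)) ^ 3)"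
      using holomorphic_on_imp_continuous_on[OF g] pos by (intro continuous_intros) auto
  qed (use pos in \<open>auto intro!: derivative_eq_intros simp: power2_eq_square power3_eq_cube\<close>)
  then obtain d' L' where V1: "c2 unit_disc (\<lambda>z. exp (- \<psi> z) * V z) d' L'"
    and L': "\<And>z. z \<in> unit_disc \<Longrightarrow> - (exp (- \<psi> z) * V z * (2 * inverse (1 + cmod2 (g z))^3 * cmod2 (cnj (g z) * deriv g z) +
      - (inverse (1 + cmod2 (g z))^2) * cmod2 (deriv g z))) \<le> L' z"
    using c2_exp_mult[OF V(1)] by blast
  \<comment> \<open>Subtracting A exp (- \<psi>) V removes the part of the Laplacian that the given
    measure does not see. Its value at 0 enters with a favourable sign, and its mean costs at most A
    times that of V.\<close>
  note F' = c2_diff[OF F c2_cmult[OF V1, of A]]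
  have "N (\<lambda>z. F z - A * (exp (- \<psi> z) * V z)) \<le> N (\<lambda>_. 1) * (F 0 - A * (exp (- \<psi> 0) * V 0)) + (B * \<kappa>) * N V"
  proof (rule carlesonD[OF carleson_scale[OF c B order.refl] F' V(1)])
    fix z assume z: "z \<in> unit_disc"
    show Vz: "0 < V z" using V z by auto
    define t where "t = cmod2 (g z)"
    define E where "E = exp (- \<psi> z)"
    have t: "0 \<le> t" by (simp add: t_def)
    have psi: "0 < \<psi> z" "\<psi> z \<le> 1"
      using t by (auto simp: \<psi>_def t_def[symmetric] inverse_le_1_iff)
    have E: "0 < E" "E \<le> 1" "1 / 3 \<le> E"
    proof -
      have "exp (\<psi> z) \<le> exp 1" using psi by simp
      also have "\<dots> \<le> (3::real)" using exp_le by simp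
      finally show "1 / 3 \<le> E" by (simp add: E_def exp_minus field_simps)
    qed (use psi in \<open>auto simp: E_def\<close>)
    have bound: "(1 + t) powr \<sigma> \<le> A * (E * ((1 - t) / (1 + t)^3)) + B * t powr \<sigma>"
    proof (cases "t \<le> 1/2")
      case True
      have "(1 + t) powr \<sigma> \<le> 2 powr \<sigma>" using t s True by (intro powr_mono2) auto
      also have "2 powr \<sigma> \<le> A * (1/3 * (4/27))" by (simp add: A_def)
      also have "\<dots> \<le> A * (E * ((1 - t) / (1 + t)^3))"
      proof -
        have "(1 + t)^3 \<le> (1 + 1/2)^3" using True t by (intro power_mono) auto
        then have "4/27 \<le> (1 - t) / (1 + t)^3"
          using True t by (subst le_divide_eq) (auto simp: power3_eq_cube field_simps add_pos_nonneg)
        with E A show ?thesis by (intro mult_left_mono mult_mono) auto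
      qed
      finally show ?thesis using B by (smt (verit) mult_nonneg_nonneg powr_ge_zero)
    next
      case False
      have "(1 + t) powr \<sigma> \<le> (3 * t) powr \<sigma>" using False s by (intro powr_mono2) auto
      then have 1: "(1 + t) powr \<sigma> \<le> 3 powr \<sigma> * t powr \<sigma>" using t by (simp add: powr_mult)
      have "1 \<le> (2 * t) powr \<sigma>" using False s by (intro ge_one_powr_ge_zero) auto
      then have 2: "A \<le> A * (2 powr \<sigma> * t powr \<sigma>)" using A t by (simp add: powr_mult)
      have "1 \<le> (1 + t)^3" using t by (intro one_le_power) auto
      moreover have "(1 + t) \<le> (1 + t)^3" using t power_increasing[of 1 3 "1 + t"] by simp
      ultimately have "-1 \<le> (1 - t) / (1 + t)^3" using t by (simp add: le_divide_eq)
      then have "-1 \<le> E * ((1 - t) / (1 + t)^3)"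
        using E by (smt (verit) mult_left_le_one_le mult_minus_right mult_nonneg_nonneg)
      then have "A * (-1) \<le> A * (E * ((1 - t) / (1 + t)^3))" using A by (intro mult_left_mono) auto
      with 1 2 show ?thesis by (simp add: B_def algebra_simps)
    qed
    define D where "D = cmod2 (deriv g z)"
    have eq: "- (2 * inverse (1 + t)^3 * cmod2 (cnj (g z) * deriv g z) + - (inverse (1 + t)^2) * D) = (1 - t) / (1 + t)^3 * D"
    proof -
      have "cmod2 (cnj (g z) * deriv g z) = t * D" by (simp add: t_def D_def norm_mult power_mult_distrib)
      moreover have "- (2 * inverse (1 + t)^3 * (t * D) + - (inverse (1 + t)^2) * D) = (1 - t) / (1 + t)^3 * D"
        using t by (simp add: divide_simps power2_eq_square power3_eq_cube) (simp add: algebra_simps)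
      ultimately show ?thesis by simp
    qed
    have "L z \<le> V z * D * (1 + t) powr \<sigma>" using L z by (simp add: t_def D_def algebra_simps)
    also have "\<dots> \<le> V z * D * (A * (E * ((1 - t) / (1 + t)^3)) + B * t powr \<sigma>)"
      using Vz by (intro mult_left_mono bound) (simp add: D_def)
    also have "\<dots> = A * (E * V z * ((1 - t) / (1 + t)^3 * D)) + V z * (B * (t powr \<sigma> * D))"
      by (simp add: algebra_simps)
    also have "E * V z * ((1 - t) / (1 + t)^3 * D) \<le> L' z"
      using L'[OF z] unfolding eq[symmetric] unfolding E_def t_def D_def by (simp add: algebra_simps)
    finally show "L z - A * L' z \<le> V z * (B * (cmod2 (g z) powr \<sigma> * cmod2 (deriv g z)))"
      using A by (simp add: t_def D_def)
  qed
  moreover have "N (\<lambda>z. F z - A * (exp (- \<psi> z) * V z)) = N F - A * N (\<lambda>z. exp (- \<psi> z) * V z)"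
    using add[OF c2_continuous(1)[OF F] c2_continuous(1)[OF c2_cmult[OF V1, of "-A"]]]
      cmult[OF c2_continuous(1)[OF V1], of "-A"] by simp
  moreover have "N (\<lambda>z. exp (- \<psi> z) * V z) \<le> N V"
  proof (rule mono[OF c2_continuous(1)[OF V1] c2_continuous(1)[OF log_sub_c2[OF V(1)]]])
    fix z assume z: "z \<in> unit_disc"
    have "exp (- \<psi> z) * V z \<le> 1 * V z"
      using V(2) z by (intro mult_right_mono) (auto simp: \<psi>_def intro: less_imp_le)
    then show "exp (- \<psi> z) * V z \<le> V z" by simp
  qed
  then have "A * N (\<lambda>z. exp (- \<psi> z) * V z) \<le> A * N V" using A by (intro mult_left_mono) auto
  moreover have "N (\<lambda>_. 1) * (F 0 - A * (exp (- \<psi> 0) * V 0)) \<le> N (\<lambda>_. 1) * F 0"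
    using A V(2) by (intro mult_left_mono N_one) (auto intro: less_imp_le)
  ultimately have "N F \<le> N (\<lambda>_. 1) * F 0 + (A + B * \<kappa>) * N V"
    by (simp add: algebra_simps)
  then show "N F \<le> N (\<lambda>_. 1) * F 0 + (21 * 2 powr \<sigma> + (3 powr \<sigma> + 21 * 2 powr \<sigma> * 2 powr \<sigma>) * \<kappa>) * N V"
    by (simp add: A_def B_def)
qed

end

section \<open>Powers of W as log-subharmonic weights\<close>

lemma log_sub_regularizer:
  assumes g: "g holomorphic_on unit_disc" and c: "0 \<le> c"
  obtains d L where "log_sub unit_disc (\<lambda>z. (1 + cmod2 (g z)) powr c) d L"
    "\<And>z. z \<in> unit_disc \<Longrightarrow> L z \<le> (c\<^sup>2 + c) * (1 + cmod2 (g z)) powr c * cmod2 (deriv g z)"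
    "\<And>z. z \<in> unit_disc \<Longrightarrow> cmod (d z) \<le> c * (1 + cmod2 (g z)) powr c * cmod (deriv g z)"
proof -
  have W: "log_sub unit_disc (\<lambda>z. 1 + cmod2 (g z)) (\<lambda>z. cnj (g z) * deriv g z) (\<lambda>z. cmod2 (deriv g z))"
    using log_sub_add[OF log_sub_const[of 1] log_sub_cmod2[OF open_ball g]] by simp
  have pos: "0 < 1 + cmod2 (g z)" for z by (intro add_pos_nonneg) auto
  show ?thesis
  proof (rule that[OF log_sub_powr[OF W pos c]])
    fix z assume z: "z \<in> unit_disc"
    define w where "w = 1 + cmod2 (g z)"
    define X where "X = w powr (c - 2)"
    define D where "D = cmod (deriv g z)"
    have w: "1 \<le> w" by (simp add: w_def)
    have X: "0 < X" "w powr (c - 1) = X * w" "w powr c = X * w\<^sup>2"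
      using w by (auto simp: X_def powr_diff powr_numeral power2_eq_square)
    have gw: "cmod2 (g z) \<le> w" "cmod (g z) \<le> w"
    proof -
      show "cmod (g z) \<le> w"
        using sum_squares_ge_zero[of "cmod (g z) - 1/2" 0] by (simp add: w_def power2_eq_square algebra_simps)
    qed (simp add: w_def)
    have ww: "w \<le> w\<^sup>2" using w by (simp add: power2_eq_square)
    have "c * (c - 1) * cmod2 (g z) \<le> c\<^sup>2 * w\<^sup>2"
    proof -
      have "c * (c - 1) * cmod2 (g z) \<le> c\<^sup>2 * cmod2 (g z)"
        using c by (intro mult_right_mono) (auto simp: power2_eq_square algebra_simps)
      also have "\<dots> \<le> c\<^sup>2 * w\<^sup>2" using gw ww by (intro mult_left_mono) auto
      finally show ?thesis .
    qed
    moreover have "c * w \<le> c * w\<^sup>2" using ww c by (intro mult_left_mono)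
    ultimately have "c * (c - 1) * cmod2 (g z) + c * w \<le> (c\<^sup>2 + c) * w\<^sup>2" by (simp add: algebra_simps)
    then have "(c * (c - 1) * cmod2 (g z) + c * w) * (X * D\<^sup>2) \<le> (c\<^sup>2 + c) * w\<^sup>2 * (X * D\<^sup>2)"
      using X by (intro mult_right_mono) auto
    then show "c * (c - 1) * (1 + cmod2 (g z)) powr (c - 2) * cmod2 (cnj (g z) * deriv g z) +
      c * (1 + cmod2 (g z)) powr (c - 1) * cmod2 (deriv g z)
      \<le> (c\<^sup>2 + c) * (1 + cmod2 (g z)) powr c * cmod2 (deriv g z)"
      unfolding w_def[symmetric] X_def[symmetric] X D_def[symmetric]
      by (simp add: norm_mult power_mult_distrib D_def[symmetric] algebra_simps)
    have "(c * X * w * D) * cmod (g z) \<le> (c * X * w * D) * w"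
      using gw X c w by (intro mult_left_mono) (auto simp: D_def)
    then show "cmod (of_real (c * (1 + cmod2 (g z)) powr (c - 1)) * (cnj (g z) * deriv g z))
      \<le> c * (1 + cmod2 (g z)) powr c * cmod (deriv g z)"
      unfolding w_def[symmetric] X D_def[symmetric] using X c w
      by (simp add: norm_mult D_def[symmetric] power2_eq_square algebra_simps)
  qed
qed

text \<open>The first term of the bound is the one a paraproduct controls, the second is the price
  of differentiating the weight. Splitting the cross term as 2 (c D U) V <= (c D U)^2 + V^2 accounts
  for the factor 2 and for the second c^2. A positive \<open>e\<close> makes the function strictly
  positive, as powers with small exponents require.\<close>

lemma log_sub_weighted:
  assumes g: "g holomorphic_on unit_disc" and u: "u holomorphic_on unit_disc" and c: "0 \<le> c" and e: "0 \<le> e"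
  obtains d L where "log_sub unit_disc (\<lambda>z. (1 + cmod2 (g z)) powr c * (cmod2 (u z) + e)) d L"
    "\<And>z. z \<in> unit_disc \<Longrightarrow> L z \<le> 2 * ((1 + cmod2 (g z)) powr c * cmod2 (deriv u z)) +
       (2 * c\<^sup>2 + c) * cmod2 (deriv g z) * ((1 + cmod2 (g z)) powr c * (cmod2 (u z) + e))"
proof -
  obtain d L where E: "log_sub unit_disc (\<lambda>z. (1 + cmod2 (g z)) powr c) d L"
    and b: "\<And>z. z \<in> unit_disc \<Longrightarrow> L z \<le> (c\<^sup>2 + c) * (1 + cmod2 (g z)) powr c * cmod2 (deriv g z)"
    "\<And>z. z \<in> unit_disc \<Longrightarrow> cmod (d z) \<le> c * (1 + cmod2 (g z)) powr c * cmod (deriv g z)"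
    using log_sub_regularizer[OF g c] by blast
  have S: "log_sub unit_disc (\<lambda>z. cmod2 (u z) + e) (\<lambda>z. cnj (u z) * deriv u z) (\<lambda>z. cmod2 (deriv u z))"
    using log_sub_add[OF log_sub_cmod2[OF open_ball u] log_sub_const[OF e]] by simp
  show ?thesis
  proof (rule that[OF log_sub_mult[OF E S]])
    fix z assume z: "z \<in> unit_disc"
    define X where "X = (1 + cmod2 (g z)) powr c"
    define D U V S where "D = cmod (deriv g z)" and "U = cmod (u z)" and "V = cmod (deriv u z)" and "S = U\<^sup>2 + e"
    have X: "0 \<le> X" by (simp add: X_def)
    have nn: "0 \<le> D" "0 \<le> U" "0 \<le> V" "0 \<le> S" using e by (auto simp: D_def U_def V_def S_def)
    have "Re (d z * cnj (cnj (u z) * deriv u z)) \<le> cmod (d z * cnj (cnj (u z) * deriv u z))"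
      by (rule complex_Re_le_cmod)
    also have "\<dots> = cmod (d z) * (U * V)" by (simp add: norm_mult U_def V_def)
    also have "\<dots> \<le> c * X * D * (U * V)"
      using b(2)[OF z] nn by (intro mult_right_mono) (auto simp: X_def D_def)
    also have "2 * \<dots> \<le> X * (c\<^sup>2 * D\<^sup>2 * U\<^sup>2 + V\<^sup>2)"
    proof -
      have "2 * (c * D * U) * V \<le> (c * D * U)\<^sup>2 + V\<^sup>2" by (rule sum_squares_bound)
      then show ?thesis using mult_left_mono[OF _ X] by (fastforce simp: power_mult_distrib algebra_simps)
    qed
    finally have 1: "2 * Re (d z * cnj (cnj (u z) * deriv u z)) \<le> X * (c\<^sup>2 * D\<^sup>2 * U\<^sup>2 + V\<^sup>2)" by simp
    have "X * (c\<^sup>2 * D\<^sup>2 * U\<^sup>2) \<le> X * (c\<^sup>2 * D\<^sup>2 * S)"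
      using X e by (intro mult_left_mono) (auto simp: S_def)
    moreover have "S * L z \<le> S * ((c\<^sup>2 + c) * X * D\<^sup>2)"
      using b(1)[OF z] nn by (intro mult_left_mono) (auto simp: X_def D_def)
    ultimately show "(1 + cmod2 (g z)) powr c * cmod2 (deriv u z) + (cmod2 (u z) + e) * L z +
      2 * Re (d z * cnj (cnj (u z) * deriv u z))
      \<le> 2 * ((1 + cmod2 (g z)) powr c * cmod2 (deriv u z)) +
       (2 * c\<^sup>2 + c) * cmod2 (deriv g z) * ((1 + cmod2 (g z)) powr c * (cmod2 (u z) + e))"
      using 1 unfolding X_def[symmetric] D_def[symmetric] U_def[symmetric] V_def[symmetric] S_def[symmetric]
      by (simp add: algebra_simps)
  qed
qed

section \<open>Weighted estimates for paraproducts\<close>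

lemma powr_add_le:
  fixes x y q :: real
  assumes "0 \<le> x" "0 \<le> y" "0 \<le> q"
  shows "(x + y) powr q \<le> 2 powr q * (x powr q + y powr q)"
proof -
  have "(x + y) powr q \<le> (2 * max x y) powr q"
    using assms by (intro powr_mono2) auto
  also have "\<dots> = 2 powr q * max x y powr q"
    using assms by (simp add: powr_mult)
  also have "max x y powr q \<le> x powr q + y powr q"
    by (auto simp: max_def)
  finally show ?thesis by simp
qed

text \<open>Removes the regularization \<open>e\<close>, whose error enters as a multiple of
  e^q.\<close>

lemma le_if_le_add_powr:
  fixes a b k q :: real
  assumes "0 < q" "\<And>e. 0 < e \<Longrightarrow> a \<le> b + k * e powr q"
  shows "a \<le> b"
proof (rule tendsto_lowerbound)
  have "((\<lambda>e. b + k * e powr q) \<longlongrightarrow> b + k * 0 powr q) (at_right 0)"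
    using assms(1) by (intro tendsto_intros) (auto simp: eventually_at_filter)
  then show "((\<lambda>e. b + k * e powr q) \<longlongrightarrow> b) (at_right 0)" by simp
  show "\<forall>\<^sub>F e in at_right 0. a \<le> b + k * e powr q"
    using assms(2) by (auto simp: eventually_at_right_less eventually_at_filter)
qed simp

context disc_mean
begin

text \<open>The Bellman function is (Y + v)^q - v^q / q, with Y built from \<open>u\<close> and v
  from \<open>h\<close>. Concavity lets the gradient term of the first power be dropped. Adding v
  keeps the base of the negative power q - 1 away from the zeros of \<open>u\<close>, and (Y + v)^(q
  - 1) <= v^(q - 1) moves the Laplacian of v onto v^q, where the subtracted term cancels it.\<close>

lemma paraproduct_step_concave:
  assumes g: "g holomorphic_on unit_disc" and u: "u holomorphic_on unit_disc" and h: "h holomorphic_on unit_disc"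
    and u0: "u 0 = 0" and c: "0 \<le> c" "0 \<le> c'" and q: "0 < q" "q \<le> 1" and s: "0 \<le> \<sigma>"
    and C: "carleson (\<lambda>z. (1 + cmod2 (g z)) powr \<sigma> * cmod2 (deriv g z)) \<kappa>"
    and \<kappa>: "2 * (2 + 2 * c\<^sup>2 + c) * \<kappa> \<le> 1"
    and dom: "\<And>z. z \<in> unit_disc \<Longrightarrow> (1 + cmod2 (g z)) powr c * cmod2 (deriv u z) \<le>
       (1 + cmod2 (g z)) powr \<sigma> * cmod2 (deriv g z) * ((1 + cmod2 (g z)) powr c' * cmod2 (h z))"
    and e: "0 < e"
  shows "N (\<lambda>z. ((1 + cmod2 (g z)) powr c * cmod2 (u z)) powr q) \<le>
    2 / q * N (\<lambda>z. ((1 + cmod2 (g z)) powr c' * (cmod2 (h z) + e)) powr q)"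
proof -
  define W where "W = (\<lambda>z. 1 + cmod2 (g z))"
  define \<tau> where "\<tau> = (\<lambda>z. W z powr \<sigma> * cmod2 (deriv g z))"
  \<comment> \<open>Collects the two coefficients in \<open>log_sub_weighted\<close>, once |g'|^2 is
    bounded by \<open>\<tau>\<close>.\<close>
  define M where "M = 2 + 2 * c\<^sup>2 + c"
  have M: "0 < M" using c by (auto simp: M_def intro!: add_pos_nonneg)
  have W: "1 \<le> W z" for z by (simp add: W_def)
  have W1: "1 \<le> W z powr \<sigma>" "0 < W z powr c" "0 < W z powr c'" for z
    using W[of z] s by (auto intro: ge_one_powr_ge_zero)
  have gt: "cmod2 (deriv g z) \<le> \<tau> z" for z
    unfolding \<tau>_def using mult_right_mono[OF W1(1), of "cmod2 (deriv g z)"] by simp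
  define Y where "Y = (\<lambda>z. W z powr c * cmod2 (u z))"
  define v where "v = (\<lambda>z. W z powr c' * (cmod2 (h z) + e))"
  obtain dY LY where Y: "log_sub unit_disc Y dY LY"
    and LY: "\<And>z. z \<in> unit_disc \<Longrightarrow> LY z \<le> 2 * (W z powr c * cmod2 (deriv u z)) +
       (2 * c\<^sup>2 + c) * cmod2 (deriv g z) * Y z"
    using log_sub_weighted[OF g u c(1) order.refl] unfolding Y_def W_def by auto
  obtain dv Lv where v: "log_sub unit_disc v dv Lv"
    using log_sub_weighted[OF g h c(2) less_imp_le[OF e]] unfolding v_def W_def by blast
  have vpos: "0 < v z" for z
    unfolding v_def using W1(3) e by (intro mult_pos_pos add_nonneg_pos) auto
  have Ypos: "0 \<le> Y z" for z unfolding Y_def by simp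
  define \<rho> where "\<rho> = (\<lambda>z. Y z + v z)"
  have \<rho>: "log_sub unit_disc \<rho> (\<lambda>z. dY z + dv z) (\<lambda>z. LY z + Lv z)"
    unfolding \<rho>_def by (rule log_sub_add[OF Y v])
  have \<rho>pos: "0 < \<rho> z" for z unfolding \<rho>_def using vpos Ypos by (intro add_nonneg_pos)
  note \<Phi> = log_sub_powr[OF \<rho> \<rho>pos less_imp_le[OF q(1)]]
  note \<Omega> = log_sub_powr[OF v vpos less_imp_le[OF q(1)]]
  have cont: "continuous_on unit_disc (\<lambda>z. \<rho> z powr q)" "continuous_on unit_disc (\<lambda>z. v z powr q)"
    using c2_continuous(1)[OF log_sub_c2[OF \<Phi>]] c2_continuous(1)[OF log_sub_c2[OF \<Omega>]] .
  have "carleson \<tau> \<kappa>" using C unfolding \<tau>_def W_def .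
  note CM = carleson_scale[OF this M order.refl]
  note F = c2_diff[OF log_sub_c2[OF \<Phi>] c2_cmult[OF log_sub_c2[OF \<Omega>], of "1 / q"]]
  have "N (\<lambda>z. \<rho> z powr q - 1 / q * v z powr q) \<le>
     N (\<lambda>_. 1) * (\<rho> 0 powr q - 1 / q * v 0 powr q) + M * \<kappa> * N (\<lambda>z. \<rho> z powr q)"
  proof (rule carlesonD[OF CM F \<Phi>])
    fix z assume z: "z \<in> unit_disc"
    show "0 < \<rho> z powr q" using \<rho>pos[of z] by simp
    note lv = log_subD[OF v z]
    define R where "R = \<rho> z powr (q - 1)"
    have R: "0 < R" "\<rho> z powr q = R * \<rho> z"
      using \<rho>pos[of z] by (auto simp: R_def powr_diff)
    define T where "T = v z powr (q - 2)"
    have T: "0 < T" "v z powr (q - 1) = T * v z"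
      using vpos[of z] by (auto simp: T_def powr_diff powr_numeral power2_eq_square)
    have "LY z \<le> 2 * (\<tau> z * v z) + (2 * c\<^sup>2 + c) * \<tau> z * Y z"
    proof -
      have "W z powr c * cmod2 (deriv u z) \<le> \<tau> z * (W z powr c' * cmod2 (h z))"
        using dom[OF z] unfolding \<tau>_def W_def .
      also have "\<dots> \<le> \<tau> z * v z"
        unfolding v_def using e W1 by (intro mult_left_mono) (auto simp: \<tau>_def)
      finally have "W z powr c * cmod2 (deriv u z) \<le> \<tau> z * v z" .
      moreover have "(2 * c\<^sup>2 + c) * cmod2 (deriv g z) * Y z \<le> (2 * c\<^sup>2 + c) * \<tau> z * Y z"
        using c Ypos gt[of z] by (intro mult_right_mono mult_left_mono) auto
      ultimately show ?thesis using LY[OF z] by linarith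
    qed
    also have "\<dots> \<le> M * (\<tau> z * \<rho> z)"
    proof -
      have "0 \<le> \<tau> z" by (simp add: \<tau>_def)
      then have "0 \<le> \<tau> z * Y z" "0 \<le> c\<^sup>2 * (\<tau> z * v z)" "0 \<le> c * (\<tau> z * v z)"
        using Ypos[of z] vpos[of z] c by auto
      then show ?thesis unfolding M_def \<rho>_def by (simp add: algebra_simps)
    qed
    finally have LY': "LY z \<le> M * (\<tau> z * \<rho> z)" .
    have 1: "q * (q - 1) * \<rho> z powr (q - 2) * cmod2 (dY z + dv z) + q * R * (LY z + Lv z)
      \<le> R * (M * (\<tau> z * \<rho> z)) + q * (T * v z) * Lv z"
    proof -
      have "q * (q - 1) * \<rho> z powr (q - 2) * cmod2 (dY z + dv z) \<le> 0"
        using q mult_nonpos_nonneg[of "q * (q - 1)" "\<rho> z powr (q - 2) * cmod2 (dY z + dv z)"]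
        by (simp add: mult_le_0_iff mult.assoc)
      moreover have "q * R * LY z \<le> 1 * (R * (M * (\<tau> z * \<rho> z)))"
      proof -
        have "q * (R * LY z) \<le> q * (R * (M * (\<tau> z * \<rho> z)))"
          using q R LY' by (intro mult_left_mono) auto
        also have "\<dots> \<le> 1 * (R * (M * (\<tau> z * \<rho> z)))"
          using q R M \<rho>pos[of z] by (intro mult_right_mono mult_nonneg_nonneg) (auto simp: \<tau>_def)
        finally show ?thesis by (simp add: mult.assoc)
      qed
      moreover have "R \<le> T * v z"
        unfolding R_def T(2)[symmetric] using q vpos[of z] Ypos[of z]
        by (intro powr_mono2') (auto simp: \<rho>_def)
      then have "q * R * Lv z \<le> q * (T * v z) * Lv z"
        using q lv(2) by (intro mult_right_mono mult_left_mono) auto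
      ultimately show ?thesis by (simp add: distrib_left)
    qed
    \<comment> \<open>Log-subharmonicity of \<open>v\<close>: the negative gradient term costs at
      most the fraction 1 - q of the positive one, so the fraction q survives. This is the origin of
      the weight 1 / q in the Bellman function.\<close>
    have 2: "q * (q - 1) * T * cmod2 (dv z) + q * (T * v z) * Lv z \<ge> q * (q * (T * v z) * Lv z)"
    proof -
      have "q * (1 - q) * T * cmod2 (dv z) \<le> q * (1 - q) * T * (v z * Lv z)"
        using q T lv by (intro mult_left_mono mult_nonneg_nonneg) auto
      then show ?thesis by (simp add: algebra_simps)
    qed
    have 3: "1 / q * (q * (q - 1) * T * cmod2 (dv z) + q * (T * v z) * Lv z) \<ge> q * (T * v z) * Lv z"
      using mult_left_mono[OF 2, of "1 / q"] q by simp
    show "q * (q - 1) * \<rho> z powr (q - 2) * cmod2 (dY z + dv z) + q * \<rho> z powr (q - 1) * (LY z + Lv z) -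
      1 / q * (q * (q - 1) * v z powr (q - 2) * cmod2 (dv z) + q * v z powr (q - 1) * Lv z)
      \<le> \<rho> z powr q * (M * \<tau> z)"
      using 1 3 unfolding R_def[symmetric] T_def[symmetric] T(2) R(2) by (simp add: algebra_simps)
  qed
  moreover have "N (\<lambda>z. \<rho> z powr q - 1 / q * v z powr q) = N (\<lambda>z. \<rho> z powr q) - 1 / q * N (\<lambda>z. v z powr q)"
    using add[OF cont(1) continuous_on_mult_left[OF cont(2), of "- (1 / q)"]] cmult[OF cont(2), of "- (1 / q)"]
    by simp
  \<comment> \<open>At 0 only \<open>v\<close> is left in \<open>\<rho>\<close> because u 0 = 0, and
    1 - 1 / q <= 0.\<close>
  moreover have "N (\<lambda>_. 1) * (\<rho> 0 powr q - 1 / q * v 0 powr q) \<le> 0"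
  proof -
    have "\<rho> 0 = v 0" using u0 by (simp add: \<rho>_def Y_def)
    moreover have "1 * v 0 powr q \<le> 1 / q * v 0 powr q" using q by (intro mult_right_mono) auto
    ultimately show ?thesis using N_one by (simp add: mult_nonneg_nonpos)
  qed
  \<comment> \<open>Absorption: the Carleson term is at most half of the left-hand side.\<close>
  moreover have "2 * (M * \<kappa> * N (\<lambda>z. \<rho> z powr q)) \<le> N (\<lambda>z. \<rho> z powr q)"
  proof -
    have "2 * M * \<kappa> * N (\<lambda>z. \<rho> z powr q) \<le> 1 * N (\<lambda>z. \<rho> z powr q)"
      using \<kappa> unfolding M_def by (intro mult_right_mono N_nonneg[OF cont(1)]) auto
    then show ?thesis by (simp add: mult.assoc)
  qed
  ultimately have "N (\<lambda>z. \<rho> z powr q) \<le> 2 / q * N (\<lambda>z. v z powr q)"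
    by simp
  moreover have "N (\<lambda>z. Y z powr q) \<le> N (\<lambda>z. \<rho> z powr q)"
  proof (rule mono[OF _ cont(1)])
    show "continuous_on unit_disc (\<lambda>z. Y z powr q)"
      using q Ypos c2_continuous(1)[OF log_sub_c2[OF Y]]
      by (intro continuous_on_powr' continuous_intros) auto
    show "Y z powr q \<le> \<rho> z powr q" for z
      using q Ypos[of z] vpos[of z] by (intro powr_mono2) (auto simp: \<rho>_def)
  qed
  ultimately show ?thesis unfolding Y_def v_def W_def by linarith
qed

text \<open>For q >= 1 the power q - 1 is harmless and no term has to be subtracted: rho^q, with rho
  the regularized weighted square of \<open>u\<close>, is tested directly against rho^q + v^q. Since
  u 0 = 0, its value at the origin comes from \<open>e\<close> alone and disappears with it.\<close>

lemma paraproduct_step_convex: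
  assumes g: "g holomorphic_on unit_disc" and u: "u holomorphic_on unit_disc" and h: "h holomorphic_on unit_disc"
    and u0: "u 0 = 0" and c: "0 \<le> c" "0 \<le> c'" and q: "1 \<le> q" and s: "0 \<le> \<sigma>"
    and C: "carleson (\<lambda>z. (1 + cmod2 (g z)) powr \<sigma> * cmod2 (deriv g z)) \<kappa>"
    and \<kappa>: "4 * q\<^sup>2 * (2 + 2 * c\<^sup>2 + c) * \<kappa> \<le> 1"
    and dom: "\<And>z. z \<in> unit_disc \<Longrightarrow> (1 + cmod2 (g z)) powr c * cmod2 (deriv u z) \<le>
       (1 + cmod2 (g z)) powr \<sigma> * cmod2 (deriv g z) * ((1 + cmod2 (g z)) powr c' * cmod2 (h z))"
    and e: "0 < e"
  shows "N (\<lambda>z. ((1 + cmod2 (g z)) powr c * cmod2 (u z)) powr q) \<le>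
    N (\<lambda>z. ((1 + cmod2 (g z)) powr c' * (cmod2 (h z) + e)) powr q) +
    2 * N (\<lambda>_. 1) * ((1 + cmod2 (g 0)) powr c * e) powr q"
proof -
  define W where "W = (\<lambda>z. 1 + cmod2 (g z))"
  define \<tau> where "\<tau> = (\<lambda>z. W z powr \<sigma> * cmod2 (deriv g z))"
  define M where "M = 2 + 2 * c\<^sup>2 + c"
  have M: "0 < M" using c by (auto simp: M_def intro!: add_pos_nonneg)
  have W: "1 \<le> W z" for z by (simp add: W_def)
  have W1: "1 \<le> W z powr \<sigma>" "0 < W z powr c" "0 < W z powr c'" for z
    using W[of z] s by (auto intro: ge_one_powr_ge_zero)
  have gt: "cmod2 (deriv g z) \<le> \<tau> z" for z
    unfolding \<tau>_def using mult_right_mono[OF W1(1), of "cmod2 (deriv g z)"] by simp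
  define \<rho> where "\<rho> = (\<lambda>z. W z powr c * (cmod2 (u z) + e))"
  define v where "v = (\<lambda>z. W z powr c' * (cmod2 (h z) + e))"
  obtain d L where \<rho>: "log_sub unit_disc \<rho> d L"
    and L: "\<And>z. z \<in> unit_disc \<Longrightarrow> L z \<le> 2 * (W z powr c * cmod2 (deriv u z)) +
       (2 * c\<^sup>2 + c) * cmod2 (deriv g z) * \<rho> z"
    using log_sub_weighted[OF g u c(1) less_imp_le[OF e]] unfolding \<rho>_def W_def by blast
  obtain dv Lv where v: "log_sub unit_disc v dv Lv"
    using log_sub_weighted[OF g h c(2) less_imp_le[OF e]] unfolding v_def W_def by blast
  have vpos: "0 < v z" for z
    unfolding v_def using W1(3) e by (intro mult_pos_pos add_nonneg_pos) auto
  have \<rho>pos: "0 < \<rho> z" for z 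
    unfolding \<rho>_def using W1(2) e by (intro mult_pos_pos add_nonneg_pos) auto
  have q0: "0 \<le> q" using q by simp
  note \<Phi> = log_sub_powr[OF \<rho> \<rho>pos q0]
  note \<Omega> = log_sub_powr[OF v vpos q0]
  have cont: "continuous_on unit_disc (\<lambda>z. \<rho> z powr q)" "continuous_on unit_disc (\<lambda>z. v z powr q)"
    using c2_continuous(1)[OF log_sub_c2[OF \<Phi>]] c2_continuous(1)[OF log_sub_c2[OF \<Omega>]] .
  \<comment> \<open>q^2 comes from |d|^2 <= F L in the Laplacian of rho^q, M from the bound for the
    Laplacian of rho, and 2 from rho^(q - 1) (rho + v) <= 2 (rho^q + v^q).\<close>
  define A where "A = 2 * q\<^sup>2 * M"
  have A: "0 < A" using M q by (simp add: A_def)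
  have "carleson \<tau> \<kappa>" using C unfolding \<tau>_def W_def .
  note CM = carleson_scale[OF this A order.refl]
  have "N (\<lambda>z. \<rho> z powr q) \<le>
     N (\<lambda>_. 1) * (\<rho> 0 powr q) + A * \<kappa> * N (\<lambda>z. \<rho> z powr q + v z powr q)"
  proof (rule carlesonD[OF CM log_sub_c2[OF \<Phi>] log_sub_add[OF \<Phi> \<Omega>]])
    fix z assume z: "z \<in> unit_disc"
    show "0 < \<rho> z powr q + v z powr q" using \<rho>pos[of z] vpos[of z] by (simp add: add_pos_pos)
    note l = log_subD[OF \<rho> z]
    have \<tau>0: "0 \<le> \<tau> z" by (simp add: \<tau>_def)
    define R where "R = \<rho> z powr (q - 2)"
    have R: "0 < R" "\<rho> z powr (q - 1) = R * \<rho> z"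
      using \<rho>pos[of z] by (auto simp: R_def powr_diff powr_numeral power2_eq_square)
    have "L z \<le> 2 * (\<tau> z * v z) + (2 * c\<^sup>2 + c) * \<tau> z * \<rho> z"
    proof -
      have "W z powr c * cmod2 (deriv u z) \<le> \<tau> z * (W z powr c' * cmod2 (h z))"
        using dom[OF z] unfolding \<tau>_def W_def .
      also have "\<dots> \<le> \<tau> z * v z"
        unfolding v_def using e W1 by (intro mult_left_mono) (auto simp: \<tau>_def)
      finally have "W z powr c * cmod2 (deriv u z) \<le> \<tau> z * v z" .
      moreover have "(2 * c\<^sup>2 + c) * cmod2 (deriv g z) * \<rho> z \<le> (2 * c\<^sup>2 + c) * \<tau> z * \<rho> z"
        using c gt[of z] \<rho>pos[of z] by (intro mult_right_mono mult_left_mono) auto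
      ultimately show ?thesis using L[OF z] by linarith
    qed
    also have "\<dots> \<le> M * \<tau> z * (\<rho> z + v z)"
    proof -
      have "0 \<le> \<tau> z * \<rho> z" "0 \<le> c\<^sup>2 * (\<tau> z * v z)" "0 \<le> c * (\<tau> z * v z)"
        using \<tau>0 \<rho>pos[of z] vpos[of z] c by (auto intro!: mult_nonneg_nonneg less_imp_le)
      then show ?thesis unfolding M_def by (simp add: algebra_simps)
    qed
    finally have L': "L z \<le> M * \<tau> z * (\<rho> z + v z)" .
    have "q * (q - 1) * R * cmod2 (d z) \<le> q * (q - 1) * R * (\<rho> z * L z)"
      using q R l by (intro mult_left_mono mult_nonneg_nonneg) auto
    then have "q * (q - 1) * R * cmod2 (d z) + q * (R * \<rho> z) * L z \<le> q\<^sup>2 * (R * \<rho> z) * L z"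
      by (simp add: power2_eq_square algebra_simps)
    also have "\<dots> \<le> q\<^sup>2 * (R * \<rho> z) * (M * \<tau> z * (\<rho> z + v z))"
      using L' R \<rho>pos[of z] by (intro mult_left_mono) auto
    also have "\<dots> = q\<^sup>2 * M * \<tau> z * (\<rho> z powr (q - 1) * (\<rho> z + v z))"
      unfolding R(2) by (simp add: algebra_simps)
    also have "\<dots> \<le> q\<^sup>2 * M * \<tau> z * (2 * (\<rho> z powr q + v z powr q))"
    proof (rule mult_left_mono)
      define m where "m = max (\<rho> z) (v z)"
      have m: "0 < m" "\<rho> z \<le> m" "v z \<le> m" using \<rho>pos[of z] by (auto simp: m_def)
      have "\<rho> z powr (q - 1) * (\<rho> z + v z) \<le> m powr (q - 1) * (2 * m)"
        using m q \<rho>pos[of z] vpos[of z] by (intro mult_mono powr_mono2) auto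
      also have "\<dots> = 2 * m powr q" using m by (simp add: powr_diff)
      also have "m powr q \<le> \<rho> z powr q + v z powr q" by (simp add: m_def max_def)
      finally show "\<rho> z powr (q - 1) * (\<rho> z + v z) \<le> 2 * (\<rho> z powr q + v z powr q)" by simp
    qed (use M \<tau>0 in simp)
    finally show "q * (q - 1) * \<rho> z powr (q - 2) * cmod2 (d z) + q * \<rho> z powr (q - 1) * L z
      \<le> (\<rho> z powr q + v z powr q) * (A * \<tau> z)"
      unfolding R_def[symmetric] R(2) A_def by (simp add: algebra_simps)
  qed
  moreover have "N (\<lambda>z. \<rho> z powr q + v z powr q) = N (\<lambda>z. \<rho> z powr q) + N (\<lambda>z. v z powr q)"
    by (rule add[OF cont])
  moreover have "2 * (A * \<kappa> * N (\<lambda>z. \<rho> z powr q + v z powr q)) \<le> N (\<lambda>z. \<rho> z powr q + v z powr q)"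
  proof -
    have "2 * A * \<kappa> * N (\<lambda>z. \<rho> z powr q + v z powr q) \<le> 1 * N (\<lambda>z. \<rho> z powr q + v z powr q)"
      using \<kappa> unfolding M_def A_def
      by (intro mult_right_mono N_nonneg continuous_intros cont) auto
    then show ?thesis by (simp add: mult.assoc)
  qed
  ultimately have "N (\<lambda>z. \<rho> z powr q) \<le> N (\<lambda>z. v z powr q) + 2 * (N (\<lambda>_. 1) * (\<rho> 0 powr q))"
    by simp
  moreover have "N (\<lambda>z. (W z powr c * cmod2 (u z)) powr q) \<le> N (\<lambda>z. \<rho> z powr q)"
  proof (rule mono[OF _ cont(1)])
    have "continuous_on unit_disc (\<lambda>z. W z powr c * cmod2 (u z))"
      unfolding W_def using holomorphic_on_imp_continuous_on[OF g] holomorphic_on_imp_continuous_on[OF u]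
      by (intro continuous_intros) (auto simp: add_nonneg_eq_0_iff)
    then show "continuous_on unit_disc (\<lambda>z. (W z powr c * cmod2 (u z)) powr q)"
      using q by (intro continuous_on_powr' continuous_on_const) auto
    show "(W z powr c * cmod2 (u z)) powr q \<le> \<rho> z powr q" for z
      using q e by (intro powr_mono2) (auto simp: \<rho>_def intro!: mult_left_mono)
  qed
  moreover have "\<rho> 0 = W 0 powr c * e" using u0 by (simp add: \<rho>_def)
  ultimately show ?thesis unfolding v_def W_def by (simp add: mult.assoc)
qed

text \<open>The smallness condition on \<open>\<kappa>\<close> covers both ranges of
  \<open>q\<close>. Letting \<open>e\<close> tend to 0 by means of \<open>powr_add_le\<close> costs
  the factor 2^q.\<close>

lemma paraproduct_step:
  assumes g: "g holomorphic_on unit_disc" and u: "u holomorphic_on unit_disc" and h: "h holomorphic_on unit_disc"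
    and u0: "u 0 = 0" and c: "0 \<le> c" "0 \<le> c'" and q: "0 < q" and s: "0 \<le> \<sigma>" and k0: "0 \<le> \<kappa>"
    and C: "carleson (\<lambda>z. (1 + cmod2 (g z)) powr \<sigma> * cmod2 (deriv g z)) \<kappa>"
    and \<kappa>: "4 * (1 + q\<^sup>2) * (2 + 2 * c\<^sup>2 + c) * \<kappa> \<le> 1"
    and dom: "\<And>z. z \<in> unit_disc \<Longrightarrow> (1 + cmod2 (g z)) powr c * cmod2 (deriv u z) \<le>
       (1 + cmod2 (g z)) powr \<sigma> * cmod2 (deriv g z) * ((1 + cmod2 (g z)) powr c' * cmod2 (h z))"
  shows "N (\<lambda>z. ((1 + cmod2 (g z)) powr c * cmod2 (u z)) powr q) \<le>
    2 powr q * (2 / q + 1) * N (\<lambda>z. ((1 + cmod2 (g z)) powr c' * cmod2 (h z)) powr q)"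
proof -
  define W where "W = (\<lambda>z. 1 + cmod2 (g z))"
  have Wpos: "W z > 0" for z by (auto simp: W_def intro: add_pos_nonneg)
  have cW: "continuous_on unit_disc W" "continuous_on unit_disc (\<lambda>z. cmod2 (h z))"
    unfolding W_def using holomorphic_on_imp_continuous_on[OF g] holomorphic_on_imp_continuous_on[OF h]
    by (auto intro!: continuous_intros)
  have cWp: "continuous_on unit_disc (\<lambda>z. W z powr r)" for r
    using Wpos by (intro continuous_intros cW) (metis less_irrefl)
  define A where "A = N (\<lambda>z. (W z powr c' * cmod2 (h z)) powr q)"
  define B where "B = N (\<lambda>z. (W z powr c') powr q)"
  define X where "X = (\<lambda>e. N (\<lambda>z. (W z powr c' * (cmod2 (h z) + e)) powr q))"
  have c1: "continuous_on unit_disc (\<lambda>z. (W z powr c' * cmod2 (h z)) powr q)"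
    using q by (intro continuous_on_powr' continuous_intros cWp cW) auto
  have c2: "continuous_on unit_disc (\<lambda>z. (W z powr c') powr q)"
    using q by (intro continuous_on_powr' continuous_intros cWp cW) auto
  have AB: "0 \<le> A" "0 \<le> B" unfolding A_def B_def by (auto intro!: N_nonneg c1 c2)
  have X: "X e \<le> 2 powr q * A + 2 powr q * B * e powr q" if e: "0 < e" for e
  proof -
    have "X e \<le> N (\<lambda>z. 2 powr q * (W z powr c' * cmod2 (h z)) powr q + 2 powr q * e powr q * (W z powr c') powr q)"
      unfolding X_def
    proof (rule mono)
      show "continuous_on unit_disc (\<lambda>z. (W z powr c' * (cmod2 (h z) + e)) powr q)"
        using q e by (intro continuous_on_powr' continuous_intros cWp cW) auto
      show "continuous_on unit_disc (\<lambda>z. 2 powr q * (W z powr c' * cmod2 (h z)) powr q + 2 powr q * e powr q * (W z powr c') powr q)"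
        by (intro continuous_intros c1 c2)
      fix z
      have "(W z powr c' * (cmod2 (h z) + e)) powr q = (W z powr c' * cmod2 (h z) + W z powr c' * e) powr q"
        by (simp add: algebra_simps)
      also have "\<dots> \<le> 2 powr q * ((W z powr c' * cmod2 (h z)) powr q + (W z powr c' * e) powr q)"
        using q e by (intro powr_add_le) auto
      finally show "(W z powr c' * (cmod2 (h z) + e)) powr q
        \<le> 2 powr q * (W z powr c' * cmod2 (h z)) powr q + 2 powr q * e powr q * (W z powr c') powr q"
        using e by (simp add: powr_mult algebra_simps)
    qed
    also have "\<dots> = 2 powr q * A + 2 powr q * e powr q * B"
      unfolding A_def B_def by (subst add) (auto intro!: continuous_intros c1 c2 simp: cmult[OF c1] cmult[OF c2])
    finally show ?thesis by (simp add: algebra_simps)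
  qed
  define K where "K = 2 powr q * (2 / q + 1)"
  define Z where "Z = N (\<lambda>z. (W z powr c * cmod2 (u z)) powr q)"
  have M: "0 \<le> (2 + 2 * c\<^sup>2 + c) * \<kappa>" using c k0 by auto
  show ?thesis
  proof (cases "q \<le> 1")
    case True
    have "2 * ((2 + 2 * c\<^sup>2 + c) * \<kappa>) \<le> 4 * (1 + q\<^sup>2) * ((2 + 2 * c\<^sup>2 + c) * \<kappa>)"
      using M by (intro mult_right_mono) (auto intro: order.trans[of _ 4])
    with \<kappa> have k: "2 * (2 + 2 * c\<^sup>2 + c) * \<kappa> \<le> 1" by (simp only: mult.assoc)
    have "Z \<le> 2 / q * (2 powr q * A)"
    proof (rule le_if_le_add_powr[OF q])
      fix e :: real assume e: "0 < e"
      have "Z \<le> 2 / q * X e"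
        using paraproduct_step_concave[OF g u h u0 c q True s C k dom e] unfolding Z_def X_def W_def .
      also have "\<dots> \<le> 2 / q * (2 powr q * A + 2 powr q * B * e powr q)"
        using X[OF e] q by (intro mult_left_mono) auto
      finally show "Z \<le> 2 / q * (2 powr q * A) + (2 / q * (2 powr q * B)) * e powr q"
        by (simp add: algebra_simps)
    qed
    also have "\<dots> \<le> K * A" using AB by (simp add: K_def algebra_simps)
    finally show ?thesis unfolding Z_def K_def A_def W_def .
  next
    case False
    have "4 * q\<^sup>2 * ((2 + 2 * c\<^sup>2 + c) * \<kappa>) \<le> 4 * (1 + q\<^sup>2) * ((2 + 2 * c\<^sup>2 + c) * \<kappa>)"
      using M by (intro mult_right_mono) auto
    with \<kappa> have k: "4 * q\<^sup>2 * (2 + 2 * c\<^sup>2 + c) * \<kappa> \<le> 1" by (simp only: mult.assoc)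
    have q1: "1 \<le> q" using False by simp
    have "Z \<le> 2 powr q * A"
    proof (rule le_if_le_add_powr[OF q])
      fix e :: real assume e: "0 < e"
      have "Z \<le> X e + 2 * N (\<lambda>_. 1) * (W 0 powr c * e) powr q"
        using paraproduct_step_convex[OF g u h u0 c q1 s C k dom e] unfolding Z_def X_def W_def .
      also have "(W 0 powr c * e) powr q = (W 0 powr c) powr q * e powr q"
        using e by (simp add: powr_mult)
      finally show "Z \<le> 2 powr q * A + (2 powr q * B + 2 * N (\<lambda>_. 1) * (W 0 powr c) powr q) * e powr q"
        using X[OF e] by (simp add: algebra_simps)
    qed
    also have "\<dots> \<le> K * A" using AB q by (simp add: K_def algebra_simps)
    finally show ?thesis unfolding Z_def K_def A_def W_def .
  qed
qed

text \<open>The last application of \<open>T_op\<close> and all those of \<open>S_op\<close> are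
  merged into the single function \<open>u\<close>, whose derivative is known in closed form. Hence
  \<open>n\<close> is here one less than the number of applications of \<open>T_op\<close>, and
  \<open>Suc n\<close> estimates are made.\<close>

lemma paraproduct_chain:
  assumes g: "g holomorphic_on unit_disc" and h: "\<And>k. h k holomorphic_on unit_disc"
    and u: "u holomorphic_on unit_disc"
    and h0: "\<And>k. h (Suc k) 0 = 0" and u0: "u 0 = 0"
    and h': "\<And>k z. z \<in> unit_disc \<Longrightarrow> deriv (h (Suc k)) z = h k z * deriv g z"
    and u': "\<And>z. z \<in> unit_disc \<Longrightarrow> deriv u z = g z ^ m * deriv g z * h n z"
    and s: "0 \<le> \<sigma>" "real m = real (Suc n) * \<sigma>" and q: "0 < q" and k0: "0 \<le> \<kappa>"
    and C: "carleson (\<lambda>z. (1 + cmod2 (g z)) powr \<sigma> * cmod2 (deriv g z)) \<kappa>"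
    and \<kappa>: "4 * (1 + q\<^sup>2) * (2 + 2 * (real m)\<^sup>2 + real m) * \<kappa> \<le> 1"
  shows "N (\<lambda>z. cmod2 (u z) powr q) \<le> (2 powr q * (2 / q + 1)) ^ Suc n * N (\<lambda>z. cmod2 (h 0 z) powr q)"
proof -
  define W where "W = (\<lambda>z. 1 + cmod2 (g z))"
  have W1: "1 \<le> W z" for z by (simp add: W_def)
  then have Wpos: "W z > 0" for z by (metis less_le_trans zero_less_one)
  define K where "K = 2 powr q * (2 / q + 1)"
  have K: "0 \<le> K" using q by (simp add: K_def)
  \<comment> \<open>The condition is increasing in the weight exponent, and the largest exponent
    that can occur is at most \<open>m\<close>.\<close>
  have small: "4 * (1 + q\<^sup>2) * (2 + 2 * c\<^sup>2 + c) * \<kappa> \<le> 1" if c: "0 \<le> c" "c \<le> real m" for c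
  proof -
    have "4 * (1 + q\<^sup>2) * (2 + 2 * c\<^sup>2 + c) * \<kappa> \<le> 4 * (1 + q\<^sup>2) * (2 + 2 * (real m)\<^sup>2 + real m) * \<kappa>"
      using c k0 by (intro mult_right_mono mult_left_mono add_mono power_mono) auto
    then show ?thesis using \<kappa> by linarith
  qed
  define X where "X = (\<lambda>k. N (\<lambda>z. (W z powr (real k * \<sigma>) * cmod2 (h k z)) powr q))"
  have X: "X k \<le> K ^ k * X 0" if "k \<le> n" for k
    using that
  proof (induction k)
    case (Suc k)
    have "real (Suc k) * \<sigma> \<le> real m"
      unfolding s(2) using s(1) Suc.prems by (intro mult_right_mono) auto
    then have sm: "4 * (1 + q\<^sup>2) * (2 + 2 * (real (Suc k) * \<sigma>)\<^sup>2 + real (Suc k) * \<sigma>) * \<kappa> \<le> 1"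
      using s(1) by (intro small) auto
    have "X (Suc k) \<le> K * X k"
      unfolding X_def K_def W_def
    proof (rule paraproduct_step[OF g h h h0 _ _ q s(1) k0 C sm])
      fix z assume z: "z \<in> unit_disc"
      have e: "W z powr (real (Suc k) * \<sigma>) = W z powr \<sigma> * W z powr (real k * \<sigma>)"
        using Wpos[of z] by (simp add: powr_add[symmetric] algebra_simps)
      show "(1 + cmod2 (g z)) powr (real (Suc k) * \<sigma>) * cmod2 (deriv (h (Suc k)) z)
         \<le> (1 + cmod2 (g z)) powr \<sigma> * cmod2 (deriv g z) *
            ((1 + cmod2 (g z)) powr (real k * \<sigma>) * cmod2 (h k z))"
        unfolding e[unfolded W_def] h'[OF z] by (simp add: norm_mult power_mult_distrib algebra_simps)
    qed (use s in auto)
    also have "\<dots> \<le> K * (K ^ k * X 0)" using Suc K by (intro mult_left_mono) auto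
    finally show ?case by simp
  qed simp
  \<comment> \<open>The whole accumulated weight is spent here: the exponent drops from n \<sigma>
    to 0, because |g|^(2 m) <= W^m = W^\<sigma> W^(n \<sigma>).\<close>
  have "N (\<lambda>z. (W z powr 0 * cmod2 (u z)) powr q) \<le> K * X n"
    unfolding X_def K_def W_def
  proof (rule paraproduct_step[OF g u h u0 _ _ q s(1) k0 C])
    fix z assume z: "z \<in> unit_disc"
    have "(cmod2 (g z)) ^ m \<le> W z ^ m" by (intro power_mono) (auto simp: W_def)
    also have "\<dots> = W z powr (\<sigma> + real n * \<sigma>)"
      using Wpos[of z] s(2) by (simp add: powr_realpow[symmetric] algebra_simps)
    also have "\<dots> = W z powr \<sigma> * W z powr (real n * \<sigma>)" by (rule powr_add)
    finally have "(cmod2 (g z)) ^ m * (cmod2 (deriv g z) * cmod2 (h n z))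
      \<le> W z powr \<sigma> * W z powr (real n * \<sigma>) * (cmod2 (deriv g z) * cmod2 (h n z))"
      by (intro mult_right_mono) auto
    then show "(1 + cmod2 (g z)) powr 0 * cmod2 (deriv u z)
       \<le> (1 + cmod2 (g z)) powr \<sigma> * cmod2 (deriv g z) *
          ((1 + cmod2 (g z)) powr (real n * \<sigma>) * cmod2 (h n z))"
      using W1[of z] unfolding u'[OF z] W_def
      by (simp add: norm_mult power_mult_distrib norm_power power_mult[symmetric] mult.commute[of 2] algebra_simps)
  next
    show "4 * (1 + q\<^sup>2) * (2 + 2 * 0\<^sup>2 + 0) * \<kappa> \<le> 1" by (rule small) auto
  qed (use s in auto)
  also have "\<dots> \<le> K * (K ^ n * X 0)" using X[of n] K by (intro mult_left_mono) auto
  also have "X 0 = N (\<lambda>z. cmod2 (h 0 z) powr q)"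
    unfolding X_def using Wpos by (simp add: less_imp_neq[symmetric])
  finally show ?thesis using Wpos by (simp add: K_def less_imp_neq[symmetric])
qed

end

section \<open>Bergman means\<close>

lemma disc_mean_circle_mean:
  assumes "0 \<le> r" "r < 1"
  shows "disc_mean (circle_mean r)"
  by unfold_locales (use assms in \<open>auto intro!: circle_mean_mono circle_mean_add simp: circle_mean_cmult\<close>)

text \<open>\<open>2 * r\<close> is the radial density of normalized area, so \<alpha> + 1 times
  this is the Bergman integral over the disc of radius \<open>R\<close>. Stopping at R < 1 keeps all
  integrands continuous.\<close>

definition bergman_mean :: "real \<Rightarrow> real \<Rightarrow> (complex \<Rightarrow> real) \<Rightarrow> real" where
  "bergman_mean \<alpha> R F = integral {0..R} (\<lambda>r. circle_mean r F * ((1 - r\<^sup>2) powr \<alpha> * (2 * r)))"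

lemma continuous_on_circle_mean:
  assumes "continuous_on unit_disc F" "R < 1"
  shows "continuous_on {0..R} (\<lambda>r. circle_mean r F)"
  by (rule continuous_on_subset[OF circle_mean_continuous[OF assms(1)]]) (use assms in auto)

lemma continuous_on_bergman_weight:
  fixes R :: real assumes "R < 1"
  shows "continuous_on {0..R} (\<lambda>r. (1 - r\<^sup>2) powr \<alpha> * (2 * r))"
  by (intro continuous_intros) (use assms in \<open>auto simp: power2_eq_1_iff\<close>)

lemma bergman_mean_integrable:
  assumes "continuous_on unit_disc F" "R < 1"
  shows "(\<lambda>r. circle_mean r F * ((1 - r\<^sup>2) powr \<alpha> * (2 * r))) integrable_on {0..R}"
  by (intro integrable_continuous_interval continuous_on_mult continuous_on_circle_mean
      continuous_on_bergman_weight assms)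

lemma disc_mean_bergman_mean:
  assumes "R < 1"
  shows "disc_mean (bergman_mean \<alpha> R)"
proof
  fix F G :: "complex \<Rightarrow> real" assume F: "continuous_on unit_disc F" and G: "continuous_on unit_disc G"
  show "bergman_mean \<alpha> R (\<lambda>z. F z + G z) = bergman_mean \<alpha> R F + bergman_mean \<alpha> R G"
    unfolding bergman_mean_def integral_add[OF bergman_mean_integrable[OF F assms] bergman_mean_integrable[OF G assms], symmetric]
    by (rule integral_cong) (use assms in \<open>simp add: circle_mean_add[OF F G] distrib_right\<close>)
  assume le: "\<And>z. z \<in> unit_disc \<Longrightarrow> F z \<le> G z"
  show "bergman_mean \<alpha> R F \<le> bergman_mean \<alpha> R G"
    unfolding bergman_mean_def
    by (intro integral_le bergman_mean_integrable F G assms mult_right_mono circle_mean_mono le)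
      (use assms in auto)
next
  fix F :: "complex \<Rightarrow> real" and k
  show "bergman_mean \<alpha> R (\<lambda>z. k * F z) = k * bergman_mean \<alpha> R F"
    unfolding bergman_mean_def circle_mean_cmult mult.assoc by simp
qed

lemma bergman_carleson:
  assumes \<tau>: "\<And>z. z \<in> unit_disc \<Longrightarrow> (1 - cmod2 z)\<^sup>2 * \<tau> z \<le> 1"
    and \<alpha>: "-1 < \<alpha>" and R: "0 \<le> R" "R < 1"
  shows "disc_mean.carleson (bergman_mean \<alpha> R) \<tau> (1 + 2 / (\<alpha> + 1))"
proof -
  interpret disc_mean "bergman_mean \<alpha> R" by (rule disc_mean_bergman_mean[OF R(2)])
  show ?thesis
    unfolding carleson_def
  proof (intro allI impI)
    fix F d L V e K
    assume F: "c2 unit_disc F d L" and V: "log_sub unit_disc V e K" "\<forall>z\<in>unit_disc. 0 < V z"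
      and L: "\<forall>z\<in>unit_disc. L z \<le> V z * \<tau> z"
    note cF = c2_continuous(1)[OF F] and cV = c2_continuous(1)[OF log_sub_c2[OF V(1)]]
    have t1: "cmod2 z < 1" if "z \<in> unit_disc" for z
      using that by (simp add: abs_square_less_1)
    have "c2 unit_disc (\<lambda>z. ln (1 - cmod2 z)) (\<lambda>z. of_real (- inverse (1 - cmod2 z)) * (cnj z * deriv (\<lambda>z. z) z))
      (\<lambda>z. - (inverse (1 - cmod2 z))\<^sup>2 * cmod2 (cnj z * deriv (\<lambda>z. z) z) + - inverse (1 - cmod2 z) * cmod2 (deriv (\<lambda>z. z) z))"
    proof (rule c2_compose[OF c2_cmod2[OF open_ball holomorphic_on_ident],
          where \<phi> = "\<lambda>x. ln (1 - x)" and ?\<phi>1.0 = "\<lambda>x. - inverse (1 - x)" and ?\<phi>2.0 = "\<lambda>x. - (inverse (1 - x))\<^sup>2"])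
      show "continuous_on unit_disc (\<lambda>z. - (inverse (1 - cmod2 z))\<^sup>2)"
        using t1 by (intro continuous_intros) force
    qed (use t1 in \<open>auto intro!: derivative_eq_intros simp: field_simps power2_eq_square less_imp_neq\<close>)
    then obtain d' K' where G: "c2 unit_disc (\<lambda>z. exp (- ln (1 - cmod2 z)) * V z) d' K'"
      and K': "\<And>z. z \<in> unit_disc \<Longrightarrow> - (exp (- ln (1 - cmod2 z)) * V z *
         (- (inverse (1 - cmod2 z))\<^sup>2 * cmod2 (cnj z * deriv (\<lambda>z. z) z) + - inverse (1 - cmod2 z) * cmod2 (deriv (\<lambda>z. z) z))) \<le> K' z"
      using c2_exp_mult[OF V(1)] by blast
    define G where "G = (\<lambda>z. exp (- ln (1 - cmod2 z)) * V z)"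
    note G' = G[folded G_def]
    have VG: "V z = (1 - cmod2 z) * G z" if "z \<in> unit_disc" for z
      using t1[OF that] by (simp add: G_def exp_minus)
    have G0: "0 \<le> G z" if "z \<in> unit_disc" for z
      using V(2) that by (auto simp: G_def intro: less_imp_le)
    have LK: "L z \<le> (1 - cmod2 z) * K' z" if z: "z \<in> unit_disc" for z
    proof -
      define i where "i = 1 - cmod2 z"
      have i: "0 < i" using t1[OF z] by (simp add: i_def)
      have Vz: "0 < V z" using V z by auto
      have "i\<^sup>2 * L z \<le> i\<^sup>2 * (V z * \<tau> z)" using L z by (intro mult_left_mono) auto
      also have "\<dots> = V z * (i\<^sup>2 * \<tau> z)" by simp
      also have "\<dots> \<le> V z * 1" using \<tau>[OF z] Vz by (intro mult_left_mono) (auto simp: i_def)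
      finally have 1: "i\<^sup>2 * L z \<le> V z" by simp
      have "V z * (inverse i * ((inverse i)\<^sup>2 * (1 - i) + inverse i)) \<le> K' z"
        using K'[OF z] i by (simp add: i_def exp_minus norm_mult algebra_simps)
      moreover have "inverse i * ((inverse i)\<^sup>2 * (1 - i) + inverse i) = inverse (i^3)"
        using i by (simp add: field_simps power2_eq_square power3_eq_cube)
      ultimately have "V z * inverse (i^3) \<le> K' z" by simp
      then have "V z \<le> i^3 * K' z" using i by (simp add: field_simps)
      with 1 have "i\<^sup>2 * L z \<le> i\<^sup>2 * (i * K' z)" by (simp add: power2_eq_square power3_eq_cube mult.assoc)
      then show ?thesis using i by (simp add: i_def)
    qed
    define w where "w = (\<lambda>r::real. (1 - r\<^sup>2) powr \<alpha> * (2 * r))"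
    define J where "J = (\<lambda>r. integral {0..r} (\<lambda>s. 4 * s * circle_mean s G))"
    have cG: "continuous_on unit_disc G" by (rule c2_continuous(1)[OF G'])
    have cg: "continuous_on {0..R} (\<lambda>s. 4 * s * circle_mean s G)"
      by (intro continuous_intros continuous_on_circle_mean cG R)
    have cJ: "continuous_on {0..R} J"
      unfolding J_def using indefinite_integral_continuous_1 integrable_continuous_interval[OF cg] by blast
    have cw: "continuous_on {0..R} w" unfolding w_def by (rule continuous_on_bergman_weight[OF R(2)])
    have wn: "0 \<le> w r" if "0 \<le> r" for r using that by (simp add: w_def)
    have cmp: "circle_mean r F \<le> F 0 + (circle_mean r V + J r)" if "0 \<le> r" "r \<le> R" for r
      using circle_mean_compare[OF F log_sub_c2[OF V(1)] G' VG G0 LK, of r] that R by (simp add: J_def)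
    have Gpos: "0 \<le> circle_mean r G" if "0 \<le> r" "r \<le> R" for r
      using circle_mean_mono[of "\<lambda>_. 0" G r] cG G0 that R by simp
    have VGm: "circle_mean r V = (1 - r\<^sup>2) * circle_mean r G" if "0 \<le> r" "r \<le> R" for r
    proof -
      have "circle_mean r V = circle_mean r (\<lambda>z. (1 - cmod2 z) * G z)"
        unfolding circle_mean_def using VG that R by simp
      also have "\<dots> = (1 - \<bar>r\<bar>\<^sup>2) * circle_mean r G" by (rule circle_mean_radial)
      finally show ?thesis by simp
    qed
    have int: "(\<lambda>r. f r * w r) integrable_on {0..R}" if "continuous_on {0..R} f" for f
      using that cw by (intro integrable_continuous_interval continuous_intros)
    have cFr: "continuous_on {0..R} (\<lambda>r. circle_mean r F)" and cVr: "continuous_on {0..R} (\<lambda>r. circle_mean r V)"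
      by (intro continuous_on_circle_mean cF cV R)+
    have "integral {0..R} (\<lambda>r. J r * w r) \<le> 2 / (\<alpha> + 1) * integral {0..R} (\<lambda>r. circle_mean r V * w r)"
    proof -
      \<comment> \<open>An antiderivative of -w that vanishes at 1. Integrating by parts, b times
        the derivative of \<open>J\<close> becomes 2 / (\<alpha> + 1) times the mean of V against w,
        and the boundary term at R has a sign that allows it to be dropped.\<close>
      define b where "b = (\<lambda>r. (1 - r\<^sup>2) powr (\<alpha> + 1) / (\<alpha> + 1))"
      have cb: "continuous_on {0..R} b"
        unfolding b_def using R \<alpha> by (intro continuous_intros) (auto simp: power2_eq_1_iff)
      have "((\<lambda>r. 2 / (\<alpha> + 1) * (circle_mean r V * w r) - J r * w r) has_integral b R * J R - b 0 * J 0) {0..R}"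
      proof (rule fundamental_theorem_of_calculus_interior[OF R(1)])
        show "continuous_on {0..R} (\<lambda>r. b r * J r)" by (intro continuous_intros cb cJ)
        fix r assume r: "r \<in> {0<..<R}"
        have "(J has_real_derivative 4 * r * circle_mean r G) (at r within {0..R})"
          unfolding J_def by (rule integral_has_real_derivative[OF cg]) (use r in auto)
        then have J': "(J has_real_derivative 4 * r * circle_mean r G) (at r)"
          using r by (simp add: at_within_Icc_at)
        have rr: "0 < 1 - r\<^sup>2" using r R by (simp add: abs_square_less_1)
        have "((\<lambda>r. (1 - r\<^sup>2) powr (\<alpha> + 1)) has_real_derivative (\<alpha> + 1) * (- w r)) (at r)"
          unfolding w_def using rr by (auto intro!: derivative_eq_intros simp: algebra_simps)
        from DERIV_cdivide[OF this, of "\<alpha> + 1"] have b': "(b has_real_derivative - w r) (at r)"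
          unfolding b_def using \<alpha> by simp
        have "b r * (4 * r * circle_mean r G) = 2 / (\<alpha> + 1) * (circle_mean r V * w r)"
        proof -
          have "circle_mean r V = (1 - r\<^sup>2) * circle_mean r G" using VGm[of r] r by simp
          moreover have "b r = (1 - r\<^sup>2) powr \<alpha> * (1 - r\<^sup>2) / (\<alpha> + 1)"
            using rr by (simp add: b_def powr_add)
          ultimately show ?thesis by (simp add: w_def)
        qed
        then have "((\<lambda>r. b r * J r) has_real_derivative 2 / (\<alpha> + 1) * (circle_mean r V * w r) - J r * w r) (at r)"
          by (auto intro!: derivative_eq_intros b' J' simp: mult.commute)
        then show "((\<lambda>r. b r * J r) has_vector_derivative 2 / (\<alpha> + 1) * (circle_mean r V * w r) - J r * w r) (at r)"
          by (simp add: has_real_derivative_iff_has_vector_derivative)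
      qed
      then have "integral {0..R} (\<lambda>r. 2 / (\<alpha> + 1) * (circle_mean r V * w r) - J r * w r) = b R * J R"
        by (simp add: integral_unique J_def)
      moreover have "integral {0..R} (\<lambda>r. 2 / (\<alpha> + 1) * (circle_mean r V * w r) - J r * w r) =
        2 / (\<alpha> + 1) * integral {0..R} (\<lambda>r. circle_mean r V * w r) - integral {0..R} (\<lambda>r. J r * w r)"
        unfolding integral_diff[OF integrable_on_mult_right[OF int[OF cVr], of "2 / (\<alpha> + 1)"] int[OF cJ]] by simp
      moreover have "0 \<le> J R" unfolding J_def
        by (intro integral_nonneg integrable_continuous_interval cg) (use Gpos in auto)
      then have "0 \<le> b R * J R" using \<alpha> by (simp add: b_def)
      ultimately show ?thesis by linarith
    qed
    moreover have "integral {0..R} (\<lambda>r. circle_mean r F * w r) \<le>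
      integral {0..R} (\<lambda>r. F 0 * w r + (circle_mean r V * w r + J r * w r))"
    proof (rule integral_le[OF int[OF cFr]])
      show "(\<lambda>r. F 0 * w r + (circle_mean r V * w r + J r * w r)) integrable_on {0..R}"
        by (intro integrable_add int cVr cJ continuous_on_const)
      fix r assume r: "r \<in> {0..R}"
      have "circle_mean r F * w r \<le> (F 0 + (circle_mean r V + J r)) * w r"
        using cmp[of r] wn[of r] r by (intro mult_right_mono) auto
      then show "circle_mean r F * w r \<le> F 0 * w r + (circle_mean r V * w r + J r * w r)"
        by (simp add: algebra_simps)
    qed
    moreover have "integral {0..R} (\<lambda>r. F 0 * w r + (circle_mean r V * w r + J r * w r)) =
      F 0 * integral {0..R} (\<lambda>r. 1 * w r) + (integral {0..R} (\<lambda>r. circle_mean r V * w r) + integral {0..R} (\<lambda>r. J r * w r))"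
      by (subst integral_add integral_mult_right, (intro integrable_add int cVr cJ continuous_on_const)+)+ simp
    ultimately have "integral {0..R} (\<lambda>r. circle_mean r F * w r) \<le> F 0 * integral {0..R} (\<lambda>r. 1 * w r)
      + (1 + 2 / (\<alpha> + 1)) * integral {0..R} (\<lambda>r. circle_mean r V * w r)"
      by (simp add: algebra_simps)
    then show "bergman_mean \<alpha> R F \<le> bergman_mean \<alpha> R (\<lambda>_. 1) * F 0 + (1 + 2 / (\<alpha> + 1)) * bergman_mean \<alpha> R V"
      unfolding bergman_mean_def w_def by (simp add: mult.commute)
  qed
qed

section \<open>Polar coordinates\<close>

lemma nn_integral_continuous_Icc:
  fixes f :: "real \<Rightarrow> real"
  assumes "continuous_on {a..b} f" "\<And>x. x \<in> {a..b} \<Longrightarrow> 0 \<le> f x"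
  shows "(\<integral>\<^sup>+x. indicator {a..b} x * ennreal (f x) \<partial>lborel) = ennreal (integral {a..b} f)"
proof -
  have "(\<integral>\<^sup>+x. ennreal (indicator {a..b} x * f x) \<partial>lborel) = ennreal (integral {a..b} f)"
    by (rule nn_integral_has_integral_lebesgue[OF assms(2)])
      (use integrable_continuous_interval[OF assms(1)] in auto)
  moreover have "ennreal (indicator {a..b} x * f x) = indicator {a..b} x * ennreal (f x)" for x
    by (simp add: indicator_def)
  ultimately show ?thesis by simp
qed

lemma measurable_Complex [measurable]:
  assumes "f \<in> borel_measurable M" "g \<in> borel_measurable M"
  shows "(\<lambda>x. Complex (f x) (g x)) \<in> borel_measurable M"
  using assms unfolding Complex_eq by measurable

text \<open>Entry point for Fubini in the plane: a measure that gives every box its area is Lebesgue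
  measure.\<close>

lemma lborel_complex:
  "(lborel :: complex measure) = distr (lborel \<Otimes>\<^sub>M lborel) borel (\<lambda>p. Complex (fst p) (snd p))"
proof (rule lborel_eqI)
  fix l u :: complex
  assume le: "\<And>b. b \<in> Basis \<Longrightarrow> l \<bullet> b \<le> u \<bullet> b"
  have "Re l \<le> Re u" "Im l \<le> Im u"
    using le[of 1] le[of \<i>] by (auto simp: Basis_complex_def inner_complex_def)
  moreover have "(\<lambda>p. Complex (fst p) (snd p)) -` box l u \<inter> space (lborel \<Otimes>\<^sub>M lborel)
      = {Re l<..<Re u} \<times> {Im l<..<Im u}"
    by (auto simp: box_def Basis_complex_def inner_complex_def space_pair_measure)
  ultimately show "emeasure (distr (lborel \<Otimes>\<^sub>M lborel) borel (\<lambda>p. Complex (fst p) (snd p))) (box l u)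
      = ennreal (\<Prod>b\<in>Basis. (u - l) \<bullet> b)"
    by (subst emeasure_distr)
      (auto simp: lborel.emeasure_pair_measure_Times Basis_complex_def inner_complex_def ennreal_mult')
qed simp

lemma nn_integral_complex:
  assumes [measurable]: "h \<in> borel_measurable borel"
  shows "(\<integral>\<^sup>+z. h z \<partial>lborel) = (\<integral>\<^sup>+x. \<integral>\<^sup>+y. h (Complex x y) \<partial>lborel \<partial>lborel)"
    and "(\<integral>\<^sup>+z. h z \<partial>lborel) = (\<integral>\<^sup>+y. \<integral>\<^sup>+x. h (Complex x y) \<partial>lborel \<partial>lborel)"
proof -
  have 1: "(\<integral>\<^sup>+z. h z \<partial>lborel) = (\<integral>\<^sup>+p. h (Complex (fst p) (snd p)) \<partial>(lborel \<Otimes>\<^sub>M lborel))"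
    by (subst lborel_complex, subst nn_integral_distr) auto
  show "(\<integral>\<^sup>+z. h z \<partial>lborel) = (\<integral>\<^sup>+x. \<integral>\<^sup>+y. h (Complex x y) \<partial>lborel \<partial>lborel)"
    unfolding 1 by (subst lborel.nn_integral_fst[symmetric]) auto
  show "(\<integral>\<^sup>+z. h z \<partial>lborel) = (\<integral>\<^sup>+y. \<integral>\<^sup>+x. h (Complex x y) \<partial>lborel \<partial>lborel)"
    unfolding 1 by (subst lborel_pair.nn_integral_snd[symmetric]) auto
qed

lemma nn_integral_shear_Re:
  assumes [measurable]: "h \<in> borel_measurable borel"
  shows "(\<integral>\<^sup>+z. h (Complex (Re z + a * Im z) (Im z)) \<partial>lborel) = (\<integral>\<^sup>+z. h z \<partial>lborel)"
proof -
  have "(\<integral>\<^sup>+x. h (Complex (x + a * y) y) \<partial>lborel) = (\<integral>\<^sup>+x. h (Complex x y) \<partial>lborel)" for y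
    using nn_integral_real_affine[of "\<lambda>x. h (Complex x y)" 1 "a * y"] by (simp add: add.commute)
  then show ?thesis
    by (simp add: nn_integral_complex(2))
qed

lemma nn_integral_shear_Im:
  assumes [measurable]: "h \<in> borel_measurable borel"
  shows "(\<integral>\<^sup>+z. h (Complex (Re z) (Im z + a * Re z)) \<partial>lborel) = (\<integral>\<^sup>+z. h z \<partial>lborel)"
proof -
  have "(\<integral>\<^sup>+y. h (Complex x (y + a * x)) \<partial>lborel) = (\<integral>\<^sup>+y. h (Complex x y) \<partial>lborel)" for x
    using nn_integral_real_affine[of "\<lambda>y. h (Complex x y)" 1 "a * x"] by (simp add: add.commute)
  then show ?thesis
    by (simp add: nn_integral_complex(1))
qed

text \<open>A rotation is a product of three shears, each of which preserves area by Fubini.\<close>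

lemma nn_integral_rotate_small:
  assumes [measurable]: "h \<in> borel_measurable borel" and c: "cos (\<theta> / 2) \<noteq> 0"
  shows "(\<integral>\<^sup>+z. h (cis \<theta> * z) \<partial>lborel) = (\<integral>\<^sup>+z. h z \<partial>lborel)"
proof -
  define a b where "a = - tan (\<theta> / 2)" and "b = sin \<theta>"
  have sc: "sin \<theta> = 2 * sin (\<theta> / 2) * cos (\<theta> / 2)" "cos \<theta> = 1 - 2 * (sin (\<theta> / 2))\<^sup>2"
    "cos \<theta> = 2 * (cos (\<theta> / 2))\<^sup>2 - 1"
    using sin_double[of "\<theta> / 2"] cos_double_sin[of "\<theta> / 2"] cos_double_cos[of "\<theta> / 2"] by auto
  have 1: "1 + a * b = cos \<theta>"
    unfolding a_def b_def sc(1,2) using c by (simp add: tan_def power2_eq_square)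
  have 2: "a * cos \<theta> + a = - sin \<theta>"
    unfolding a_def sc(1,3) using c by (simp add: tan_def power2_eq_square algebra_simps)
  define S where "S = (\<lambda>z. Complex (Re z + a * Im z) (Im z))"
  define T where "T = (\<lambda>z. Complex (Re z) (Im z + b * Re z))"
  have [measurable]: "S \<in> borel_measurable borel" "T \<in> borel_measurable borel"
    unfolding S_def T_def by measurable
  have eq: "cis \<theta> * z = S (T (S z))" for z
  proof (rule complex_eqI)
    have "Re (S (T (S z))) = (1 + a * b) * Re z + (a * (1 + a * b) + a) * Im z"
      by (simp add: S_def T_def algebra_simps)
    then show "Re (cis \<theta> * z) = Re (S (T (S z)))" unfolding 1 2 by simp
    have "Im (S (T (S z))) = b * Re z + (1 + a * b) * Im z"
      by (simp add: S_def T_def algebra_simps)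
    then show "Im (cis \<theta> * z) = Im (S (T (S z)))" unfolding 1 unfolding b_def by simp
  qed
  have "(\<integral>\<^sup>+z. h (S (T (S z))) \<partial>lborel) = (\<integral>\<^sup>+z. h (S (T z)) \<partial>lborel)"
    using nn_integral_shear_Re[of "\<lambda>z. h (S (T z))" a] by (simp add: S_def)
  also have "\<dots> = (\<integral>\<^sup>+z. h (S z) \<partial>lborel)"
    using nn_integral_shear_Im[of "\<lambda>z. h (S z)" b] by (simp add: T_def)
  also have "\<dots> = (\<integral>\<^sup>+z. h z \<partial>lborel)"
    using nn_integral_shear_Re[of h a] by (simp add: S_def)
  finally show ?thesis by (simp add: eq)
qed

lemma nn_integral_rotate:
  assumes [measurable]: "h \<in> borel_measurable borel" and t: "0 \<le> \<theta>" "\<theta> \<le> 2 * pi"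
  shows "(\<integral>\<^sup>+z. h (cis \<theta> * z) \<partial>lborel) = (\<integral>\<^sup>+z. h z \<partial>lborel)"
proof -
  \<comment> \<open>Quartering puts s / 2 into [0, pi/4], so the shear parameter tan (s / 2) exists
    even for a half turn.\<close>
  define s where "s = \<theta> / 4"
  have "0 < cos (s / 2)" unfolding s_def by (rule cos_gt_zero_pi) (use t pi_gt_zero in linarith)+
  then have c: "cos (s / 2) \<noteq> 0" by simp
  have "cis \<theta> * z = cis s * (cis s * (cis s * (cis s * z)))" for z
    by (simp add: mult.assoc[symmetric] cis_mult s_def)
  then have "(\<integral>\<^sup>+z. h (cis \<theta> * z) \<partial>lborel) = (\<integral>\<^sup>+z. h (cis s * (cis s * (cis s * (cis s * z)))) \<partial>lborel)"
    by (simp only:)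
  also have "\<dots> = (\<integral>\<^sup>+z. h (cis s * (cis s * (cis s * z))) \<partial>lborel)"
    by (rule nn_integral_rotate_small[OF _ c, of "\<lambda>z. h (cis s * (cis s * (cis s * z)))"]) measurable
  also have "\<dots> = (\<integral>\<^sup>+z. h (cis s * (cis s * z)) \<partial>lborel)"
    by (rule nn_integral_rotate_small[OF _ c, of "\<lambda>z. h (cis s * (cis s * z))"]) measurable
  also have "\<dots> = (\<integral>\<^sup>+z. h (cis s * z) \<partial>lborel)"
    by (rule nn_integral_rotate_small[OF _ c, of "\<lambda>z. h (cis s * z)"]) measurable
  also have "\<dots> = (\<integral>\<^sup>+z. h z \<partial>lborel)"
    by (rule nn_integral_rotate_small[OF _ c]) measurable
  finally show ?thesis .
qed

lemma nn_integral_periodic_shift: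
  fixes k :: "real \<Rightarrow> ennreal"
  assumes [measurable]: "k \<in> borel_measurable borel" and per: "\<And>t. k (t + 2 * pi) = k t"
    and c: "0 \<le> c" "c \<le> 2 * pi"
  shows "(\<integral>\<^sup>+t. indicator {0..<2*pi} t * k (t + c) \<partial>lborel) = (\<integral>\<^sup>+t. indicator {0..<2*pi} t * k t \<partial>lborel)"
proof -
  have "(\<integral>\<^sup>+t. indicator {0..<2*pi} t * k (t + c) \<partial>lborel) =
    (\<integral>\<^sup>+t. indicator {c..<2*pi + c} t * k t \<partial>lborel)"
    using nn_integral_real_affine[of "\<lambda>t. indicator {c..<2*pi + c} t * k t" 1 c]
    by (simp add: indicator_def algebra_simps)
  also have "\<dots> = (\<integral>\<^sup>+t. indicator {c..<2*pi} t * k t + indicator {2*pi..<2*pi + c} t * k t \<partial>lborel)"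
    using c by (intro nn_integral_cong) (auto simp: indicator_def)
  also have "\<dots> = (\<integral>\<^sup>+t. indicator {c..<2*pi} t * k t \<partial>lborel) + (\<integral>\<^sup>+t. indicator {2*pi..<2*pi + c} t * k t \<partial>lborel)"
    by (rule nn_integral_add) measurable
  also have "(\<integral>\<^sup>+t. indicator {2*pi..<2*pi + c} t * k t \<partial>lborel) = (\<integral>\<^sup>+t. indicator {0..<c} t * k t \<partial>lborel)"
    using nn_integral_real_affine[of "\<lambda>t. indicator {2*pi..<2*pi + c} t * k t" 1 "2 * pi"] per
    by (simp add: indicator_def add.commute)
  also have "(\<integral>\<^sup>+t. indicator {c..<2*pi} t * k t \<partial>lborel) + (\<integral>\<^sup>+t. indicator {0..<c} t * k t \<partial>lborel)
     = (\<integral>\<^sup>+t. indicator {c..<2*pi} t * k t + indicator {0..<c} t * k t \<partial>lborel)"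
    by (rule nn_integral_add[symmetric]) measurable
  also have "\<dots> = (\<integral>\<^sup>+t. indicator {0..<2*pi} t * k t \<partial>lborel)"
    using c by (intro nn_integral_cong) (auto simp: indicator_def)
  finally show ?thesis .
qed

lemma measurable_rcis [measurable]:
  assumes "f \<in> borel_measurable M" "g \<in> borel_measurable M"
  shows "(\<lambda>x. rcis (f x) (g x)) \<in> borel_measurable M"
proof -
  have "rcis (f x) (g x) = Complex (f x * cos (g x)) (f x * sin (g x))" for x
    by (simp add: complex_eq_iff)
  then show ?thesis using assms by simp
qed

text \<open>The integral is averaged over all rotations and the order of integration is exchanged.
  For fixed z the rotated points run once around the circle of radius |z|, and by periodicity the
  starting angle does not matter.\<close>

lemma nn_integral_circle_average:
  assumes [measurable]: "h \<in> borel_measurable borel"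
  shows "ennreal (2 * pi) * (\<integral>\<^sup>+z. h z \<partial>lborel) =
    (\<integral>\<^sup>+z. \<integral>\<^sup>+t. indicator {0..<2*pi} t * h (rcis (cmod z) t) \<partial>lborel \<partial>lborel)"
proof -
  have cis [measurable]: "cis \<in> borel_measurable borel"
    by (intro borel_measurable_continuous_onI continuous_intros)
  have "ennreal (2 * pi) * (\<integral>\<^sup>+z. h z \<partial>lborel) = (\<integral>\<^sup>+t. indicator {0..<2*pi} t * (\<integral>\<^sup>+z. h z \<partial>lborel) \<partial>lborel)"
    by (simp add: nn_integral_multc)
  also have "\<dots> = (\<integral>\<^sup>+t. \<integral>\<^sup>+z. indicator {0..<2*pi} t * h (cis t * z) \<partial>lborel \<partial>lborel)"
    by (intro nn_integral_cong) (auto simp: nn_integral_rotate indicator_def)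
  also have "\<dots> = (\<integral>\<^sup>+z. \<integral>\<^sup>+t. indicator {0..<2*pi} t * h (cis t * z) \<partial>lborel \<partial>lborel)"
    by (rule lborel_pair.Fubini') measurable
  also have "\<dots> = (\<integral>\<^sup>+z. \<integral>\<^sup>+t. indicator {0..<2*pi} t * h (rcis (cmod z) t) \<partial>lborel \<partial>lborel)"
  proof (rule nn_integral_cong)
    fix z :: complex
    define c where "c = Arg2pi z"
    have c: "0 \<le> c" "c \<le> 2 * pi" using Arg2pi[of z] by (auto simp: c_def)
    have z: "z = rcis (cmod z) c"
      using Arg2pi_eq[of z] by (simp add: c_def rcis_def cis_conv_exp)
    have "cis t * z = rcis (cmod z) (t + c)" for t
      by (subst z) (simp add: rcis_def cis_mult[symmetric])
    then have "(\<integral>\<^sup>+t. indicator {0..<2*pi} t * h (cis t * z) \<partial>lborel) =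
       (\<integral>\<^sup>+t. indicator {0..<2*pi} t * h (rcis (cmod z) (t + c)) \<partial>lborel)" by simp
    also have "\<dots> = (\<integral>\<^sup>+t. indicator {0..<2*pi} t * h (rcis (cmod z) t) \<partial>lborel)"
      by (rule nn_integral_periodic_shift[OF _ _ c, of "\<lambda>t. h (rcis (cmod z) t)"])
        (measurable, simp add: rcis_def cis_mult[symmetric])
    finally show "(\<integral>\<^sup>+t. indicator {0..<2*pi} t * h (cis t * z) \<partial>lborel) =
       (\<integral>\<^sup>+t. indicator {0..<2*pi} t * h (rcis (cmod z) t) \<partial>lborel)" .
  qed
  finally show ?thesis .
qed

text \<open>The image of area under the modulus and the measure 2 pi r dr on [0, 1] give the same
  mass to every half-line {x<..}, and this determines them.\<close>

lemma nn_integral_disc_radial: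
  fixes B :: "real \<Rightarrow> ennreal"
  assumes [measurable]: "B \<in> borel_measurable borel"
  shows "(\<integral>\<^sup>+z. indicator unit_disc z * B (cmod z) \<partial>lborel) =
    (\<integral>\<^sup>+r. indicator {0..1} r * ennreal (2 * pi * r) * B r \<partial>lborel)"
proof -
  define M where "M = distr (density lborel (indicator unit_disc)) borel cmod"
  define N where "N = density lborel (\<lambda>r::real. indicator {0..1} r * ennreal (2 * pi * r))"
  have M: "emeasure M {x<..} = ennreal (pi - pi * (min 1 (max 0 x))\<^sup>2)" for x
  proof -
    have [measurable, simp]: "cmod -` {x<..} \<in> sets borel"
      by (intro borel_open open_vimage continuous_intros open_greaterThan)
    have "emeasure M {x<..} = (\<integral>\<^sup>+z. indicator unit_disc z * indicator (cmod -` {x<..}) z \<partial>lborel)"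
    proof -
      have "emeasure M {x<..} = emeasure (density lborel (indicator unit_disc)) (cmod -` {x<..})"
        unfolding M_def by (subst emeasure_distr) auto
      also have "\<dots> = (\<integral>\<^sup>+z. indicator unit_disc z * indicator (cmod -` {x<..}) z \<partial>lborel)"
        by (rule emeasure_density[OF borel_measurable_indicator]) simp_all
      finally show ?thesis .
    qed
    also have "\<dots> = (\<integral>\<^sup>+z. indicator (unit_disc \<inter> cmod -` {x<..}) z \<partial>lborel)"
      by (intro nn_integral_cong) (auto simp: indicator_def)
    also have "\<dots> = emeasure lborel (unit_disc \<inter> cmod -` {x<..})"
      by (subst nn_integral_indicator) auto
    also have "unit_disc \<inter> cmod -` {x<..} = (if x < 0 then unit_disc else unit_disc - cball 0 (min 1 x))"
      by (auto intro: less_le_trans[OF _ norm_ge_zero])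
    also have "emeasure lborel \<dots> = ennreal (pi - pi * (min 1 (max 0 x))\<^sup>2)"
    proof (cases "x < 0")
      case True
      then show ?thesis by (simp add: emeasure_ball unit_ball_vol_2)
    next
      case False
      have "emeasure lborel (unit_disc - ball 0 (min 1 x)) = emeasure lborel unit_disc - emeasure lborel (ball 0 (min 1 x) :: complex set)"
        by (intro emeasure_Diff) (use emeasure_lborel_ball_finite[of "0::complex" "min 1 x"] in auto)
      also have "\<dots> = ennreal (pi - pi * (min 1 (max 0 x))\<^sup>2)"
        using False by (simp add: emeasure_ball unit_ball_vol_2 ennreal_minus)
      also have "emeasure lborel (unit_disc - ball 0 (min 1 x)) = emeasure lborel (unit_disc - cball 0 (min 1 x))"
      proof -
        have "sphere (0::complex) (min 1 x) \<in> null_sets lborel"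
          using negligible_sphere[of "0::complex" "min 1 x"] by (auto simp: null_sets_completion_iff negligible_iff_null_sets negligible_convex_frontier)
        then have "emeasure lborel ((unit_disc - ball 0 (min 1 x)) - sphere 0 (min 1 x)) = emeasure lborel (unit_disc - ball (0::complex) (min 1 x))"
          by (intro emeasure_Diff_null_set) auto
        moreover have "(unit_disc - ball 0 (min 1 x)) - sphere 0 (min 1 x) = unit_disc - cball (0::complex) (min 1 x)"
          by auto
        ultimately show ?thesis by simp
      qed
      finally show ?thesis using False by simp
    qed
    finally show ?thesis .
  qed
  have N: "emeasure N {x<..} = ennreal (pi - pi * (min 1 (max 0 x))\<^sup>2)" for x
  proof -
    define y where "y = min 1 (max 0 x)"
    have y: "0 \<le> y" "y \<le> 1" by (auto simp: y_def)
    have "emeasure N {x<..} = (\<integral>\<^sup>+r. indicator {0..1} r * ennreal (2 * pi * r) * indicator {x<..} r \<partial>lborel)"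
      unfolding N_def by (simp add: emeasure_density)
    also have "\<dots> = (\<integral>\<^sup>+r. indicator {y..1} r * ennreal (2 * pi * r) \<partial>lborel)"
    proof (rule nn_integral_cong_AE, rule AE_mp[OF _ AE_I2])
      show "AE r in lborel. r \<noteq> y \<and> r \<noteq> 1"
        by (intro AE_conjI AE_lborel_singleton)
    qed (auto simp: indicator_def y_def)
    also have "\<dots> = ennreal (integral {y..1} (\<lambda>r. 2 * pi * r))"
      using y by (intro nn_integral_continuous_Icc continuous_intros) auto
    also have "integral {y..1} (\<lambda>r. 2 * pi * r) = pi * 1\<^sup>2 - pi * y\<^sup>2"
    proof (rule integral_unique, rule fundamental_theorem_of_calculus[OF y(2)])
      fix r show "((\<lambda>r. pi * r\<^sup>2) has_vector_derivative 2 * pi * r) (at r within {y..1})"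
        unfolding has_real_derivative_iff_has_vector_derivative[symmetric]
        by (auto intro!: derivative_eq_intros)
    qed
    finally show ?thesis by (simp add: y_def)
  qed
  have MN: "M = N"
    by (rule measure_eqI_lessThan) (auto simp: M N, auto simp: M_def N_def)
  have "(\<integral>\<^sup>+r. B r \<partial>M) = (\<integral>\<^sup>+z. indicator unit_disc z * B (cmod z) \<partial>lborel)"
    unfolding M_def by (subst nn_integral_distr) (auto simp: nn_integral_density[OF borel_measurable_indicator])
  moreover have "(\<integral>\<^sup>+r. B r \<partial>N) = (\<integral>\<^sup>+r. indicator {0..1} r * ennreal (2 * pi * r) * B r \<partial>lborel)"
    unfolding N_def by (subst nn_integral_density) auto
  ultimately show ?thesis unfolding MN by simp
qed

section \<open>Hardy and Bergman norms as means\<close>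

lemma continuous_on_powr_pos:
  fixes F :: "'a::topological_space \<Rightarrow> real"
  assumes "0 < p" "continuous_on S F" "\<And>z. z \<in> S \<Longrightarrow> 0 \<le> F z"
  shows "continuous_on S (\<lambda>z. F z powr p)"
  using assms by (intro continuous_on_powr' continuous_on_const) auto

lemmas continuous_on_weight_intros = continuous_on_powr_pos continuous_on_norm continuous_on_power
  continuous_on_mult continuous_on_add continuous_on_const

text \<open>Averaging over rotations turns the integrand into a radial function, and for radial
  functions the previous lemma applies; this replaces a change of variables by the polar
  map.\<close>

lemma nn_integral_disc_polar:
  fixes w :: "real \<Rightarrow> real"
  assumes F: "continuous_on unit_disc F" "\<And>z. z \<in> unit_disc \<Longrightarrow> 0 \<le> F z"
    and w [measurable]: "w \<in> borel_measurable borel" and w0: "\<And>r. 0 \<le> w r"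
  shows "(\<integral>\<^sup>+z. indicator unit_disc z * ennreal (F z * w (cmod z)) \<partial>lborel) =
    (\<integral>\<^sup>+r. indicator {0..<1} r * ennreal (2 * pi * r * circle_mean r F * w r) \<partial>lborel)"
proof -
  define h where "h = (\<lambda>z. ennreal (indicator unit_disc z *\<^sub>R F z * w (cmod z)))"
  have [measurable]: "(\<lambda>z. indicator unit_disc z *\<^sub>R F z) \<in> borel_measurable borel"
    by (intro borel_measurable_continuous_on_indicator F) simp
  have h [measurable]: "h \<in> borel_measurable borel" unfolding h_def by measurable
  define B where "B = (\<lambda>r. indicator {-1<..<1} r *\<^sub>R circle_mean r F * w r)"
  have [measurable]: "(\<lambda>r. indicator {-1<..<1} r *\<^sub>R circle_mean r F) \<in> borel_measurable borel"
    by (intro borel_measurable_continuous_on_indicator circle_mean_continuous F) simp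
  have B [measurable]: "B \<in> borel_measurable borel" unfolding B_def by measurable
  have inner: "(\<integral>\<^sup>+t. indicator {0..<2*pi} t * h (rcis (cmod z) t) \<partial>lborel) =
      ennreal (2 * pi) * (indicator unit_disc z * ennreal (B (cmod z)))" for z :: complex
  proof (cases "z \<in> unit_disc")
    case True
    then have z: "\<bar>cmod z\<bar> < 1" by simp
    have "(\<integral>\<^sup>+t. indicator {0..<2*pi} t * h (rcis (cmod z) t) \<partial>lborel) =
      (\<integral>\<^sup>+t. indicator {0..2*pi} t * ennreal (F (rcis (cmod z) t) * w (cmod z)) \<partial>lborel)"
    proof (rule nn_integral_cong_AE, rule AE_mp[OF AE_lborel_singleton[of "2 * pi"] AE_I2])
    qed (use z in \<open>auto simp: indicator_def h_def complex_mod_rcis\<close>)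
    also have "\<dots> = ennreal (integral {0..2*pi} (\<lambda>t. F (rcis (cmod z) t) * w (cmod z)))"
      using z w0 F(2) by (intro nn_integral_continuous_Icc continuous_intros continuous_on_circle F) auto
    also have "integral {0..2*pi} (\<lambda>t. F (rcis (cmod z) t) * w (cmod z)) = 2 * pi * B (cmod z)"
    proof -
      have "indicat_real {-1<..<1} (cmod z) = 1"
        using z by (auto simp: indicator_def intro: less_le_trans[OF _ norm_ge_zero])
      then show ?thesis by (simp add: circle_mean_def B_def)
    qed
    finally show ?thesis using True by (simp add: ennreal_mult')
  qed (simp add: h_def complex_mod_rcis)
  have "(\<integral>\<^sup>+z. indicator unit_disc z * ennreal (F z * w (cmod z)) \<partial>lborel) = (\<integral>\<^sup>+z. h z \<partial>lborel)"
    by (intro nn_integral_cong) (auto simp: h_def indicator_def)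
  moreover have "ennreal (2 * pi) * (\<integral>\<^sup>+z. h z \<partial>lborel) =
     ennreal (2 * pi) * (\<integral>\<^sup>+r. indicator {0..1} r * ennreal (2 * pi * r) * ennreal (B r) \<partial>lborel)"
  proof -
    have [measurable]: "(\<lambda>z::complex. B (cmod z)) \<in> borel_measurable borel"
      by (rule measurable_compose[OF _ B]) measurable
    have "(\<lambda>z. ennreal (B (cmod z))) \<in> borel_measurable (borel :: complex measure)" by measurable
    then have "(\<lambda>z. indicator unit_disc z * ennreal (B (cmod z))) \<in> borel_measurable lborel"
      by (intro borel_measurable_times_ennreal borel_measurable_indicator) simp_all
    then show ?thesis
      unfolding nn_integral_circle_average[OF h] inner
      using nn_integral_disc_radial[of "\<lambda>r. ennreal (B r)"] by (subst nn_integral_cmult) simp_all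
  qed
  then have "(\<integral>\<^sup>+z. h z \<partial>lborel) = (\<integral>\<^sup>+r. indicator {0..1} r * ennreal (2 * pi * r) * ennreal (B r) \<partial>lborel)"
    by (simp add: ennreal_mult_cancel_left)
  moreover have "(\<integral>\<^sup>+r. indicator {0..1} r * ennreal (2 * pi * r) * ennreal (B r) \<partial>lborel) =
     (\<integral>\<^sup>+r. indicator {0..<1} r * ennreal (2 * pi * r * circle_mean r F * w r) \<partial>lborel)"
    by (intro nn_integral_cong) (auto simp: B_def indicator_def ennreal_mult'[symmetric] mult.assoc)
  ultimately show ?thesis by simp
qed

lemma circle_mean_nonneg:
  assumes "continuous_on unit_disc F" "\<And>z. z \<in> unit_disc \<Longrightarrow> 0 \<le> F z" "\<bar>r\<bar> < 1"
  shows "0 \<le> circle_mean r F"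
  using circle_mean_mono[of "\<lambda>_. 0" F r] assms by simp

text \<open>The result is one integral over a fixed rectangle, a form that can be differentiated
  under the integral sign when F carries a parameter.\<close>

lemma nn_integral_cball_polar:
  assumes F: "continuous_on unit_disc F" "\<And>z. z \<in> unit_disc \<Longrightarrow> 0 \<le> F z" and R: "0 \<le> R" "R < 1"
  shows "(\<integral>\<^sup>+z. indicator (cball 0 R) z * ennreal (F z) \<partial>lborel) =
    ennreal (integral (cbox (0, 0) (R, 2 * pi)) (\<lambda>p. fst p * F (rcis (fst p) (snd p))))"
proof -
  have "(\<integral>\<^sup>+z. indicator (cball 0 R) z * ennreal (F z) \<partial>lborel) =
     (\<integral>\<^sup>+z. indicator unit_disc z * ennreal (F z * indicator {..R} (cmod z)) \<partial>lborel)"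
    using R by (intro nn_integral_cong) (auto simp: indicator_def)
  also have "\<dots> = (\<integral>\<^sup>+r. indicator {0..<1} r * ennreal (2 * pi * r * circle_mean r F * indicator {..R} r) \<partial>lborel)"
    by (intro nn_integral_disc_polar F) auto
  also have "\<dots> = (\<integral>\<^sup>+r. indicator {0..R} r * ennreal (2 * pi * r * circle_mean r F) \<partial>lborel)"
    using R by (intro nn_integral_cong) (auto simp: indicator_def)
  also have "\<dots> = ennreal (integral {0..R} (\<lambda>r. 2 * pi * r * circle_mean r F))"
    using R by (intro nn_integral_continuous_Icc continuous_intros continuous_on_circle_mean F mult_nonneg_nonneg
        circle_mean_nonneg) auto
  also have "integral {0..R} (\<lambda>r. 2 * pi * r * circle_mean r F) =
      integral {0..R} (\<lambda>r. integral {0..2*pi} (\<lambda>t. r * F (rcis r t)))"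
    unfolding circle_mean_def by (intro integral_cong) simp
  also have "\<dots> = integral (cbox (0, 0) (R, 2 * pi)) (\<lambda>p. fst p * F (rcis (fst p) (snd p)))"
  proof -
    have "continuous_on (cbox (0, 0) (R, 2 * pi)) (\<lambda>p. fst p * F (rcis (fst p) (snd p)))"
      by (intro continuous_intros continuous_on_compose2[OF F(1)]) (use R in \<open>auto simp: complex_mod_rcis\<close>)
    from integral_prod_continuous[OF this] show ?thesis by simp
  qed
  finally show ?thesis .
qed

lemma bergman_pow_polar:
  assumes f: "f holomorphic_on unit_disc" and p: "0 < p" and \<alpha>: "-1 < \<alpha>" and R: "0 \<le> R" "R < 1"
  shows "ennreal ((\<alpha> + 1) * bergman_mean \<alpha> R (\<lambda>z. cmod (f z) powr p)) \<le> bergman_pow \<alpha> p f" (is ?ge)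
    and "ennreal ((\<alpha> + 1) * bergman_mean \<alpha> R (\<lambda>z. cmod (f z) powr p)) =
      ennreal ((\<alpha> + 1) / pi) * (\<integral>\<^sup>+r. indicator {0..R} r *
        ennreal (2 * pi * r * circle_mean r (\<lambda>z. cmod (f z) powr p) * (1 - r\<^sup>2) powr \<alpha>) \<partial>lborel)" (is ?eq)
    and "bergman_pow \<alpha> p f = ennreal ((\<alpha> + 1) / pi) * (\<integral>\<^sup>+r. indicator {0..<1} r *
        ennreal (2 * pi * r * circle_mean r (\<lambda>z. cmod (f z) powr p) * (1 - r\<^sup>2) powr \<alpha>) \<partial>lborel)" (is ?bp)
proof -
  define F where "F = (\<lambda>z. cmod (f z) powr p)"
  have F: "continuous_on unit_disc F" "\<And>z. 0 \<le> F z"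
    unfolding F_def using holomorphic_on_imp_continuous_on[OF f] p
    by (auto intro!: continuous_on_weight_intros)
  have "(\<integral>\<^sup>+z. indicator unit_disc z * ennreal (F z * (1 - cmod2 z) powr \<alpha>) \<partial>lborel) =
    (\<integral>\<^sup>+r. indicator {0..<1} r * ennreal (2 * pi * r * circle_mean r F * (1 - r\<^sup>2) powr \<alpha>) \<partial>lborel)"
    by (rule nn_integral_disc_polar[OF F]) auto
  then show bp: ?bp
    unfolding bergman_pow_def F_def by simp
  have "(\<integral>\<^sup>+r. indicator {0..R} r * ennreal (2 * pi * r * circle_mean r F * (1 - r\<^sup>2) powr \<alpha>) \<partial>lborel)
    = (\<integral>\<^sup>+r. indicator {0..R} r * ennreal (pi * (circle_mean r F * ((1 - r\<^sup>2) powr \<alpha> * (2 * r)))) \<partial>lborel)"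
    by (intro nn_integral_cong) (simp add: algebra_simps)
  also have "\<dots> = ennreal (integral {0..R} (\<lambda>r. pi * (circle_mean r F * ((1 - r\<^sup>2) powr \<alpha> * (2 * r)))))"
  proof (rule nn_integral_continuous_Icc)
    show "continuous_on {0..R} (\<lambda>r. pi * (circle_mean r F * ((1 - r\<^sup>2) powr \<alpha> * (2 * r))))"
      by (rule continuous_on_mult_left) (intro continuous_on_mult continuous_on_circle_mean F R continuous_on_bergman_weight[OF R(2)])
    fix r assume "r \<in> {0..R}"
    with circle_mean_nonneg[OF F, of r] R show "0 \<le> pi * (circle_mean r F * ((1 - r\<^sup>2) powr \<alpha> * (2 * r)))" by simp
  qed
  also have "\<dots> = ennreal (pi * bergman_mean \<alpha> R F)"
    by (simp add: bergman_mean_def)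
  finally show eq: ?eq
    unfolding F_def[symmetric] using \<alpha> by (simp add: ennreal_mult'[symmetric])
  show ?ge
    unfolding eq bp
    by (intro mult_left_mono nn_integral_mono) (use R in \<open>auto simp: indicator_def\<close>)
qed

text \<open>Monotone convergence along radii increasing to 1 removes the truncation.\<close>

lemma bergman_pow_le:
  assumes f: "f holomorphic_on unit_disc" and p: "0 < p" and \<alpha>: "-1 < \<alpha>"
    and K: "\<And>R. 0 \<le> R \<Longrightarrow> R < 1 \<Longrightarrow> ennreal ((\<alpha> + 1) * bergman_mean \<alpha> R (\<lambda>z. cmod (f z) powr p)) \<le> K"
  shows "bergman_pow \<alpha> p f \<le> K"
proof -
  define B where "B = (\<lambda>r. ennreal (2 * pi * r * circle_mean r (\<lambda>z. cmod (f z) powr p) * (1 - r\<^sup>2) powr \<alpha>))"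
  define R where "R = (\<lambda>n. 1 - 1 / real (Suc n))"
  have R: "0 \<le> R n" "R n < 1" for n by (auto simp: R_def)
  have inc: "incseq (\<lambda>n r. indicator {0..R n} r * B r)"
  proof (rule incseq_SucI)
    fix n
    have "R n \<le> R (Suc n)" by (simp add: R_def frac_le)
    then show "(\<lambda>r. indicator {0..R n} r * B r) \<le> (\<lambda>r. indicator {0..R (Suc n)} r * B r)"
      by (auto simp: le_fun_def indicator_def)
  qed
  have cf: "continuous_on unit_disc (\<lambda>z. cmod (f z) powr p)"
    using holomorphic_on_imp_continuous_on[OF f] p by (auto intro!: continuous_on_weight_intros)
  have meas: "(\<lambda>r. indicator {0..R n} r * B r) \<in> borel_measurable lborel" for n
  proof -
    have "(\<lambda>r. indicator {0..R n} r *\<^sub>R (circle_mean r (\<lambda>z. cmod (f z) powr p))) \<in> borel_measurable borel"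
      by (intro borel_measurable_continuous_on_indicator continuous_on_circle_mean cf R) simp
    then have "(\<lambda>r. ennreal (2 * pi * r * (indicator {0..R n} r *\<^sub>R (circle_mean r (\<lambda>z. cmod (f z) powr p))) * (1 - r\<^sup>2) powr \<alpha>)) \<in> borel_measurable borel"
      by measurable
    moreover have "ennreal (2 * pi * r * (indicator {0..R n} r *\<^sub>R (circle_mean r (\<lambda>z. cmod (f z) powr p))) * (1 - r\<^sup>2) powr \<alpha>)
       = indicator {0..R n} r * B r" for r
      by (auto simp: B_def indicator_def)
    ultimately show ?thesis by simp
  qed
  have sup: "indicator {0..<1} r * B r = (SUP n. indicator {0..R n} r * B r)" for r
  proof (rule antisym)
    show "(SUP n. indicator {0..R n} r * B r) \<le> indicator {0..<1} r * B r"
      using R by (intro SUP_least) (auto simp: indicator_def intro: order.strict_trans1)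
    show "indicator {0..<1} r * B r \<le> (SUP n. indicator {0..R n} r * B r)"
    proof (cases "0 \<le> r \<and> r < 1")
      case True
      then obtain n where "inverse (real (Suc n)) < 1 - r" using reals_Archimedean[of "1 - r"] by auto
      then have "r \<le> R n" by (simp add: R_def inverse_eq_divide)
      with True show ?thesis by (intro SUP_upper2[of n]) auto
    qed (auto simp: indicator_def)
  qed
  have "bergman_pow \<alpha> p f = ennreal ((\<alpha> + 1) / pi) * (\<integral>\<^sup>+r. indicator {0..<1} r * B r \<partial>lborel)"
    using bergman_pow_polar(3)[OF f p \<alpha>, of 0] by (simp add: B_def)
  also have "(\<integral>\<^sup>+r. indicator {0..<1} r * B r \<partial>lborel) = (SUP n. \<integral>\<^sup>+r. indicator {0..R n} r * B r \<partial>lborel)"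
    unfolding sup by (rule nn_integral_monotone_convergence_SUP[OF inc meas])
  also have "ennreal ((\<alpha> + 1) / pi) * \<dots> = (SUP n. ennreal ((\<alpha> + 1) / pi) * (\<integral>\<^sup>+r. indicator {0..R n} r * B r \<partial>lborel))"
    by (rule SUP_mult_left_ennreal)
  also have "\<dots> \<le> K"
  proof (rule SUP_least)
    fix n
    show "ennreal ((\<alpha> + 1) / pi) * (\<integral>\<^sup>+r. indicator {0..R n} r * B r \<partial>lborel) \<le> K"
      using K[OF R, of n] bergman_pow_polar(2)[OF f p \<alpha> R, of n] by (simp add: B_def)
  qed
  finally show ?thesis .
qed

lemma hardy_pow_eq:
  assumes f: "f holomorphic_on unit_disc" and p: "0 < p"
  shows "hardy_pow p f = (SUP r\<in>{0<..<1}. ennreal (circle_mean r (\<lambda>z. cmod (f z) powr p)))"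
  unfolding hardy_pow_def
proof (rule SUP_cong[OF refl])
  fix r :: real assume r: "r \<in> {0<..<1}"
  have cf: "continuous_on unit_disc (\<lambda>z. cmod (f z) powr p)"
    using holomorphic_on_imp_continuous_on[OF f] p by (auto intro!: continuous_on_weight_intros)
  have "(\<integral>\<^sup>+t. indicator {0..2*pi} t * ennreal (cmod (f (rcis r t)) powr p) \<partial>lborel)
    = ennreal (integral {0..2*pi} (\<lambda>t. cmod (f (rcis r t)) powr p))"
    using r by (intro nn_integral_continuous_Icc continuous_on_circle[OF cf]) auto
  then show "ennreal (1 / (2 * pi)) * (\<integral>\<^sup>+t. indicator {0..2*pi} t * ennreal (cmod (f (complex_of_real r * exp (\<i> * complex_of_real t))) powr p) \<partial>lborel)
    = ennreal (circle_mean r (\<lambda>z. cmod (f z) powr p))"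
    by (simp add: rcis_def cis_conv_exp circle_mean_def ennreal_mult'[symmetric])
qed

text \<open>|g|^(2 \<sigma>) need not be smooth at zeros of \<open>g\<close>, so |g|^2 + e is used
  and \<open>e\<close> is sent to 0. The factor 2^\<sigma> is the price of separating
  \<open>e\<close> by \<open>powr_add_le\<close>.\<close>

lemma power_weight_submean:
  assumes g: "g holomorphic_on unit_disc" and h: "h holomorphic_on unit_disc" and s: "0 < \<sigma>" and r: "0 \<le> r" "r < 1"
  shows "cmod2 (g 0) powr \<sigma> * cmod2 (h 0) \<le>
    2 powr \<sigma> * circle_mean r (\<lambda>z. cmod2 (g z) powr \<sigma> * cmod2 (h z))"
proof (rule le_if_le_add_powr[OF s])
  fix e :: real assume e: "0 < e"
  have G: "log_sub unit_disc (\<lambda>z. cmod2 (g z) + e) (\<lambda>z. cnj (g z) * deriv g z) (\<lambda>z. cmod2 (deriv g z))"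
    using log_sub_add[OF log_sub_cmod2[OF open_ball g] log_sub_const[of e]] e by simp
  have pos: "0 < cmod2 (g z) + e" for z using e by (intro add_nonneg_pos) auto
  note F = log_sub_mult[OF log_sub_powr[OF G pos less_imp_le[OF s]] log_sub_cmod2[OF open_ball h]]
  have cg: "continuous_on unit_disc g" "continuous_on unit_disc h"
    using g h by (auto intro: holomorphic_on_imp_continuous_on)
  have c1: "continuous_on unit_disc (\<lambda>z. cmod2 (g z) powr \<sigma> * cmod2 (h z))"
    and c2: "continuous_on unit_disc (\<lambda>z. cmod2 (h z))"
    using s by (auto intro!: continuous_on_weight_intros cg)
  have "cmod2 (g 0) powr \<sigma> * cmod2 (h 0) \<le> (cmod2 (g 0) + e) powr \<sigma> * cmod2 (h 0)"
    using s e by (intro mult_right_mono powr_mono2) auto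
  also have "\<dots> \<le> circle_mean r (\<lambda>z. (cmod2 (g z) + e) powr \<sigma> * cmod2 (h z))"
    by (rule circle_mean_subharmonic[OF log_sub_c2[OF F] r]) (rule log_subD(2)[OF F])
  also have "\<dots> \<le> circle_mean r (\<lambda>z. 2 powr \<sigma> * (cmod2 (g z) powr \<sigma> * cmod2 (h z)) + 2 powr \<sigma> * e powr \<sigma> * cmod2 (h z))"
  proof (rule circle_mean_mono)
    show "continuous_on unit_disc (\<lambda>z. (cmod2 (g z) + e) powr \<sigma> * cmod2 (h z))"
      using s e by (auto intro!: continuous_on_weight_intros cg)
    show "continuous_on unit_disc (\<lambda>z. 2 powr \<sigma> * (cmod2 (g z) powr \<sigma> * cmod2 (h z)) + 2 powr \<sigma> * e powr \<sigma> * cmod2 (h z))"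
      by (intro continuous_intros c1 c2)
    fix z
    have "(cmod2 (g z) + e) powr \<sigma> * cmod2 (h z) \<le> 2 powr \<sigma> * (cmod2 (g z) powr \<sigma> + e powr \<sigma>) * cmod2 (h z)"
      using s e by (intro mult_right_mono powr_add_le) auto
    then show "(cmod2 (g z) + e) powr \<sigma> * cmod2 (h z) \<le>
       2 powr \<sigma> * (cmod2 (g z) powr \<sigma> * cmod2 (h z)) + 2 powr \<sigma> * e powr \<sigma> * cmod2 (h z)"
      by (simp add: algebra_simps)
  qed (use r in auto)
  also have "\<dots> = 2 powr \<sigma> * circle_mean r (\<lambda>z. cmod2 (g z) powr \<sigma> * cmod2 (h z))
     + (2 powr \<sigma> * circle_mean r (\<lambda>z. cmod2 (h z))) * e powr \<sigma>"
    using r by (subst circle_mean_add) (auto intro!: continuous_on_mult_left c1 c2 simp: circle_mean_cmult)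
  finally show "cmod2 (g 0) powr \<sigma> * cmod2 (h 0) \<le>
    2 powr \<sigma> * circle_mean r (\<lambda>z. cmod2 (g z) powr \<sigma> * cmod2 (h z))
    + (2 powr \<sigma> * circle_mean r (\<lambda>z. cmod2 (h z))) * e powr \<sigma>" .
qed

lemma nn_integral_ball_affine:
  fixes F :: "complex \<Rightarrow> ennreal"
  assumes [measurable]: "(\<lambda>z. indicator (ball a \<rho>) z * F z) \<in> borel_measurable borel" and \<rho>: "0 < \<rho>"
  shows "(\<integral>\<^sup>+z. indicator (ball a \<rho>) z * F z \<partial>lborel) =
    ennreal (\<rho>\<^sup>2) * (\<integral>\<^sup>+z. indicator unit_disc z * F (a + of_real \<rho> * z) \<partial>lborel)"
proof -
  have eq: "(lborel :: complex measure) = density (distr lborel borel (\<lambda>x. a + \<rho> *\<^sub>R x)) (\<lambda>_. ennreal (\<rho>\<^sup>2))"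
    using lborel_affine[of \<rho> a] \<rho> by simp
  have "(\<integral>\<^sup>+z. indicator (ball a \<rho>) z * F z \<partial>lborel) =
     ennreal (\<rho>\<^sup>2) * (\<integral>\<^sup>+z. indicator (ball a \<rho>) (a + \<rho> *\<^sub>R z) * F (a + \<rho> *\<^sub>R z) \<partial>lborel)"
    by (subst eq) (simp add: nn_integral_density nn_integral_distr nn_integral_cmult)
  moreover have "indicator (ball a \<rho>) (a + \<rho> *\<^sub>R z) = (indicator unit_disc z :: ennreal)" for z
    using \<rho> by (auto simp: indicator_def dist_norm)
  ultimately show ?thesis by (simp add: scaleR_conv_of_real)
qed

text \<open>The circle version, transported to the disc about \<open>a\<close> by an affine map and
  integrated over the radii.\<close>

lemma power_weight_disc_submean:
  assumes g: "g holomorphic_on unit_disc" and h: "h holomorphic_on unit_disc" and s: "0 < \<sigma>"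
    and \<rho>: "0 < \<rho>" "ball a \<rho> \<subseteq> unit_disc"
  shows "ennreal (pi * \<rho>\<^sup>2 * (cmod2 (g a) powr \<sigma> * cmod2 (h a))) \<le>
    ennreal (2 powr \<sigma>) * (\<integral>\<^sup>+z. indicator (ball a \<rho>) z * ennreal (cmod2 (g z) powr \<sigma> * cmod2 (h z)) \<partial>lborel)"
proof -
  define k where "k = (\<lambda>z. cmod2 (g z) powr \<sigma> * cmod2 (h z))"
  define A where "A = (\<lambda>z. a + of_real \<rho> * z)"
  have A: "A ` unit_disc \<subseteq> ball a \<rho>" using \<rho> by (auto simp: A_def dist_norm norm_mult)
  then have A': "A ` unit_disc \<subseteq> unit_disc" using \<rho> by blast
  have Ah: "A holomorphic_on unit_disc" unfolding A_def by (intro holomorphic_intros)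
  have hol: "(\<lambda>z. g (A z)) holomorphic_on unit_disc" "(\<lambda>z. h (A z)) holomorphic_on unit_disc"
    using holomorphic_on_compose_gen[OF Ah g A'] holomorphic_on_compose_gen[OF Ah h A'] by (auto simp: o_def)
  have ck: "continuous_on unit_disc k"
    using s holomorphic_on_imp_continuous_on[OF g] holomorphic_on_imp_continuous_on[OF h]
    unfolding k_def by (auto intro!: continuous_on_weight_intros)
  have ckA: "continuous_on unit_disc (\<lambda>z. k (A z))"
    by (rule continuous_on_compose2[OF ck holomorphic_on_imp_continuous_on[OF Ah] A'])
  have k0: "0 \<le> k z" for z by (simp add: k_def)
  have sub: "k a \<le> 2 powr \<sigma> * circle_mean r (\<lambda>z. k (A z))" if "0 \<le> r" "r < 1" for r
    using power_weight_submean[OF hol s that] by (simp add: k_def A_def)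
  have "ennreal (pi * k a) = ennreal (integral {0..1} (\<lambda>r. 2 * pi * r * k a))"
  proof -
    have "integral {0..1} (\<lambda>r. 2 * pi * r * k a) = pi * k a * 1\<^sup>2 - pi * k a * 0\<^sup>2"
    proof (rule integral_unique, rule fundamental_theorem_of_calculus)
      fix r :: real show "((\<lambda>r. pi * k a * r\<^sup>2) has_vector_derivative 2 * pi * r * k a) (at r within {0..1})"
        unfolding has_real_derivative_iff_has_vector_derivative[symmetric]
        by (auto intro!: derivative_eq_intros)
    qed simp
    then show ?thesis by simp
  qed
  also have "\<dots> = (\<integral>\<^sup>+r. indicator {0..1} r * ennreal (2 * pi * r * k a) \<partial>lborel)"
    by (rule nn_integral_continuous_Icc[symmetric]) (auto intro!: continuous_intros mult_nonneg_nonneg k0)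
  also have "\<dots> \<le> (\<integral>\<^sup>+r. ennreal (2 powr \<sigma>) * (indicator {0..<1} r * ennreal (2 * pi * r * circle_mean r (\<lambda>z. k (A z)) * 1)) \<partial>lborel)"
  proof (rule nn_integral_mono_AE, rule AE_mp[OF AE_lborel_singleton[of 1] AE_I2], rule impI)
    fix r :: real assume r: "r \<noteq> 1"
    show "indicator {0..1} r * ennreal (2 * pi * r * k a) \<le>
      ennreal (2 powr \<sigma>) * (indicator {0..<1} r * ennreal (2 * pi * r * circle_mean r (\<lambda>z. k (A z)) * 1))"
    proof (cases "0 \<le> r \<and> r < 1")
      case True
      then have "2 * pi * r * k a \<le> 2 * pi * r * (2 powr \<sigma> * circle_mean r (\<lambda>z. k (A z)))"
        by (intro mult_left_mono sub) auto
      then have "ennreal (2 * pi * r * k a) \<le> ennreal (2 powr \<sigma> * (2 * pi * r * circle_mean r (\<lambda>z. k (A z))))"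
        by (intro ennreal_leI) (simp add: algebra_simps)
      with True show ?thesis by (simp add: ennreal_mult')
    qed (use r in \<open>auto simp: indicator_def\<close>)
  qed
  also have "\<dots> = ennreal (2 powr \<sigma>) * (\<integral>\<^sup>+r. indicator {0..<1} r * ennreal (2 * pi * r * circle_mean r (\<lambda>z. k (A z)) * 1) \<partial>lborel)"
  proof (rule nn_integral_cmult)
    have "(\<lambda>r. indicator {-1<..<1} r *\<^sub>R circle_mean r (\<lambda>z. k (A z))) \<in> borel_measurable borel"
      by (intro borel_measurable_continuous_on_indicator circle_mean_continuous ckA) simp
    then have "(\<lambda>r. indicator {0..<1} r * ennreal (2 * pi * r * (indicator {-1<..<1} r *\<^sub>R circle_mean r (\<lambda>z. k (A z))))) \<in> borel_measurable borel"
      by measurable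
    moreover have "indicator {0..<1} r * ennreal (2 * pi * r * (indicator {-1<..<1} r *\<^sub>R circle_mean r (\<lambda>z. k (A z))))
      = indicator {0..<1} r * ennreal (2 * pi * r * circle_mean r (\<lambda>z. k (A z)) * 1)" for r :: real
      by (auto simp: indicator_def)
    ultimately show "(\<lambda>r. indicator {0..<1} r * ennreal (2 * pi * r * circle_mean r (\<lambda>z. k (A z)) * 1)) \<in> borel_measurable lborel"
      by simp
  qed
  also have "(\<integral>\<^sup>+r. indicator {0..<1} r * ennreal (2 * pi * r * circle_mean r (\<lambda>z. k (A z)) * 1) \<partial>lborel)
    = (\<integral>\<^sup>+z. indicator unit_disc z * ennreal (k (A z) * 1) \<partial>lborel)"
    using nn_integral_disc_polar[OF ckA k0, of "\<lambda>_. 1"] by simp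
  finally have 1: "ennreal (pi * k a) \<le> ennreal (2 powr \<sigma>) * (\<integral>\<^sup>+z. indicator unit_disc z * ennreal (k (A z)) \<partial>lborel)"
    by simp
  have "(\<lambda>z. ennreal (indicator (ball a \<rho>) z *\<^sub>R k z)) \<in> borel_measurable borel"
    by (intro measurable_compose[OF borel_measurable_continuous_on_indicator measurable_ennreal]
        continuous_on_subset[OF ck]) (use \<rho> in auto)
  moreover have "ennreal (indicator (ball a \<rho>) z *\<^sub>R k z) = indicator (ball a \<rho>) z * ennreal (k z)" for z
    by (simp add: indicator_def)
  ultimately have m: "(\<lambda>z. indicator (ball a \<rho>) z * ennreal (k z)) \<in> borel_measurable borel" by simp
  have "ennreal (pi * \<rho>\<^sup>2 * k a) = ennreal (\<rho>\<^sup>2) * ennreal (pi * k a)"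
    using k0[of a] by (simp add: ennreal_mult'[symmetric] mult_ac)
  also have "\<dots> \<le> ennreal (\<rho>\<^sup>2) * (ennreal (2 powr \<sigma>) * (\<integral>\<^sup>+z. indicator unit_disc z * ennreal (k (A z)) \<partial>lborel))"
    by (intro mult_left_mono 1) auto
  also have "\<dots> = ennreal (2 powr \<sigma>) * (\<integral>\<^sup>+z. indicator (ball a \<rho>) z * ennreal (k z) \<partial>lborel)"
    unfolding nn_integral_ball_affine[OF m \<rho>(1)] A_def by (simp add: algebra_simps)
  finally show ?thesis unfolding k_def .
qed

section \<open>Carleson condition for Hardy means\<close>

lemma continuous_on_slice:
  assumes "continuous_on (U \<times> T) F" "z \<in> U"
  shows "continuous_on T (\<lambda>p. F (z, p))"
  by (rule continuous_on_compose2[OF assms(1)]) (use assms(2) in \<open>auto intro!: continuous_intros\<close>)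

text \<open>Differentiation under the integral sign, applied once to \<open>f\<close> and once to
  \<open>d\<close>. The derivatives are packed as bounded linear maps because the Leibniz rule asks
  for their joint continuity as such.\<close>

lemma c2_integral:
  fixes f :: "complex \<Rightarrow> 'b::euclidean_space \<Rightarrow> real" and d P :: "complex \<Rightarrow> 'b \<Rightarrow> complex"
  assumes U: "open U" "convex U"
    and f': "\<And>z p. \<lbrakk>z \<in> U; p \<in> cbox a b\<rbrakk> \<Longrightarrow> ((\<lambda>z. f z p) has_derivative (\<lambda>h. 2 * Re (d z p * h))) (at z)"
    and d': "\<And>z p. \<lbrakk>z \<in> U; p \<in> cbox a b\<rbrakk> \<Longrightarrow>
      ((\<lambda>z. d z p) has_derivative (\<lambda>h. P z p * h + of_real (L z p) * cnj h)) (at z)"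
    and cf: "\<And>z. z \<in> U \<Longrightarrow> continuous_on (cbox a b) (f z)"
    and cd: "continuous_on (U \<times> cbox a b) (\<lambda>(z, p). d z p)"
    and cP: "continuous_on (U \<times> cbox a b) (\<lambda>(z, p). P z p)"
    and cL: "continuous_on (U \<times> cbox a b) (\<lambda>(z, p). L z p)"
  shows "c2 U (\<lambda>z. integral (cbox a b) (f z)) (\<lambda>z. integral (cbox a b) (d z)) (\<lambda>z. integral (cbox a b) (L z))"
proof (rule c2I[where P="\<lambda>z. integral (cbox a b) (P z)"])
  show "continuous_on U (\<lambda>z. integral (cbox a b) (P z))" "continuous_on U (\<lambda>z. integral (cbox a b) (L z))"
    using cP cL by (auto intro: integral_continuous_on_param)
  fix z assume z: "z \<in> U"
  have slice: "continuous_on (cbox a b) (k z)" if "continuous_on (U \<times> cbox a b) (\<lambda>(z, p). k z p)" for k :: "complex \<Rightarrow> 'b \<Rightarrow> 'c::topological_space"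
    using continuous_on_slice[OF that z] by simp
  define re where "re = Blinfun Re"
  define cj where "cj = Blinfun cnj"
  have re: "blinfun_apply re = Re" unfolding re_def by (rule bounded_linear_Blinfun_apply[OF bounded_linear_Re])
  have cj: "blinfun_apply cj = cnj" unfolding cj_def by (rule bounded_linear_Blinfun_apply[OF bounded_linear_cnj])
  define D1 where "D1 = (\<lambda>z p. 2 *\<^sub>R (re o\<^sub>L blinfun_mult_right (d z p)))"
  define D2 where "D2 = (\<lambda>z p. blinfun_mult_right (P z p) + (blinfun_mult_right (of_real (L z p)) o\<^sub>L cj))"
  have D1: "blinfun_apply (D1 z p) = (\<lambda>h. 2 * Re (d z p * h))" for z p
    by (simp add: D1_def fun_eq_iff re blinfun.scaleR_left)
  have D2: "blinfun_apply (D2 z p) = (\<lambda>h. P z p * h + of_real (L z p) * cnj h)" for z p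
    by (simp add: D2_def fun_eq_iff cj blinfun.add_left)
  have cD1: "continuous_on (U \<times> cbox a b) (\<lambda>(z, p). D1 z p)"
    using cd unfolding D1_def split_beta
    by (auto intro!: continuous_intros bounded_linear.continuous_on[OF bounded_linear_blinfun_mult_right]
        bounded_bilinear.continuous_on[OF bounded_bilinear_blinfun_compose])
  have cD2: "continuous_on (U \<times> cbox a b) (\<lambda>(z, p). D2 z p)"
    using cP cL unfolding D2_def split_beta
    by (auto intro!: continuous_intros bounded_linear.continuous_on[OF bounded_linear_blinfun_mult_right]
        bounded_bilinear.continuous_on[OF bounded_bilinear_blinfun_compose])
  have id: "d z integrable_on cbox a b" and iP: "P z integrable_on cbox a b" and iL: "L z integrable_on cbox a b"
    using slice[OF cd] slice[OF cP] slice[OF cL] by (auto intro: integrable_continuous)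
  have "((\<lambda>z. integral (cbox a b) (f z)) has_derivative blinfun_apply (integral (cbox a b) (D1 z))) (at z within U)"
  proof (rule leibniz_rule[OF _ _ cD1 z U(2)])
    show "((\<lambda>z. f z p) has_derivative blinfun_apply (D1 z p)) (at z within U)" if "z \<in> U" "p \<in> cbox a b" for z p
      using f'[OF that] unfolding D1 by (rule has_derivative_at_withinI)
    show "f z integrable_on cbox a b" if "z \<in> U" for z
      by (rule integrable_continuous[OF cf[OF that]])
  qed
  moreover have "blinfun_apply (integral (cbox a b) (D1 z)) = (\<lambda>h. 2 * Re (integral (cbox a b) (d z) * h))"
  proof
    fix h
    have "blinfun_apply (integral (cbox a b) (D1 z)) h = integral (cbox a b) (\<lambda>p. 2 * Re (d z p * h))"
      using slice[OF cD1] by (subst blinfun_apply_integral) (auto simp: D1 intro: integrable_continuous)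
    also have "\<dots> = 2 * integral (cbox a b) (\<lambda>p. Re (d z p * h))" by (rule integral_mult_right)
    also have "integral (cbox a b) (\<lambda>p. Re (d z p * h)) = Re (integral (cbox a b) (\<lambda>p. d z p * h))"
      using integral_linear[OF integrable_on_mult_left[OF id] bounded_linear_Re] by (simp add: o_def)
    finally show "blinfun_apply (integral (cbox a b) (D1 z)) h = 2 * Re (integral (cbox a b) (d z) * h)"
      by (simp only: integral_mult_left)
  qed
  ultimately show "((\<lambda>z. integral (cbox a b) (f z)) has_derivative (\<lambda>h. 2 * Re (integral (cbox a b) (d z) * h))) (at z)"
    by (simp only: at_within_open[OF z U(1)])
  have "((\<lambda>z. integral (cbox a b) (d z)) has_derivative blinfun_apply (integral (cbox a b) (D2 z))) (at z within U)"
  proof (rule leibniz_rule[OF _ _ cD2 z U(2)])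
    show "((\<lambda>z. d z p) has_derivative blinfun_apply (D2 z p)) (at z within U)" if "z \<in> U" "p \<in> cbox a b" for z p
      using d'[OF that] unfolding D2 by (rule has_derivative_at_withinI)
    show "d z integrable_on cbox a b" if "z \<in> U" for z
      using continuous_on_slice[OF cd that] by (intro integrable_continuous) simp
  qed
  moreover have "blinfun_apply (integral (cbox a b) (D2 z)) =
     (\<lambda>h. integral (cbox a b) (P z) * h + of_real (integral (cbox a b) (L z)) * cnj h)"
  proof
    fix h
    have iL': "(\<lambda>p. complex_of_real (L z p)) integrable_on cbox a b"
      using integrable_linear[OF iL bounded_linear_of_real[where 'a=complex]] by (simp add: o_def)
    have "blinfun_apply (integral (cbox a b) (D2 z)) h = integral (cbox a b) (\<lambda>p. P z p * h + of_real (L z p) * cnj h)"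
      using slice[OF cD2] by (subst blinfun_apply_integral) (auto simp: D2 intro: integrable_continuous)
    also have "\<dots> = integral (cbox a b) (\<lambda>p. P z p * h) + integral (cbox a b) (\<lambda>p. of_real (L z p) * cnj h)"
      by (intro integral_add integrable_on_mult_left iP iL')
    also have "integral (cbox a b) (\<lambda>p. complex_of_real (L z p) * cnj h) = integral (cbox a b) (\<lambda>p. complex_of_real (L z p)) * cnj h"
      by (rule integral_mult_left)
    also have "integral (cbox a b) (\<lambda>p. complex_of_real (L z p)) = of_real (integral (cbox a b) (L z))"
      using integral_linear[OF iL bounded_linear_of_real[where 'a=complex]] by (simp add: o_def)
    finally show "blinfun_apply (integral (cbox a b) (D2 z)) h =
      integral (cbox a b) (P z) * h + of_real (integral (cbox a b) (L z)) * cnj h"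
      by (simp only: integral_mult_left)
  qed
  ultimately show "((\<lambda>z. integral (cbox a b) (d z)) has_derivative
     (\<lambda>h. integral (cbox a b) (P z) * h + of_real (integral (cbox a b) (L z)) * cnj h)) (at z)"
    by (simp only: at_within_open[OF z U(1)])
qed

section \<open>Disc automorphisms and the potential of a BMO measure\<close>

lemma disc_auto_denominator:
  assumes "cmod a < 1" "cmod z < 1"
  shows "1 - cnj z * a \<noteq> 0"
proof
  assume "1 - cnj z * a = 0"
  then have "cmod (cnj z * a) = 1" by (metis eq_iff_diff_eq_0 norm_one)
  moreover have "cmod z * cmod a < 1 * 1" using assms by (intro mult_strict_mono) auto
  ultimately show False by (simp add: norm_mult)
qed

text \<open>The BMOA condition integrates in z with \<open>a\<close> fixed, whereas the potential is
  differentiated in \<open>a\<close>; there \<open>disc_auto z\<close> is the holomorphic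
  one.\<close>

lemma cmod_disc_auto_swap: "cmod (disc_auto z a) = cmod (disc_auto a z)"
proof -
  have "cmod (1 - cnj z * a) = cmod (cnj (1 - cnj z * a))" by (simp only: complex_mod_cnj)
  also have "\<dots> = cmod (1 - cnj a * z)" by (simp add: mult.commute)
  finally show ?thesis by (simp add: disc_auto_def norm_divide norm_minus_commute)
qed

lemma cmod_disc_auto_less_1:
  assumes "cmod a < 1" "cmod z < 1"
  shows "cmod (disc_auto a z) < 1"
proof -
  have "0 < (1 - cmod2 a) * (1 - cmod2 z)"
    using assms by (intro mult_pos_pos) (auto simp: abs_square_less_1)
  also have "\<dots> = cmod2 (1 - cnj a * z) - cmod2 (a - z)"
    unfolding cmod_power2 by (simp add: power2_eq_square algebra_simps)
  finally have "cmod2 (a - z) < cmod2 (1 - cnj a * z)" by simp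
  then have "cmod (a - z) < cmod (1 - cnj a * z)" by (rule power2_less_imp_less) simp
  then show ?thesis
    by (simp add: disc_auto_def norm_divide divide_less_eq_1_pos[OF le_less_trans[OF norm_ge_zero]])
qed

text \<open>The potential is the integral of \<open>1 - \<bar>\<phi>\<^sub>z(a)\<bar>\<^sup>2\<close> against \<open>\<tau>(z) dA(z) / \<pi>\<close>. The hypothesis bounds it by 1, and
  it is superharmonic because \<open>\<phi>\<^sub>z\<close> is holomorphic. The kernel of its Laplacian is of size \<open>\<rho>\<^sup>-\<^sup>2\<close> on the disc of
  radius \<open>\<rho> = (1 - \<bar>a\<bar>) / 2\<close> about \<open>a\<close>, so the sub-mean value property of \<open>\<tau>\<close> recovers \<open>\<tau>(a)\<close>.\<close>

lemma bmo_potential: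
  assumes g: "g holomorphic_on unit_disc" and s: "0 < \<sigma>" and r: "0 \<le> r" "r < 1"
    and bmo: "\<And>a. a \<in> unit_disc \<Longrightarrow> (\<integral>\<^sup>+z. indicator unit_disc z * ennreal (1 - cmod2 (disc_auto a z)) *
      ennreal (cmod2 (g z) powr \<sigma> * cmod2 (deriv g z)) \<partial>lborel) \<le> ennreal pi"
  obtains \<psi> d K where "c2 unit_disc \<psi> d K"
    "\<And>a. a \<in> unit_disc \<Longrightarrow> 0 \<le> \<psi> a" "\<And>a. a \<in> unit_disc \<Longrightarrow> \<psi> a \<le> 1"
    "\<And>a. cmod a \<le> r \<Longrightarrow> cmod2 (g a) powr \<sigma> * cmod2 (deriv g a) \<le> - (625 * 2 powr \<sigma> * K a)"
proof -
  define \<tau> where "\<tau> = (\<lambda>z. cmod2 (g z) powr \<sigma> * cmod2 (deriv g z))"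
  \<comment> \<open>For |a| <= r the disc of radius (1 - |a|) / 2 about \<open>a\<close> stays
    within radius (1 + |a|) / 2 <= R. Cutting the measure at R < 1 makes the potential an integral
    of smooth functions over a compact set.\<close>
  define R where "R = (1 + r) / 2"
  have R: "0 \<le> R" "R < 1" "r < R" using r by (auto simp: R_def)
  have hg: "deriv g holomorphic_on unit_disc" by (intro holomorphic_deriv g) simp
  have c\<tau>: "continuous_on unit_disc \<tau>" unfolding \<tau>_def
    using s holomorphic_on_imp_continuous_on[OF g] holomorphic_on_imp_continuous_on[OF hg]
    by (auto intro!: continuous_on_weight_intros)
  have \<tau>0: "0 \<le> \<tau> z" for z by (simp add: \<tau>_def)
  \<comment> \<open>\<open>v\<close> and \<open>w\<close> are the first and second derivatives of
    \<open>disc_auto z\<close> in \<open>a\<close>.\<close>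
  define v where "v = (\<lambda>a z. - of_real (1 - cmod2 z) * inverse (1 - cnj z * a)^2)"
  define w where "w = (\<lambda>a z. - 2 * cnj z * of_real (1 - cmod2 z) * inverse (1 - cnj z * a)^3)"
  have u': "((\<lambda>a. disc_auto z a) has_field_derivative v a z) (at a)"
    and v': "((\<lambda>a. v a z) has_field_derivative w a z) (at a)" if "cmod a < 1" "cmod z < 1" for a z
  proof -
    note nz = disc_auto_denominator[OF that]
    have zz: "of_real (1 - cmod2 z) = 1 - z * cnj z" using complex_norm_square[of z] by simp
    have "((\<lambda>a. (z - a) / (1 - cnj z * a)) has_field_derivative
       ((0 - 1) * (1 - cnj z * a) - (z - a) * (0 - cnj z * 1)) / ((1 - cnj z * a) * (1 - cnj z * a))) (at a)"
      using nz by (intro derivative_intros) auto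
    moreover have "(0 - 1) * (1 - cnj z * a) - (z - a) * (0 - cnj z * 1) = - (1 - z * cnj z)"
      by (simp add: algebra_simps)
    ultimately have "((\<lambda>a. (z - a) / (1 - cnj z * a)) has_field_derivative
       (- (1 - z * cnj z)) / ((1 - cnj z * a) * (1 - cnj z * a))) (at a)"
      by (simp only:)
    then show "((\<lambda>a. disc_auto z a) has_field_derivative v a z) (at a)"
      unfolding disc_auto_def v_def zz by (simp add: divide_inverse power2_eq_square)
    show "((\<lambda>a. v a z) has_field_derivative w a z) (at a)"
      unfolding v_def w_def using nz
      by (auto intro!: derivative_eq_intros simp: power2_eq_square power3_eq_cube algebra_simps)
  qed
  define S where "S = cbox (0::real, 0::real) (R, 2 * pi)"
  define Z where "Z = (\<lambda>p::real \<times> real. rcis (fst p) (snd p))"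
  have Z: "cmod (Z p) < 1" "cmod (Z p) \<le> R" "0 \<le> fst p" if "p \<in> S" for p
    using that R by (cases p; auto simp: Z_def S_def complex_mod_rcis)+
  \<comment> \<open>Density of \<tau> dA / pi in polar coordinates, the factor \<open>fst p\<close>
    being the Jacobian.\<close>
  define m where "m = (\<lambda>p. fst p * \<tau> (Z p) / pi)"
  have m0: "0 \<le> m p" if "p \<in> S" for p using Z[OF that] \<tau>0 by (simp add: m_def)
  have cZ: "continuous_on X Z" for X unfolding Z_def by (intro continuous_intros)
  have cm: "continuous_on S m"
    unfolding m_def using Z by (intro continuous_intros continuous_on_compose2[OF c\<tau> cZ]) auto
  define f where "f = (\<lambda>a p. m p * (1 - cmod2 (disc_auto (Z p) a)))"
  define d where "d = (\<lambda>a p. - of_real (m p) * (cnj (disc_auto (Z p) a) * v a (Z p)))"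
  define P where "P = (\<lambda>a p. - of_real (m p) * (cnj (disc_auto (Z p) a) * w a (Z p)))"
  define L where "L = (\<lambda>a p. - (m p * cmod2 (v a (Z p))))"
  have nz: "1 - cnj (Z (snd x)) * fst x \<noteq> 0" if "x \<in> unit_disc \<times> S" for x
    using that Z by (intro disc_auto_denominator) auto
  have cfst: "continuous_on (unit_disc \<times> S) (\<lambda>x. m (snd x))"
    by (rule continuous_on_compose2[OF cm]) (auto intro!: continuous_intros)
  have cZs: "continuous_on (unit_disc \<times> S) (\<lambda>x. Z (snd x))"
    unfolding Z_def by (intro continuous_intros)
  have cda: "continuous_on (unit_disc \<times> S) (\<lambda>x. disc_auto (Z (snd x)) (fst x))"
    unfolding disc_auto_def using nz by (intro continuous_intros cZs) blast
  have cv: "continuous_on (unit_disc \<times> S) (\<lambda>x. v (fst x) (Z (snd x)))"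
    unfolding v_def using nz by (intro continuous_intros cZs) auto
  have cw: "continuous_on (unit_disc \<times> S) (\<lambda>x. w (fst x) (Z (snd x)))"
    unfolding w_def using nz by (intro continuous_intros cZs) auto
  have psi: "c2 unit_disc (\<lambda>a. integral S (f a)) (\<lambda>a. integral S (d a)) (\<lambda>a. integral S (L a))"
    unfolding S_def
  proof (rule c2_integral[where P = P], unfold S_def[symmetric])
    fix a p assume a: "a \<in> unit_disc" and p: "p \<in> S"
    have au: "cmod a < 1" "cmod (Z p) < 1" using a Z[OF p] by auto
    note D = cmod2_derivatives[OF u'[OF au] v'[OF au]]
    show "((\<lambda>a. f a p) has_derivative (\<lambda>h. 2 * Re (d a p * h))) (at a)"
      unfolding f_def d_def
      by (rule has_derivative_eq_rhs[OF has_derivative_mult_right[OF has_derivative_diff[OF has_derivative_const D(1)]]])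
        (auto simp: fun_eq_iff algebra_simps)
    show "((\<lambda>a. d a p) has_derivative (\<lambda>h. P a p * h + of_real (L a p) * cnj h)) (at a)"
      unfolding d_def P_def L_def
      by (rule has_derivative_eq_rhs[OF has_derivative_mult_right[OF D(2)]]) (auto simp: fun_eq_iff algebra_simps)
  next
    fix a :: complex assume a: "a \<in> unit_disc"
    have "continuous_on S (\<lambda>p. disc_auto (Z p) a)"
      using continuous_on_slice[OF cda a] by simp
    then show "continuous_on S (f a)"
      unfolding f_def by (intro continuous_intros cm)
  qed (auto simp: split_beta d_def P_def L_def intro!: continuous_intros cfst cda cv cw)
  have cfS: "continuous_on S (f a)" and cLS: "continuous_on S (L a)" if a: "a \<in> unit_disc" for a
  proof -
    have "continuous_on S (\<lambda>p. disc_auto (Z p) a)"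
      using continuous_on_slice[OF cda a] by simp
    then show "continuous_on S (f a)"
      unfolding f_def by (intro continuous_intros cm)
    have "continuous_on S (\<lambda>p. v a (Z p))"
      using continuous_on_slice[OF cv a] by simp
    then show "continuous_on S (L a)"
      unfolding L_def by (intro continuous_intros cm)
  qed
  have ifS: "f a integrable_on S" and iLS: "L a integrable_on S" if "a \<in> unit_disc" for a
    using cfS[OF that] cLS[OF that] unfolding S_def by (auto intro: integrable_continuous)
  have polar: "ennreal (integral S (\<lambda>p. fst p * F (Z p))) = (\<integral>\<^sup>+z. indicator (cball 0 R) z * ennreal (F z) \<partial>lborel)"
    if "continuous_on unit_disc F" "\<And>z. z \<in> unit_disc \<Longrightarrow> 0 \<le> F z" for F
    using nn_integral_cball_polar[OF that R(1,2)] by (simp add: S_def Z_def)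
  show ?thesis
  proof (rule that[OF psi])
    fix a :: complex assume a: "a \<in> unit_disc"
    have k0: "0 \<le> 1 - cmod2 (disc_auto z a)" if "z \<in> unit_disc" for z
      using cmod_disc_auto_less_1[of z a] that a by (simp add: abs_square_le_1)
    have ck: "continuous_on unit_disc (\<lambda>z. disc_auto z a)"
      unfolding disc_auto_def using disc_auto_denominator a by (intro continuous_intros) auto
    show "0 \<le> integral S (f a)"
      using k0 Z by (intro integral_nonneg[OF ifS[OF a]]) (auto simp: f_def intro!: mult_nonneg_nonneg m0)
    have "ennreal (pi * integral S (f a)) = ennreal (integral S (\<lambda>p. fst p * (\<tau> (Z p) * (1 - cmod2 (disc_auto (Z p) a)))))"
      by (subst integral_mult_right[symmetric]) (simp add: f_def m_def algebra_simps)
    also have "\<dots> = (\<integral>\<^sup>+z. indicator (cball 0 R) z * ennreal (\<tau> z * (1 - cmod2 (disc_auto z a))) \<partial>lborel)"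
      using k0 \<tau>0 by (intro polar continuous_intros c\<tau> ck mult_nonneg_nonneg) auto
    also have "\<dots> \<le> (\<integral>\<^sup>+z. indicator unit_disc z * ennreal (1 - cmod2 (disc_auto a z)) * ennreal (\<tau> z) \<partial>lborel)"
    proof (intro nn_integral_mono)
      fix z
      show "indicator (cball 0 R) z * ennreal (\<tau> z * (1 - cmod2 (disc_auto z a))) \<le>
        indicator unit_disc z * ennreal (1 - cmod2 (disc_auto a z)) * ennreal (\<tau> z)"
      proof (cases "z \<in> cball 0 R")
        case True
        then have "z \<in> unit_disc" using R by auto
        then show ?thesis using k0[of z] \<tau>0[of z] True
          by (simp add: cmod_disc_auto_swap[of z a] ennreal_mult mult.commute indicator_def)
      qed simp
    qed
    also have "\<dots> \<le> ennreal pi" using bmo[OF a] unfolding \<tau>_def .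
    finally show "integral S (f a) \<le> 1" by (simp add: ennreal_le_iff)
  next
    fix a :: complex assume ar: "cmod a \<le> r"
    then have a: "a \<in> unit_disc" using r by simp
    define \<rho> where "\<rho> = (1 - cmod a) / 2"
    have \<rho>: "0 < \<rho>" using a by (simp add: \<rho>_def)
    have sub: "ball a \<rho> \<subseteq> cball 0 R"
    proof
      fix z assume "z \<in> ball a \<rho>"
      then have "cmod (z - a) < \<rho>" by (simp add: dist_norm norm_minus_commute)
      then have "cmod z < cmod a + \<rho>" using norm_triangle_ineq[of a "z - a"] by simp
      also have "\<dots> \<le> R" using ar by (simp add: \<rho>_def R_def field_simps)
      finally show "z \<in> cball 0 R" by simp
    qed
    \<comment> \<open>|v| is (1 - |z|^2) / |1 - cnj z * a|^2, with numerator at least \<rho>. The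
      denominator is at most (5 \<rho>)^2, since 1 - |a|^2 <= 4 \<rho> and |z - a| < \<rho>;
      squaring 1 / (25 \<rho>) gives 625.\<close>
    have kernel: "1 / (625 * \<rho>\<^sup>2) \<le> cmod2 (v a z)" if z: "z \<in> ball a \<rho>" for z
    proof -
      have za: "cmod (z - a) < \<rho>" using z by (simp add: dist_norm norm_minus_commute)
      then have "cmod z \<le> cmod a + \<rho>" using norm_triangle_ineq[of a "z - a"] by simp
      then have z1: "\<rho> \<le> 1 - cmod z" by (simp add: \<rho>_def field_simps)
      then have "cmod z < 1" using \<rho> by simp
      have "cmod2 z \<le> cmod z" using \<open>cmod z < 1\<close> by (simp add: power2_eq_square mult_left_le_one_le)
      then have 1: "\<rho> \<le> 1 - cmod2 z" using z1 by simp
      have "1 - cnj z * a = of_real (1 - cmod2 a) - cnj (z - a) * a"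
        using complex_norm_square[of a] by (simp add: algebra_simps)
      then have "cmod (1 - cnj z * a) \<le> cmod (of_real (1 - cmod2 a)) + cmod (cnj (z - a) * a)"
        by (metis norm_triangle_ineq4)
      also have "\<dots> = \<bar>1 - cmod2 a\<bar> + cmod (z - a) * cmod a" by (simp only: norm_of_real norm_mult complex_mod_cnj)
      also have "\<dots> \<le> 4 * \<rho> + \<rho> * 1"
      proof (intro add_mono mult_mono)
        have "\<bar>1 - cmod2 a\<bar> = (1 - cmod a) * (1 + cmod a)"
          using a by (simp add: abs_if power2_eq_square algebra_simps) (metis abs_square_less_1 norm_ge_zero abs_of_nonneg power2_eq_square not_less order.asym)
        also have "\<dots> \<le> (1 - cmod a) * 2" using a by (intro mult_left_mono) auto
        finally show "\<bar>1 - cmod2 a\<bar> \<le> 4 * \<rho>" by (simp add: \<rho>_def)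
      qed (use za a \<rho> in auto)
      finally have 2: "cmod (1 - cnj z * a) \<le> 5 * \<rho>" by simp
      have nz: "0 < cmod (1 - cnj z * a)"
        using disc_auto_denominator[of a z] a \<open>cmod z < 1\<close> by simp
      have "cmod (1 - cnj z * a) ^ 2 \<le> (5 * \<rho>)\<^sup>2" using 2 by (intro power_mono) auto
      then have "1 / (25 * \<rho>) \<le> (1 - cmod2 z) / cmod (1 - cnj z * a) ^ 2"
        using 1 \<rho> nz frac_le[of "1 - cmod2 z" \<rho> "cmod2 (1 - cnj z * a)" "(5 * \<rho>)\<^sup>2"]
        by (simp add: power2_eq_square)
      also have "\<dots> = cmod (v a z)"
      proof -
        have "cmod (v a z) = cmod (complex_of_real (1 - cmod2 z)) / cmod (1 - cnj z * a) ^ 2"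
          unfolding v_def by (simp only: norm_mult norm_inverse norm_minus_cancel norm_power divide_inverse power_inverse)
        then show ?thesis using 1 \<rho> by (simp only: norm_of_real)
      qed
      finally have "(1 / (25 * \<rho>))\<^sup>2 \<le> cmod2 (v a z)" using \<rho> by (intro power_mono) auto
      then show ?thesis by (simp add: power2_eq_square)
    qed
    have cva: "continuous_on unit_disc (\<lambda>z. v a z)"
      unfolding v_def using disc_auto_denominator a by (intro continuous_intros) auto
    have "ennreal (pi * \<rho>\<^sup>2 * \<tau> a) \<le> ennreal (2 powr \<sigma>) * (\<integral>\<^sup>+z. indicator (ball a \<rho>) z * ennreal (\<tau> z) \<partial>lborel)"
      unfolding \<tau>_def by (rule power_weight_disc_submean[OF g hg s \<rho>]) (use sub R in auto)
    also have "(\<integral>\<^sup>+z. indicator (ball a \<rho>) z * ennreal (\<tau> z) \<partial>lborel) \<le>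
      (\<integral>\<^sup>+z. indicator (cball 0 R) z * ennreal (625 * \<rho>\<^sup>2 * (\<tau> z * cmod2 (v a z))) \<partial>lborel)"
    proof (intro nn_integral_mono)
      fix z
      show "indicator (ball a \<rho>) z * ennreal (\<tau> z) \<le> indicator (cball 0 R) z * ennreal (625 * \<rho>\<^sup>2 * (\<tau> z * cmod2 (v a z)))"
      proof (cases "z \<in> ball a \<rho>")
        case True
        have "1 \<le> 625 * \<rho>\<^sup>2 * cmod2 (v a z)"
          using kernel[OF True] \<rho> by (simp add: field_simps)
        then have "\<tau> z * 1 \<le> \<tau> z * (625 * \<rho>\<^sup>2 * cmod2 (v a z))"
          using \<tau>0 by (intro mult_left_mono)
        then show ?thesis using True sub by (auto simp: algebra_simps intro!: ennreal_leI)
      qed simp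
    qed
    also have "\<dots> = ennreal (integral S (\<lambda>p. fst p * (625 * \<rho>\<^sup>2 * (\<tau> (Z p) * cmod2 (v a (Z p))))))"
      using \<tau>0 by (intro polar[symmetric] continuous_intros c\<tau> cva) auto
    also have "integral S (\<lambda>p. fst p * (625 * \<rho>\<^sup>2 * (\<tau> (Z p) * cmod2 (v a (Z p)))))
      = integral S (\<lambda>p. (- (625 * \<rho>\<^sup>2 * pi)) * L a p)"
      by (intro integral_cong) (simp add: L_def m_def algebra_simps)
    also have "\<dots> = - (625 * \<rho>\<^sup>2 * pi) * integral S (L a)" by (rule integral_mult_right)
    finally have "ennreal (pi * \<rho>\<^sup>2 * \<tau> a) \<le> ennreal (2 powr \<sigma>) * ennreal (- (625 * \<rho>\<^sup>2 * pi) * integral S (L a))"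
      by (simp add: mult_left_mono)
    also have "\<dots> = ennreal (pi * \<rho>\<^sup>2 * (- (625 * 2 powr \<sigma> * integral S (L a))))"
      by (simp add: ennreal_mult'[symmetric] algebra_simps)
    finally have E: "ennreal (pi * \<rho>\<^sup>2 * \<tau> a) \<le> ennreal (pi * \<rho>\<^sup>2 * (- (625 * 2 powr \<sigma> * integral S (L a))))" .
    \<comment> \<open>The sign is needed to leave \<open>ennreal\<close>, where a negative bound
      would have been rounded up to 0.\<close>
    have "0 \<le> - integral S (L a)"
    proof -
      have "0 \<le> integral S (\<lambda>p. - L a p)"
        using m0 by (intro integral_nonneg integrable_neg iLS[OF a]) (auto simp: L_def)
      then show ?thesis by simp
    qed
    then have "0 \<le> pi * \<rho>\<^sup>2 * (- (625 * 2 powr \<sigma> * integral S (L a)))"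
      by (intro mult_nonneg_nonneg) (auto simp: mult_nonneg_nonpos)
    then have "pi * \<rho>\<^sup>2 * \<tau> a \<le> pi * \<rho>\<^sup>2 * (- (625 * 2 powr \<sigma> * integral S (L a)))"
      using E by (simp only: ennreal_le_iff)
    then have "\<tau> a \<le> - (625 * 2 powr \<sigma> * integral S (L a))"
      by (rule mult_left_le_imp_le) (use \<rho> in auto)
    then show "cmod2 (g a) powr \<sigma> * cmod2 (deriv g a) \<le> - (625 * 2 powr \<sigma> * integral S (L a))"
      unfolding \<tau>_def .
  qed
qed

text \<open>F - A exp (- \<psi>) V is superharmonic up to radius \<open>r\<close> when A = 3 * 625 *
  2^\<sigma>, where 3 bounds exp \<psi> for \<psi> <= 1. The potential depends on \<open>r\<close>,
  but this constant does not.\<close>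

lemma hardy_carleson:
  assumes g: "g holomorphic_on unit_disc" and s: "0 < \<sigma>" and r: "0 \<le> r" "r < 1"
    and bmo: "\<And>a. a \<in> unit_disc \<Longrightarrow> (\<integral>\<^sup>+z. indicator unit_disc z * ennreal (1 - cmod2 (disc_auto a z)) *
      ennreal (cmod2 (g z) powr \<sigma> * cmod2 (deriv g z)) \<partial>lborel) \<le> ennreal pi"
  shows "disc_mean.carleson (circle_mean r) (\<lambda>z. cmod2 (g z) powr \<sigma> * cmod2 (deriv g z)) (1875 * 2 powr \<sigma>)"
proof -
  interpret disc_mean "circle_mean r" by (rule disc_mean_circle_mean[OF r])
  obtain \<psi> d0 K0 where psi: "c2 unit_disc \<psi> d0 K0"
    "\<And>a. a \<in> unit_disc \<Longrightarrow> 0 \<le> \<psi> a" "\<And>a. a \<in> unit_disc \<Longrightarrow> \<psi> a \<le> 1"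
    "\<And>a. cmod a \<le> r \<Longrightarrow> cmod2 (g a) powr \<sigma> * cmod2 (deriv g a) \<le> - (625 * 2 powr \<sigma> * K0 a)"
    using bmo_potential[OF g s r bmo] by blast
  show ?thesis
    unfolding carleson_def
  proof (intro allI impI)
    fix F d L V e K
    assume F: "c2 unit_disc F d L" and V: "log_sub unit_disc V e K" "\<forall>z\<in>unit_disc. 0 < V z"
      and L: "\<forall>z\<in>unit_disc. L z \<le> V z * (cmod2 (g z) powr \<sigma> * cmod2 (deriv g z))"
    obtain d' L' where G: "c2 unit_disc (\<lambda>z. exp (- \<psi> z) * V z) d' L'"
      and L': "\<And>z. z \<in> unit_disc \<Longrightarrow> - (exp (- \<psi> z) * V z * K0 z) \<le> L' z"
      using c2_exp_mult[OF V(1) psi(1)] by blast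
    define A where "A = 1875 * 2 powr \<sigma>"
    have A: "0 < A" by (simp add: A_def)
    have "circle_mean r (\<lambda>z. F z - A * (exp (- \<psi> z) * V z)) \<le> F 0 - A * (exp (- \<psi> 0) * V 0)"
    proof (rule circle_mean_superharmonic[OF c2_diff[OF F c2_cmult[OF G]] r])
      fix z assume zr: "cmod z \<le> r"
      then have z: "z \<in> unit_disc" using r by simp
      define T where "T = cmod2 (g z) powr \<sigma> * cmod2 (deriv g z)"
      have T: "0 \<le> T" "T \<le> - (625 * 2 powr \<sigma> * K0 z)" using psi(4)[OF zr] by (auto simp: T_def)
      define E where "E = exp (- \<psi> z)"
      have E: "1 \<le> 3 * E"
      proof -
        have "exp (\<psi> z) \<le> exp 1" using psi(3)[OF z] by simp
        also have "\<dots> \<le> (3::real)" using exp_le by simp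
        finally show ?thesis by (simp add: E_def exp_minus field_simps)
      qed
      have Vz: "0 < V z" using V z by auto
      have "L z \<le> V z * T * 1" using L z by (simp add: T_def)
      also have "\<dots> \<le> V z * T * (3 * E)" using E Vz T by (intro mult_left_mono) auto
      also have "\<dots> = 3 * E * V z * T" by simp
      also have "\<dots> \<le> 3 * E * V z * (- (625 * 2 powr \<sigma> * K0 z))"
        using T Vz by (intro mult_left_mono) (auto simp: E_def)
      also have "\<dots> = A * - (E * V z * K0 z)" by (simp add: A_def)
      also have "\<dots> \<le> A * L' z" using L'[OF z] A unfolding E_def by (intro mult_left_mono) auto
      finally show "L z - A * L' z \<le> 0" by simp
    qed
    moreover have "circle_mean r (\<lambda>z. F z - A * (exp (- \<psi> z) * V z)) = circle_mean r F - A * circle_mean r (\<lambda>z. exp (- \<psi> z) * V z)"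
      using add[OF c2_continuous(1)[OF F] c2_continuous(1)[OF c2_cmult[OF G, of "-A"]]]
        cmult[OF c2_continuous(1)[OF G], of "-A"] by simp
    moreover have "circle_mean r (\<lambda>z. exp (- \<psi> z) * V z) \<le> circle_mean r V"
    proof (rule mono[OF c2_continuous(1)[OF G] c2_continuous(1)[OF log_sub_c2[OF V(1)]]])
      fix z assume z: "z \<in> unit_disc"
      have "exp (- \<psi> z) * V z \<le> 1 * V z"
        using V(2) z psi(2)[OF z] by (intro mult_right_mono) (auto intro: less_imp_le)
      then show "exp (- \<psi> z) * V z \<le> V z" by simp
    qed
    then have "A * circle_mean r (\<lambda>z. exp (- \<psi> z) * V z) \<le> A * circle_mean r V" using A by (intro mult_left_mono) auto
    moreover have "0 \<le> A * (exp (- \<psi> 0) * V 0)" using A V(2) by (auto intro: less_imp_le)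
    ultimately show "circle_mean r F \<le> circle_mean r (\<lambda>_. 1) * F 0 + 1875 * 2 powr \<sigma> * circle_mean r V"
      unfolding A_def[symmetric] circle_mean_const by linarith
  qed
qed

section \<open>Iterated paraproducts\<close>

lemma power2_powr:
  fixes x :: real
  assumes "0 \<le> x"
  shows "(x\<^sup>2) powr q = x powr (2 * q)"
  using assms powr_powr[of x 2 q] by (cases "x = 0") auto

lemma Limsup_ge_along:
  fixes f :: "'a \<Rightarrow> ennreal"
  assumes lim: "filterlim \<gamma> F G" and f: "((\<lambda>t. f (\<gamma> t)) \<longlongrightarrow> l) G" and G: "G \<noteq> bot"
  shows "l \<le> Limsup F f"
  unfolding Limsup_def
proof (rule INF_greatest)
  fix P assume "P \<in> {P. eventually P F}"
  then have "eventually (\<lambda>t. P (\<gamma> t)) G" using lim by (auto simp: filterlim_iff)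
  then have "eventually (\<lambda>t. f (\<gamma> t) \<le> (SUP x\<in>Collect P. f x)) G"
    by eventually_elim (auto intro: SUP_upper)
  then show "l \<le> (SUP x\<in>Collect P. f x)"
    by (rule tendsto_upperbound[OF f _ G])
qed

text \<open>The Carleson condition needs only this direction. The limsup is bounded below along the
  ray of steepest ascent, whose direction \<open>c\<close> makes the derivative of the modulus equal
  to its full size; where g or g' vanishes the left side is 0.\<close>

lemma grad_abs_powr_ge:
  assumes g: "g holomorphic_on unit_disc" and z: "z \<in> unit_disc" and s: "1 < s"
  shows "ennreal (s * (cmod (g z) powr (s - 1) * cmod (deriv g z))) \<le> grad_abs (\<lambda>w. cmod (g w) powr s) z"
proof (cases "g z = 0 \<or> deriv g z = 0")
  case True
  then show ?thesis by auto
next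
  case False
  define e where "e = cnj (g z) * deriv g z"
  define c where "c = cnj e / of_real (cmod e)"
  have e0: "0 < cmod e" using False by (simp add: e_def)
  have c: "cmod c = 1" using e0 by (simp add: c_def norm_divide)
  have ec: "e * c = of_real (cmod e)"
  proof -
    have "e * c = of_real (cmod2 e) / of_real (cmod e)"
      unfolding complex_norm_square by (simp add: c_def)
    then show ?thesis using e0 by (simp add: power2_eq_square)
  qed
  have hg: "deriv g holomorphic_on unit_disc" by (intro holomorphic_deriv g) simp
  define A where "A = s * (cmod (g z) powr (s - 1) * cmod (deriv g z))"
  have A0: "0 \<le> A" using s by (simp add: A_def)
  define \<psi> where "\<psi> = (\<lambda>w. cmod (g w) powr s)"
  have D1: "((\<lambda>w. cmod2 (g w)) has_derivative (\<lambda>h. 2 * Re (e * h))) (at z)"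
    unfolding e_def
    by (rule cmod2_derivatives(1)[OF holomorphic_derivI[OF g open_ball z] holomorphic_derivI[OF hg open_ball z]])
  have psi: "\<psi> = (\<lambda>w. (cmod2 (g w)) powr (s / 2))"
    by (simp add: \<psi>_def power2_powr)
  have D2: "((\<lambda>x. x powr (s / 2)) has_derivative (\<lambda>h. h * (s / 2 * (cmod2 (g z)) powr (s / 2 - 1)))) (at (cmod2 (g z)))"
    by (rule has_derivative_eq_rhs[OF has_real_derivative_powr[unfolded has_field_derivative_def]])
      (use False in \<open>auto simp: fun_eq_iff\<close>)
  have D: "(\<psi> has_derivative (\<lambda>h. 2 * Re (e * h) * (s / 2 * (cmod2 (g z)) powr (s / 2 - 1)))) (at z)"
    unfolding psi using has_derivative_compose[OF D1 D2] .
  have line: "((\<lambda>t. z + of_real t * c) has_derivative (\<lambda>h. of_real h * c)) (at (0::real))"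
    by (auto intro!: derivative_eq_intros)
  have "((\<lambda>t. \<psi> (z + of_real t * c)) has_derivative
     (\<lambda>h. 2 * Re (e * (of_real h * c)) * (s / 2 * (cmod2 (g z)) powr (s / 2 - 1)))) (at (0::real))"
    by (rule has_derivative_compose[OF line]) (use D in simp)
  moreover have "2 * Re (e * (of_real h * c)) * (s / 2 * (cmod2 (g z)) powr (s / 2 - 1)) = A * h" for h
  proof -
    have "e * (of_real h * c) = of_real (h * cmod e)" using ec by (simp add: algebra_simps)
    then have 1: "2 * Re (e * (of_real h * c)) = 2 * (h * cmod e)" by (simp only: Re_complex_of_real)
    have 2: "(cmod2 (g z)) powr (s / 2 - 1) = cmod (g z) powr (s - 2)"
      by (simp add: power2_powr algebra_simps)
    have 3: "cmod (g z) powr (s - 1) = cmod (g z) powr (s - 2) * cmod (g z)"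
      using False powr_add[of "cmod (g z)" "s - 2" 1] by simp
    show ?thesis unfolding 1 2 A_def 3 by (simp add: e_def norm_mult)
  qed
  ultimately have "((\<lambda>t. \<psi> (z + of_real t * c)) has_field_derivative A) (at (0::real))"
    by (simp add: has_field_derivative_def)
  then have "((\<lambda>t. (\<psi> (z + of_real t * c) - \<psi> z) / t) \<longlongrightarrow> A) (at 0)"
    by (simp add: DERIV_def)
  then have "((\<lambda>t. (\<psi> (z + of_real t * c) - \<psi> z) / t) \<longlongrightarrow> A) (at_right 0)"
    by (rule filterlim_mono[OF _ order.refl]) (simp add: at_le)
  then have "((\<lambda>t. ennreal \<bar>(\<psi> (z + of_real t * c) - \<psi> z) / t\<bar>) \<longlongrightarrow> ennreal \<bar>A\<bar>) (at_right 0)"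
    by (intro tendsto_ennrealI tendsto_rabs)
  then have lim: "((\<lambda>t. ennreal (\<bar>\<psi> (z + of_real t * c) - \<psi> z\<bar> / cmod ((z + of_real t * c) - z))) \<longlongrightarrow> ennreal A) (at_right 0)"
    using A0 by (simp add: abs_divide norm_mult c)
  show ?thesis
    unfolding grad_abs_def A_def[symmetric]
  proof (rule Limsup_ge_along[where \<gamma> = "\<lambda>t. z + of_real t * c", OF _ lim[unfolded \<psi>_def]])
    have "((\<lambda>t. z + of_real t * c) \<longlongrightarrow> z + of_real 0 * c) (at_right (0::real))"
      by (intro tendsto_intros)
    moreover have "eventually (\<lambda>t. z + of_real t * c \<noteq> z) (at_right (0::real))"
      using c by (auto simp: eventually_at_filter intro!: always_eventually)
    ultimately show "filterlim (\<lambda>t. z + of_real t * c) (at z) (at_right (0::real))"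
      by (simp add: filterlim_at)
  qed simp
qed

lemma enn_root_leD:
  assumes "enn_root q x \<le> ennreal c" "0 < q" "0 \<le> c"
  shows "x \<le> ennreal (c powr q)"
proof (cases x)
  case (real y)
  then have "y powr (1 / q) \<le> c" using assms by (simp add: enn_root_def ennreal_le_iff)
  then have "(y powr (1 / q)) powr q \<le> c powr q" using assms by (intro powr_mono2) auto
  then show ?thesis using real assms by (simp add: powr_powr ennreal_leI)
next
  case top
  then show ?thesis using assms by (simp add: enn_root_def top_unique)
qed

lemma enn_root_leI:
  assumes "x \<le> ennreal c" "0 < q" "0 \<le> c"
  shows "enn_root q x \<le> ennreal (c powr (1 / q))"
proof (cases x)
  case (real y)
  then have "y powr (1 / q) \<le> c powr (1 / q)" using assms by (intro powr_mono2) (auto simp: ennreal_le_iff)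
  then show ?thesis using real by (simp add: enn_root_def ennreal_leI)
next
  case top
  then show ?thesis using assms by (simp add: top_unique)
qed

section \<open>The operators and their iterates as primitives\<close>

lemma contour_integral_linepath_primitive:
  assumes F: "F holomorphic_on unit_disc"
  defines "I \<equiv> \<lambda>z. contour_integral (linepath 0 z) F"
  shows "\<And>z. z \<in> unit_disc \<Longrightarrow> (I has_field_derivative F z) (at z)" "I 0 = 0"
proof -
  obtain P where P: "\<And>z. z \<in> unit_disc \<Longrightarrow> (P has_field_derivative F z) (at z within unit_disc)"
    using holomorphic_convex_primitive'[OF convex_ball open_ball F] by blast
  have I: "I z = P z - P 0" if z: "z \<in> unit_disc" for z
  proof -
    have "closed_segment 0 z \<subseteq> unit_disc" using z by (intro closed_segment_subset) auto
    then have "(F has_contour_integral P (pathfinish (linepath 0 z)) - P (pathstart (linepath 0 z))) (linepath 0 z)"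
      by (intro contour_integral_primitive[OF P]) auto
    then show ?thesis unfolding I_def by (auto dest: contour_integral_unique)
  qed
  show "(I has_field_derivative F z) (at z)" if z: "z \<in> unit_disc" for z
  proof (rule has_field_derivative_transform_within_open[where S = unit_disc])
    show "((\<lambda>z. P z - P 0) has_field_derivative F z) (at z)"
      using P[OF z] z by (auto intro!: derivative_eq_intros simp: at_within_open[OF z open_ball])
  qed (use z I in auto)
  show "I 0 = 0" using I[of 0] by simp
qed

lemma T_op_props:
  assumes "g holomorphic_on unit_disc" "f holomorphic_on unit_disc"
  shows "T_op g f holomorphic_on unit_disc" "T_op g f 0 = 0"
    "\<And>z. z \<in> unit_disc \<Longrightarrow> deriv (T_op g f) z = f z * deriv g z"
proof -
  have "(\<lambda>w. f w * deriv g w) holomorphic_on unit_disc"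
    using assms by (intro holomorphic_intros) auto
  note * = contour_integral_linepath_primitive[OF this, folded T_op_def]
  show "T_op g f 0 = 0" by (simp add: T_op_def)
  show "T_op g f holomorphic_on unit_disc"
    using *(1) unfolding holomorphic_on_open[OF open_ball] by blast
  show "\<And>z. z \<in> unit_disc \<Longrightarrow> deriv (T_op g f) z = f z * deriv g z"
    using *(1) by (rule DERIV_imp_deriv)
qed

lemma S_op_props:
  assumes "g holomorphic_on unit_disc" "f holomorphic_on unit_disc"
  shows "S_op g f holomorphic_on unit_disc" "S_op g f 0 = 0"
    "\<And>z. z \<in> unit_disc \<Longrightarrow> deriv (S_op g f) z = deriv f z * g z"
proof -
  have "(\<lambda>w. deriv f w * g w) holomorphic_on unit_disc"
    using assms by (intro holomorphic_intros) auto
  note * = contour_integral_linepath_primitive[OF this, folded S_op_def]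
  show "S_op g f 0 = 0" by (simp add: S_op_def)
  show "S_op g f holomorphic_on unit_disc"
    using *(1) unfolding holomorphic_on_open[OF open_ball] by blast
  show "\<And>z. z \<in> unit_disc \<Longrightarrow> deriv (S_op g f) z = deriv f z * g z"
    using *(1) by (rule DERIV_imp_deriv)
qed

lemma T_op_iterate:
  assumes "g holomorphic_on unit_disc" "f holomorphic_on unit_disc"
  shows "(T_op g ^^ k) f holomorphic_on unit_disc"
  by (induction k) (auto intro: T_op_props(1) assms)

text \<open>Each \<open>S_op\<close> multiplies the derivative by \<open>g\<close>, so m of them act
  like a single integration. The assumption f 0 = 0 settles k = 0; further iterates vanish at 0 by
  construction.\<close>

lemma S_op_iterate:
  assumes g: "g holomorphic_on unit_disc" and f: "f holomorphic_on unit_disc" and f0: "f 0 = 0"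
  shows "(S_op g ^^ k) f holomorphic_on unit_disc" "(S_op g ^^ k) f 0 = 0"
    "z \<in> unit_disc \<Longrightarrow> deriv ((S_op g ^^ k) f) z = deriv f z * g z ^ k"
proof -
  show hol: "(S_op g ^^ k) f holomorphic_on unit_disc" for k
    by (induction k) (auto intro: S_op_props(1) g f)
  show "(S_op g ^^ k) f 0 = 0"
    by (cases k) (auto simp: f0 S_op_props(2)[OF g hol])
  show "deriv ((S_op g ^^ k) f) z = deriv f z * g z ^ k" if z: "z \<in> unit_disc"
    by (induction k) (auto simp: S_op_props(3)[OF g hol z])
qed

text \<open>The factor \<delta> by which the normalized symbol is shrunk. It has the form 1 / (1 + M
  \<kappa>1), with \<kappa>1 the constant from \<open>carleson_regularized\<close>, so that \<delta>
  <= 1 and \<delta>^2 M \<kappa>1 <= 1, the smallness required by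
  \<open>paraproduct_chain\<close>.\<close>

definition chain_scale :: "real \<Rightarrow> real \<Rightarrow> nat \<Rightarrow> real \<Rightarrow> real" where
  "chain_scale \<sigma> \<kappa> m q = 1 / (1 + 4 * (1 + q\<^sup>2) * (2 + 2 * (real m)\<^sup>2 + real m) *
     (21 * 2 powr \<sigma> + (3 powr \<sigma> + 21 * 2 powr \<sigma> * 2 powr \<sigma>) * \<kappa>))"

text \<open>One factor per step of the chain; the denominator undoes the shrinking, since the
  operator is homogeneous of degree m + n in the symbol. Writing it out shows that neither the
  symbol nor the radius enters.\<close>

definition chain_const :: "real \<Rightarrow> real \<Rightarrow> nat \<Rightarrow> nat \<Rightarrow> real \<Rightarrow> real" where
  "chain_const \<sigma> \<kappa> m n q = (2 powr q * (2 / q + 1)) ^ n / chain_scale \<sigma> \<kappa> m q powr (2 * q * real (m + n))"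

lemma chain_scale_pos: "0 \<le> \<kappa> \<Longrightarrow> 0 < chain_scale \<sigma> \<kappa> m q"
  unfolding chain_scale_def
  by (intro divide_pos_pos add_pos_nonneg mult_nonneg_nonneg add_nonneg_nonneg) auto

lemma chain_const_pos: "0 \<le> \<kappa> \<Longrightarrow> 0 < q \<Longrightarrow> 0 < chain_const \<sigma> \<kappa> m n q"
  unfolding chain_const_def
  using chain_scale_pos[of \<kappa> \<sigma> m q] by (intro divide_pos_pos zero_less_power mult_pos_pos add_pos_pos) auto

lemma (in disc_mean) iterated_paraproduct_bound:
  assumes g: "g holomorphic_on unit_disc" and f: "f holomorphic_on unit_disc"
    and s: "0 \<le> \<sigma>" "real m = real n * \<sigma>" and n: "1 \<le> n" and q: "0 < q" and k: "0 \<le> \<kappa>" and Q: "0 < Q"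
    and C: "carleson (\<lambda>z. cmod2 (g z / of_real Q) powr \<sigma> * cmod2 (deriv g z / of_real Q)) \<kappa>"
  shows "N (\<lambda>z. (cmod ((S_op g ^^ m) ((T_op g ^^ n) f) z)) powr (2 * q)) \<le>
    chain_const \<sigma> \<kappa> m n q * Q powr (2 * q * real (m + n)) * N (\<lambda>z. cmod (f z) powr (2 * q))"
proof -
  obtain n' where n': "n = Suc n'" using n by (cases n) auto
  define \<kappa>1 where "\<kappa>1 = 21 * 2 powr \<sigma> + (3 powr \<sigma> + 21 * 2 powr \<sigma> * 2 powr \<sigma>) * \<kappa>"
  define M where "M = 4 * (1 + q\<^sup>2) * (2 + 2 * (real m)\<^sup>2 + real m)"
  define \<delta> where "\<delta> = chain_scale \<sigma> \<kappa> m q"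
  have \<kappa>1: "0 \<le> \<kappa>1" unfolding \<kappa>1_def using k by (intro add_nonneg_nonneg mult_nonneg_nonneg) auto
  have M: "0 \<le> M" unfolding M_def by (intro mult_nonneg_nonneg add_nonneg_nonneg) auto
  have MK: "0 \<le> M * \<kappa>1" using M \<kappa>1 by simp
  have \<delta>: "0 < \<delta>" "\<delta> \<le> 1" "M * (\<delta>\<^sup>2 * \<kappa>1) \<le> 1"
  proof -
    show d0: "0 < \<delta>" unfolding \<delta>_def by (rule chain_scale_pos[OF k])
    have d: "\<delta> = 1 / (1 + M * \<kappa>1)"
      unfolding \<delta>_def chain_scale_def M_def \<kappa>1_def ..
    then have \<delta>': "\<delta> * (1 + M * \<kappa>1) = 1" "\<delta> = 1 / (1 + M * \<kappa>1)"
      using MK by auto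
    show d1: "\<delta> \<le> 1" unfolding \<delta>'(2) using MK by simp
    have "\<delta> * (\<delta> * (M * \<kappa>1)) \<le> 1 * (\<delta> * (M * \<kappa>1))" using d0 d1 MK by (intro mult_right_mono) auto
    also have "\<dots> \<le> 1" using \<delta>'(1) d0 by (simp add: algebra_simps)
    finally show "M * (\<delta>\<^sup>2 * \<kappa>1) \<le> 1" by (simp add: power2_eq_square algebra_simps)
  qed
  define G where "G = (\<lambda>z. g z / of_real Q)"
  have G: "G holomorphic_on unit_disc" unfolding G_def using Q by (intro holomorphic_intros g) auto
  have dG: "deriv G z = deriv g z / of_real Q" if "z \<in> unit_disc" for z
    unfolding G_def using holomorphic_on_imp_differentiable_at[OF g open_ball that] by (simp add: deriv_cdivide_right)
  have C0: "carleson (\<lambda>z. cmod2 (G z) powr \<sigma> * cmod2 (deriv G z)) \<kappa>"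
    using carleson_scale[OF C zero_less_one, of "\<lambda>z. cmod2 (G z) powr \<sigma> * cmod2 (deriv G z)"]
    by (simp add: dG) (simp add: G_def)
  have C1: "carleson (\<lambda>z. (1 + cmod2 (G z)) powr \<sigma> * cmod2 (deriv G z)) \<kappa>1"
    unfolding \<kappa>1_def by (rule carleson_regularized[OF G s(1) k C0])
  \<comment> \<open>Dividing by \<open>Q\<close> normalizes the symbol, and the factor
    \<open>\<delta>\<close> makes its Carleson constant small.\<close>
  define \<mu> where "\<mu> = \<delta> / Q"
  have \<mu>: "0 < \<mu>" using \<delta> Q by (simp add: \<mu>_def)
  define g' where "g' = (\<lambda>z. of_real \<mu> * g z)"
  have g': "g' holomorphic_on unit_disc" unfolding g'_def by (intro holomorphic_intros g)
  have dg': "deriv g' z = of_real \<mu> * deriv g z" if "z \<in> unit_disc" for z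
    unfolding g'_def using holomorphic_on_imp_differentiable_at[OF g open_ball that] by simp
  \<comment> \<open>Shrinking comes after regularizing: 1 + |\<delta> G|^2 <= 1 + |G|^2, so exactly
    the factor \<delta>^2 is gained, from the derivative.\<close>
  have C2: "carleson (\<lambda>z. (1 + cmod2 (g' z)) powr \<sigma> * cmod2 (deriv g' z)) (\<delta>\<^sup>2 * \<kappa>1)"
  proof (rule carleson_scale[OF C1])
    fix z assume z: "z \<in> unit_disc"
    have e: "cmod (g' z) = \<delta> * cmod (G z)" "cmod (deriv g' z) = \<delta> * cmod (deriv G z)"
      unfolding dg'[OF z] dG[OF z] using \<delta> Q by (simp_all add: g'_def G_def \<mu>_def norm_mult norm_divide)
    have "(1 + cmod2 (g' z)) powr \<sigma> \<le> (1 + cmod2 (G z)) powr \<sigma>"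
      using s \<delta> unfolding e power_mult_distrib
      by (intro powr_mono2 add_left_mono mult_left_le_one_le) (auto simp: abs_square_le_1)
    then have "(1 + cmod2 (g' z)) powr \<sigma> * cmod2 (deriv g' z) \<le> (1 + cmod2 (G z)) powr \<sigma> * cmod2 (deriv g' z)"
      by (intro mult_right_mono) auto
    then show "(1 + cmod2 (g' z)) powr \<sigma> * cmod2 (deriv g' z) \<le> \<delta>\<^sup>2 * ((1 + cmod2 (G z)) powr \<sigma> * cmod2 (deriv G z))"
      by (simp add: e(2) power_mult_distrib algebra_simps)
  qed (use \<delta> in simp)
  \<comment> \<open>\<open>T_op\<close> and \<open>S_op\<close> are linear in the symbol, so these
    multiples are the iterates belonging to the symbol g'.\<close>
  define h where "h = (\<lambda>k z. of_real (\<mu> ^ k) * (T_op g ^^ k) f z)"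
  define v where "v = (S_op g ^^ m) ((T_op g ^^ n) f)"
  define u where "u = (\<lambda>z. of_real (\<mu> ^ (m + n)) * v z)"
  note Thol = T_op_iterate[OF g f]
  have T0: "(T_op g ^^ Suc k) f 0 = 0" for k by (simp add: T_op_props(2)[OF g Thol])
  have dT: "deriv ((T_op g ^^ Suc k) f) z = (T_op g ^^ k) f z * deriv g z" if "z \<in> unit_disc" for k z
    by (simp add: T_op_props(3)[OF g Thol that])
  have v: "v holomorphic_on unit_disc" "v 0 = 0"
    unfolding v_def using S_op_iterate(1,2)[OF g Thol] T0 by (auto simp: n' simp del: funpow.simps)
  have dv: "deriv v z = (T_op g ^^ n') f z * deriv g z * g z ^ m" if z: "z \<in> unit_disc" for z
    unfolding v_def n' S_op_iterate(3)[OF g Thol T0 z] dT[OF z] ..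
  have hol_deriv: "deriv (\<lambda>z. c * F z) z = c * deriv F z" if "F holomorphic_on unit_disc" "z \<in> unit_disc" for F c z
    using holomorphic_on_imp_differentiable_at[OF that(1) open_ball that(2)] by simp
  have "N (\<lambda>z. cmod2 (u z) powr q) \<le> (2 powr q * (2 / q + 1)) ^ Suc n' * N (\<lambda>z. cmod2 (h 0 z) powr q)"
  proof (rule paraproduct_chain[OF g' _ _ _ _ _ _ s(1) _ q _ C2])
    show "h k holomorphic_on unit_disc" for k unfolding h_def by (intro holomorphic_intros Thol)
    show "u holomorphic_on unit_disc" unfolding u_def by (intro holomorphic_intros v)
    show "h (Suc k) 0 = 0" for k unfolding h_def T0 by simp
    show "u 0 = 0" by (simp add: u_def v)
    show "deriv (h (Suc k)) z = h k z * deriv g' z" if z: "z \<in> unit_disc" for k z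
      unfolding h_def hol_deriv[OF Thol z] dT[OF z] dg'[OF z] by simp
    show "deriv u z = g' z ^ m * deriv g' z * h n' z" if z: "z \<in> unit_disc" for z
      unfolding u_def hol_deriv[OF v(1) z] dv[OF z] dg'[OF z] h_def
      by (simp add: g'_def n' power_add power_mult_distrib)
    show "real m = real (Suc n') * \<sigma>" using s(2) by (simp add: n')
    show "0 \<le> \<delta>\<^sup>2 * \<kappa>1" using \<kappa>1 by simp
    show "4 * (1 + q\<^sup>2) * (2 + 2 * (real m)\<^sup>2 + real m) * (\<delta>\<^sup>2 * \<kappa>1) \<le> 1"
      using \<delta>(3) unfolding M_def .
  qed
  then have "N (\<lambda>z. cmod (u z) powr (2 * q)) \<le> (2 powr q * (2 / q + 1)) ^ n * N (\<lambda>z. cmod (f z) powr (2 * q))"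
    by (simp add: power2_powr n' h_def)
  moreover have "N (\<lambda>z. cmod (u z) powr (2 * q)) = \<mu> powr (2 * q * real (m + n)) * N (\<lambda>z. cmod (v z) powr (2 * q))"
  proof -
    have "cmod (u z) powr (2 * q) = \<mu> powr (2 * q * real (m + n)) * cmod (v z) powr (2 * q)" for z
    proof -
      have "cmod (u z) = \<mu> powr real (m + n) * cmod (v z)"
        using \<mu> by (simp add: u_def norm_mult norm_power powr_realpow[symmetric] del: of_nat_add)
      then show ?thesis by (simp add: powr_mult powr_powr mult.commute)
    qed
    moreover have "continuous_on unit_disc (\<lambda>z. cmod (v z) powr (2 * q))"
      using q holomorphic_on_imp_continuous_on[OF v(1)] by (auto intro!: continuous_on_weight_intros)
    ultimately show ?thesis by (simp add: cmult)
  qed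
  moreover have "\<mu> powr (2 * q * real (m + n)) = \<delta> powr (2 * q * real (m + n)) / Q powr (2 * q * real (m + n))"
    using \<delta> Q by (simp add: \<mu>_def powr_divide)
  moreover have "0 < \<delta> powr (2 * q * real (m + n))" "0 < Q powr (2 * q * real (m + n))" using \<delta> Q by auto
  ultimately show ?thesis
    unfolding chain_const_def \<delta>_def[symmetric] v_def[symmetric] by (simp add: field_simps)
qed

section \<open>From the norm of g to the Carleson hypotheses\<close>

lemma bloch_normalized:
  assumes g: "g holomorphic_on unit_disc" and s: "1 < s" and Q: "0 < Q"
    and b: "bloch_q_norm s g \<le> ennreal Q" and z: "z \<in> unit_disc"
  shows "(1 - cmod2 z)\<^sup>2 * (cmod2 (g z / of_real Q) powr (s - 1) * cmod2 (deriv g z / of_real Q)) \<le> 1"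
proof -
  have t: "0 < 1 - cmod2 z" using z by (simp add: abs_square_less_1)
  define X where "X = cmod (g z) powr (s - 1) * cmod (deriv g z)"
  have X: "0 \<le> X" by (simp add: X_def)
  have "ennreal ((1 - cmod2 z) * (s * X)) = ennreal (1 - cmod2 z) * ennreal (s * X)"
    using t by (simp add: ennreal_mult')
  also have "\<dots> \<le> ennreal (1 - cmod2 z) * grad_abs (\<lambda>w. cmod (g w) powr s) z"
    unfolding X_def by (intro mult_left_mono grad_abs_powr_ge[OF g z s]) simp
  also have "\<dots> \<le> (SUP z\<in>unit_disc. ennreal (1 - cmod2 z) * grad_abs (\<lambda>w. cmod (g w) powr s) z)"
    by (rule SUP_upper[OF z])
  also have "\<dots> \<le> ennreal (Q powr s)"
    using enn_root_leD[OF b[unfolded bloch_q_norm_def]] s Q by auto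
  finally have "(1 - cmod2 z) * (s * X) \<le> Q powr s"
    by (simp add: ennreal_le_iff)
  \<comment> \<open>The factor \<open>s\<close> > 1 produced by the gradient is given away.\<close>
  moreover have "(1 - cmod2 z) * X * 1 \<le> (1 - cmod2 z) * X * s" using t X s by (intro mult_left_mono) auto
  ultimately have "(1 - cmod2 z) * X \<le> Q powr s" by (simp add: algebra_simps)
  then have "((1 - cmod2 z) * X)\<^sup>2 \<le> (Q powr s)\<^sup>2" using t X by (intro power_mono) auto
  moreover have "cmod2 (g z / of_real Q) powr (s - 1) * cmod2 (deriv g z / of_real Q) = X\<^sup>2 / (Q powr s)\<^sup>2"
  proof -
    have "(x\<^sup>2) powr (s - 1) = (x powr (s - 1))\<^sup>2" if "0 \<le> x" for x :: real
      using that by (simp add: power2_eq_square powr_mult)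
    moreover have "Q powr s = Q powr (s - 1) * Q" using Q powr_add[of Q "s - 1" 1] by simp
    ultimately show ?thesis using Q
      by (simp add: X_def norm_divide powr_divide power_divide power_mult_distrib)
  qed
  ultimately show ?thesis using Q by (simp add: power_mult_distrib)
qed

text \<open>The normalized density is Q^(-2 s) times (|g|^(s - 1) |g'|)^2, which is bounded by the
  squared gradient after giving away the factor s^2; the exponent 2 s matches the root in
  \<open>bmoa_q_norm\<close>.\<close>

lemma bmoa_normalized:
  assumes g: "g holomorphic_on unit_disc" and s: "1 < s" and Q: "0 < Q"
    and b: "bmoa_q_norm s g \<le> ennreal Q" and a: "a \<in> unit_disc"
  shows "(\<integral>\<^sup>+z. indicator unit_disc z * ennreal (1 - cmod2 (disc_auto a z)) *
      ennreal (cmod2 (g z / of_real Q) powr (s - 1) * cmod2 (deriv g z / of_real Q)) \<partial>lborel) \<le> ennreal pi"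
proof -
  define \<tau> where "\<tau> = (\<lambda>z. cmod2 (g z / of_real Q) powr (s - 1) * cmod2 (deriv g z / of_real Q))"
  define c where "c = Q powr (2 * s)"
  have c: "0 < c" using Q by (simp add: c_def)
  have le: "ennreal (c * \<tau> z) \<le> (grad_abs (\<lambda>w. cmod (g w) powr s) z)\<^sup>2" if z: "z \<in> unit_disc" for z
  proof -
    define X where "X = cmod (g z) powr (s - 1) * cmod (deriv g z)"
    have X: "0 \<le> X" by (simp add: X_def)
    have "c * \<tau> z = X\<^sup>2"
    proof -
      have "(x\<^sup>2) powr (s - 1) = (x powr (s - 1))\<^sup>2" if "0 \<le> x" for x :: real
        using that by (simp add: power2_eq_square powr_mult)
      moreover have "c = (Q powr (s - 1) * Q)\<^sup>2"
        using Q powr_add[of Q "s - 1" 1] powr_add[of Q s s] by (simp add: c_def power2_eq_square)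
      ultimately show ?thesis using Q
        by (simp add: X_def \<tau>_def norm_divide powr_divide power_divide power_mult_distrib)
    qed
    then have "ennreal (c * \<tau> z) = (ennreal X)\<^sup>2" using X by (simp add: ennreal_power)
    also have "\<dots> \<le> (ennreal (s * X))\<^sup>2"
      using X s mult_right_mono[of 1 s X] by (intro power_mono ennreal_leI) auto
    also have "\<dots> \<le> (grad_abs (\<lambda>w. cmod (g w) powr s) z)\<^sup>2"
      unfolding X_def by (intro power_mono grad_abs_powr_ge[OF g z s]) simp
    finally show ?thesis .
  qed
  have cg: "continuous_on unit_disc g" "continuous_on unit_disc (deriv g)"
    using g holomorphic_deriv[OF g] by (auto intro!: holomorphic_on_imp_continuous_on)
  have c\<tau>: "continuous_on unit_disc \<tau>"
    unfolding \<tau>_def using s Q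
    by (intro continuous_on_weight_intros continuous_on_divide cg) auto
  have ck: "continuous_on unit_disc (\<lambda>z. disc_auto a z)"
    unfolding disc_auto_def using disc_auto_denominator[of _ a] a by (intro continuous_intros) auto
  define k where "k = (\<lambda>z. 1 - cmod2 (disc_auto a z))"
  have ckk: "continuous_on unit_disc (\<lambda>z. k z * \<tau> z)" unfolding k_def by (intro continuous_intros ck c\<tau>)
  have k0: "0 \<le> k z" if "z \<in> unit_disc" for z
    using cmod_disc_auto_less_1[of a z] a that by (simp add: k_def abs_square_le_1)
  have "(\<lambda>z. ennreal (indicator unit_disc z *\<^sub>R (k z * \<tau> z))) \<in> borel_measurable borel"
    by (intro measurable_compose[OF borel_measurable_continuous_on_indicator measurable_ennreal] ckk) simp
  moreover have "ennreal (indicator unit_disc z *\<^sub>R (k z * \<tau> z)) = indicator unit_disc z * ennreal (k z) * ennreal (\<tau> z)" for z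
    using k0[of z] by (auto simp: indicator_def ennreal_mult')
  ultimately have m: "(\<lambda>z. indicator unit_disc z * ennreal (k z) * ennreal (\<tau> z)) \<in> borel_measurable lborel" by simp
  define I where "I = (\<integral>\<^sup>+z. indicator unit_disc z * ennreal (k z) * ennreal (\<tau> z) \<partial>lborel)"
  \<comment> \<open>The constant is moved on the side of the continuous density, so the comparison
    with \<open>grad_abs\<close> rests on monotonicity of the integral alone.\<close>
  have "ennreal c * I = (\<integral>\<^sup>+z. ennreal c * (indicator unit_disc z * ennreal (k z) * ennreal (\<tau> z)) \<partial>lborel)"
    unfolding I_def by (rule nn_integral_cmult[OF m, symmetric])
  also have "\<dots> \<le> (\<integral>\<^sup>+z. indicator unit_disc z * ennreal (k z) * (grad_abs (\<lambda>w. cmod (g w) powr s) z)\<^sup>2 \<partial>lborel)"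
  proof (intro nn_integral_mono)
    fix z
    show "ennreal c * (indicator unit_disc z * ennreal (k z) * ennreal (\<tau> z)) \<le>
      indicator unit_disc z * ennreal (k z) * (grad_abs (\<lambda>w. cmod (g w) powr s) z)\<^sup>2"
    proof (cases "z \<in> unit_disc")
      case True
      have "ennreal (k z) * ennreal (c * \<tau> z) \<le> ennreal (k z) * (grad_abs (\<lambda>w. cmod (g w) powr s) z)\<^sup>2"
        by (intro mult_left_mono le[OF True]) simp
      then show ?thesis using True c by (simp add: ennreal_mult' mult_ac)
    qed simp
  qed
  finally have "ennreal (1 / pi) * (ennreal c * I) \<le> ennreal (1 / pi) *
     (\<integral>\<^sup>+z. indicator unit_disc z * ennreal (k z) * (grad_abs (\<lambda>w. cmod (g w) powr s) z)\<^sup>2 \<partial>lborel)"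
    by (rule mult_left_mono) (rule zero_le)
  also have "\<dots> \<le> (SUP a\<in>unit_disc. ennreal (1 / pi) *
     (\<integral>\<^sup>+z. indicator unit_disc z * ennreal (1 - cmod2 (disc_auto a z)) * (grad_abs (\<lambda>w. cmod (g w) powr s) z)\<^sup>2 \<partial>lborel))"
    unfolding k_def by (rule SUP_upper[OF a])
  also have "\<dots> \<le> ennreal c"
    unfolding c_def using enn_root_leD[OF b[unfolded bmoa_q_norm_def]] s Q by auto
  finally have "ennreal (pi / c) * (ennreal (1 / pi) * (ennreal c * I)) \<le> ennreal (pi / c) * ennreal c"
    by (rule mult_left_mono) (rule zero_le)
  moreover have "ennreal (pi / c) * (ennreal (1 / pi) * (ennreal c * I)) = I"
    using c by (simp add: mult.assoc[symmetric] ennreal_mult'[symmetric])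
  moreover have "ennreal (pi / c) * ennreal c = ennreal pi"
    using c by (simp add: ennreal_mult'[symmetric])
  ultimately show ?thesis by (simp add: I_def k_def \<tau>_def)
qed

text \<open>\<open>Q\<close> is any positive upper bound for the norm of g rather than the norm
  itself, so that division by \<open>Q\<close> makes sense even when the norm is 0.\<close>

lemma Apnorm_paraproduct_bound:
  fixes \<alpha> p \<sigma> :: real
  assumes \<alpha>: "-1 \<le> \<alpha>" and p: "0 < p" and m: "1 \<le> m" and n: "1 \<le> n" and \<sigma>: "real m = real n * \<sigma>"
  shows "\<exists>C>0. \<forall>g f Q. g holomorphic_on unit_disc \<longrightarrow> f holomorphic_on unit_disc \<longrightarrow> Apnorm \<alpha> p f \<le> 1 \<longrightarrow>
     0 < Q \<longrightarrow> Bq_alpha_norm \<alpha> (\<sigma> + 1) g \<le> ennreal Q \<longrightarrow>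
     Apnorm \<alpha> p ((S_op g ^^ m) ((T_op g ^^ n) f)) \<le> ennreal (C * Q ^ (m + n))"
proof -
  have \<sigma>0: "0 < \<sigma>" using m n \<sigma> by (metis less_le_trans mult_le_0_iff not_less of_nat_0_le_iff of_nat_1 of_nat_mono zero_less_one)
  define \<kappa> where "\<kappa> = (if \<alpha> = -1 then 1875 * 2 powr \<sigma> else 1 + 2 / (\<alpha> + 1))"
  have \<kappa>: "0 \<le> \<kappa>" using \<alpha> by (auto simp: \<kappa>_def intro!: add_nonneg_nonneg)
  \<comment> \<open>The means are estimated for powers of squared moduli, hence half the
    exponent.\<close>
  define q where "q = p / 2"
  have q: "0 < q" "2 * q = p" using p by (auto simp: q_def)
  define B where "B = chain_const \<sigma> \<kappa> m n q"
  have B: "0 < B" unfolding B_def by (rule chain_const_pos[OF \<kappa> q(1)])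
  have "Apnorm \<alpha> p ((S_op g ^^ m) ((T_op g ^^ n) f)) \<le> ennreal (B powr (1 / p) * Q ^ (m + n))"
    if g: "g holomorphic_on unit_disc" and f: "f holomorphic_on unit_disc" and fn: "Apnorm \<alpha> p f \<le> 1"
      and Q: "0 < Q" and gn: "Bq_alpha_norm \<alpha> (\<sigma> + 1) g \<le> ennreal Q" for g f Q
  proof -
    define u where "u = (S_op g ^^ m) ((T_op g ^^ n) f)"
    define K where "K = B * Q powr (p * real (m + n))"
    have K: "0 \<le> K" using B by (simp add: K_def)
    have u: "u holomorphic_on unit_disc"
    proof -
      obtain n' where n': "n = Suc n'" using n by (cases n) auto
      have "(T_op g ^^ n) f 0 = 0" by (simp add: n' T_op_props(2)[OF g T_op_iterate[OF g f]])
      then show ?thesis unfolding u_def by (rule S_op_iterate(1)[OF g T_op_iterate[OF g f]])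
    qed
    have G: "(\<lambda>z. g z / of_real Q) holomorphic_on unit_disc" using Q by (intro holomorphic_intros g) auto
    have dG: "deriv (\<lambda>z. g z / of_real Q) z = deriv g z / of_real Q" if "z \<in> unit_disc" for z
      using holomorphic_on_imp_differentiable_at[OF g open_ball that] by (simp add: deriv_cdivide_right)
    have "(if \<alpha> = -1 then hardy_pow p f else bergman_pow \<alpha> p f) \<le> ennreal (1 powr p)"
      using fn p unfolding Apnorm_def by (intro enn_root_leD) auto
    then have f1: "(if \<alpha> = -1 then hardy_pow p f else bergman_pow \<alpha> p f) \<le> 1" by simp
    have "(if \<alpha> = -1 then hardy_pow p u else bergman_pow \<alpha> p u) \<le> ennreal K"
    proof (cases "\<alpha> = -1")
      case True
      have "ennreal (circle_mean r (\<lambda>z. cmod (u z) powr p)) \<le> ennreal K" if r: "r \<in> {0<..<1}" for r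
      proof -
        interpret disc_mean "circle_mean r" using r by (intro disc_mean_circle_mean) auto
        have "carleson (\<lambda>z. cmod2 (g z / of_real Q) powr \<sigma> * cmod2 (deriv (\<lambda>z. g z / of_real Q) z)) (1875 * 2 powr \<sigma>)"
        proof (rule hardy_carleson[OF G \<sigma>0])
          fix a :: complex assume a: "a \<in> unit_disc"
          have "(\<integral>\<^sup>+z. indicator unit_disc z * ennreal (1 - cmod2 (disc_auto a z)) *
            ennreal (cmod2 (g z / of_real Q) powr \<sigma> * cmod2 (deriv (\<lambda>z. g z / of_real Q) z)) \<partial>lborel)
            = (\<integral>\<^sup>+z. indicator unit_disc z * ennreal (1 - cmod2 (disc_auto a z)) *
            ennreal (cmod2 (g z / of_real Q) powr \<sigma> * cmod2 (deriv g z / of_real Q)) \<partial>lborel)"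
            by (intro nn_integral_cong) (auto simp: indicator_def dG)
          also have "\<dots> \<le> ennreal pi"
            using bmoa_normalized[OF g _ Q _ a, of "\<sigma> + 1"] gn True \<sigma>0 by (simp add: Bq_alpha_norm_def)
          finally show "(\<integral>\<^sup>+z. indicator unit_disc z * ennreal (1 - cmod2 (disc_auto a z)) *
            ennreal (cmod2 (g z / of_real Q) powr \<sigma> * cmod2 (deriv (\<lambda>z. g z / of_real Q) z)) \<partial>lborel) \<le> ennreal pi" .
        qed (use r in auto)
        from carleson_scale[OF this zero_less_one, of "\<lambda>z. cmod2 (g z / of_real Q) powr \<sigma> * cmod2 (deriv g z / of_real Q)"]
        have "carleson (\<lambda>z. cmod2 (g z / of_real Q) powr \<sigma> * cmod2 (deriv g z / of_real Q)) \<kappa>"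
          using True by (simp add: dG \<kappa>_def)
        from iterated_paraproduct_bound[OF g f less_imp_le[OF \<sigma>0] \<sigma> n q(1) \<kappa> Q this]
        have "circle_mean r (\<lambda>z. cmod (u z) powr p) \<le> K * circle_mean r (\<lambda>z. cmod (f z) powr p)"
          unfolding q(2) u_def[symmetric] B_def[symmetric] K_def[symmetric] .
        moreover have "ennreal (circle_mean r (\<lambda>z. cmod (f z) powr p)) \<le> ennreal 1"
        proof -
          have "ennreal (circle_mean r (\<lambda>z. cmod (f z) powr p)) \<le> hardy_pow p f"
            unfolding hardy_pow_eq[OF f p] by (rule SUP_upper[OF r])
          also have "\<dots> \<le> ennreal 1" using f1 True by simp
          finally show ?thesis .
        qed
        then have "circle_mean r (\<lambda>z. cmod (f z) powr p) \<le> 1" by (simp only: ennreal_le_iff zero_le_one)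
        then have "K * circle_mean r (\<lambda>z. cmod (f z) powr p) \<le> K * 1" using K by (intro mult_left_mono)
        ultimately show ?thesis by (intro ennreal_leI) linarith
      qed
      then show ?thesis using True unfolding hardy_pow_eq[OF u p] by (auto intro!: SUP_least)
    next
      case False
      then have \<alpha>': "-1 < \<alpha>" using \<alpha> by simp
      have "bergman_pow \<alpha> p u \<le> ennreal K"
      proof (rule bergman_pow_le[OF u p \<alpha>'])
        fix R :: real assume R: "0 \<le> R" "R < 1"
        interpret disc_mean "bergman_mean \<alpha> R" by (rule disc_mean_bergman_mean[OF R(2)])
        have "carleson (\<lambda>z. cmod2 (g z / of_real Q) powr \<sigma> * cmod2 (deriv g z / of_real Q)) (1 + 2 / (\<alpha> + 1))"
        proof (rule bergman_carleson[OF _ \<alpha>' R])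
          fix z assume z: "z \<in> unit_disc"
          show "(1 - cmod2 z)\<^sup>2 * (cmod2 (g z / of_real Q) powr \<sigma> * cmod2 (deriv g z / of_real Q)) \<le> 1"
            using bloch_normalized[OF g _ Q _ z, of "\<sigma> + 1"] gn False \<sigma>0 by (simp add: Bq_alpha_norm_def)
        qed
        then have "carleson (\<lambda>z. cmod2 (g z / of_real Q) powr \<sigma> * cmod2 (deriv g z / of_real Q)) \<kappa>"
          using False by (simp add: \<kappa>_def)
        from iterated_paraproduct_bound[OF g f less_imp_le[OF \<sigma>0] \<sigma> n q(1) \<kappa> Q this]
        have "bergman_mean \<alpha> R (\<lambda>z. cmod (u z) powr p) \<le> K * bergman_mean \<alpha> R (\<lambda>z. cmod (f z) powr p)"
          unfolding q(2) u_def[symmetric] B_def[symmetric] K_def[symmetric] .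
        then have "(\<alpha> + 1) * bergman_mean \<alpha> R (\<lambda>z. cmod (u z) powr p) \<le> (\<alpha> + 1) * (K * bergman_mean \<alpha> R (\<lambda>z. cmod (f z) powr p))"
          using \<alpha>' by (intro mult_left_mono) auto
        also have "\<dots> = K * ((\<alpha> + 1) * bergman_mean \<alpha> R (\<lambda>z. cmod (f z) powr p))" by simp
        also have "\<dots> \<le> K * 1"
        proof (rule mult_left_mono[OF _ K])
          note bergman_pow_polar(1)[OF f p \<alpha>' R]
          also have "bergman_pow \<alpha> p f \<le> ennreal 1" using f1 False by simp
          finally show "(\<alpha> + 1) * bergman_mean \<alpha> R (\<lambda>z. cmod (f z) powr p) \<le> 1" by (simp only: ennreal_le_iff zero_le_one)
        qed
        finally show "ennreal ((\<alpha> + 1) * bergman_mean \<alpha> R (\<lambda>z. cmod (u z) powr p)) \<le> ennreal K"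
          by (intro ennreal_leI) simp
      qed
      then show ?thesis using False by simp
    qed
    then have "Apnorm \<alpha> p u \<le> ennreal (K powr (1 / p))"
      unfolding Apnorm_def by (rule enn_root_leI[OF _ p K])
    also have "K powr (1 / p) = B powr (1 / p) * Q ^ (m + n)"
      using p Q B by (simp add: K_def powr_mult powr_powr powr_realpow[symmetric] del: of_nat_add)
    finally show ?thesis unfolding u_def .
  qed
  moreover have "0 < B powr (1 / p)" using B by simp
  ultimately show ?thesis by blast
qed

theorem theorem6p1:
  fixes \<alpha> p s :: real and m n :: nat
  assumes "\<alpha> \<ge> -1" and "0 < p" and "m \<ge> 1" and "n \<ge> 2"
    and "s = real m / real n + 1"
  shows "\<exists>C>0. \<forall>g. g holomorphic_on ball 0 1 \<longrightarrow>
           opnorm \<alpha> p ((S_op g ^^ m) \<circ> (T_op g ^^ n))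
             \<le> ennreal C * Bq_alpha_norm \<alpha> s g ^ nat \<lceil>s * real n\<rceil>"
proof -
  define \<sigma> where "\<sigma> = real m / real n"
  have \<sigma>: "real m = real n * \<sigma>" "s = \<sigma> + 1" using assms by (auto simp: \<sigma>_def)
  have "s * real n = real (m + n)" using assms(4,5) by (simp add: field_simps)
  \<comment> \<open>s n is the integer m + n, so rounding up in the exponent is exact.\<close>
  then have exp: "nat \<lceil>s * real n\<rceil> = m + n" by (simp only: ceiling_of_nat nat_int)
  have n1: "1 \<le> n" using assms(4) by simp
  obtain C where C: "0 < C" and bound: "\<And>g f Q. \<lbrakk>g holomorphic_on unit_disc; f holomorphic_on unit_disc;
     Apnorm \<alpha> p f \<le> 1; 0 < Q; Bq_alpha_norm \<alpha> s g \<le> ennreal Q\<rbrakk> \<Longrightarrow>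
     Apnorm \<alpha> p ((S_op g ^^ m) ((T_op g ^^ n) f)) \<le> ennreal (C * Q ^ (m + n))"
    using Apnorm_paraproduct_bound[OF assms(1-3) n1 \<sigma>(1)] unfolding \<sigma>(2) by blast
  have "opnorm \<alpha> p ((S_op g ^^ m) \<circ> (T_op g ^^ n)) \<le> ennreal C * Bq_alpha_norm \<alpha> s g ^ (m + n)"
    if g: "g holomorphic_on unit_disc" for g
  proof (cases "Bq_alpha_norm \<alpha> s g")
    case top
    \<comment> \<open>m + n > 0 matters here, since a zeroth power would be 1; with C > 0 the
      right-hand side is then infinite.\<close>
    have "(\<infinity>::ennreal) ^ (m + n) = \<infinity>" using assms(3) by (cases m) (auto simp: ennreal_top_mult)
    then show ?thesis using C top by (simp add: ennreal_mult_top)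
  next
    case (real b)
    \<comment> \<open>The norm \<open>b\<close> may be 0, so the bound is applied with b + e in
      place of \<open>b\<close> and e tends to 0 afterwards.\<close>
    have le: "opnorm \<alpha> p ((S_op g ^^ m) \<circ> (T_op g ^^ n)) \<le> ennreal (C * (b + e) ^ (m + n))" if e: "0 < e" for e
      unfolding opnorm_def
    proof (rule SUP_least)
      fix f assume "f \<in> {f. in_Ap \<alpha> p f \<and> Apnorm \<alpha> p f \<le> 1}"
      then show "Apnorm \<alpha> p (((S_op g ^^ m) \<circ> (T_op g ^^ n)) f) \<le> ennreal (C * (b + e) ^ (m + n))"
        using bound[OF g, of f "b + e"] real e by (auto simp: in_Ap_def ennreal_leI)
    qed
    have "((\<lambda>e. ennreal (C * (b + e) ^ (m + n))) \<longlongrightarrow> ennreal (C * (b + 0) ^ (m + n))) (at_right 0)"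
      by (intro tendsto_ennrealI tendsto_intros)
    then have "opnorm \<alpha> p ((S_op g ^^ m) \<circ> (T_op g ^^ n)) \<le> ennreal (C * (b + 0) ^ (m + n))"
    proof (rule tendsto_lowerbound)
      show "\<forall>\<^sub>F e in at_right 0. opnorm \<alpha> p ((S_op g ^^ m) \<circ> (T_op g ^^ n)) \<le> ennreal (C * (b + e) ^ (m + n))"
        using le by (auto simp: eventually_at_filter)
    qed simp
    then show ?thesis using C real by (simp add: ennreal_mult' ennreal_power)
  qed
  with C show ?thesis unfolding exp by blast
qed

end
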